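(* Let $d\ge 3$. There are no 3-pseudo-reflective local $C^\infty$-smooth (real) projective billiards in $\mathbb{R}^d$.
   Context: $\mathbb{P}(T\mathbb{R}^d)$ is the set of pairs $(A,L)$ with $A\in\mathbb{R}^d$ and $L$ a line through $A$ (identified with a 1-dimensional subspace of $T_A\mathbb{R}^d$); $\pi(A,L)=A$. A line-framed hypersurface is a regularly embedded connected $(d-1)$-dimensional submanifold $\alpha\subset\mathbb{P}(T\mathbb{R}^d)$ such that $\pi$ sends $\alpha$ diffeomorphically onto a regularly embedded hypersurface $a\subset\mathbb{R}^d$ (its classical boundary), and for every $(A,L)\in\alpha$ the line $L$ is transversal to $T_Aa$. A local projective billiard is a collection of germs of line-framed hypersurfaces $\alpha_1,\dots,\alpha_k$, with classical boundaries $a_1,\dots,a_k$; it is $C^\infty$-smooth if all $\alpha_j$ are. Symmetry of lines: let $(A,L)\in\alpha$, with classical boundary $a$. Two lines $\ell,\ell^*$ through $A$ are symmetric with respect to $(L,T_Aa)$ if $\ell,\ell^*,L$ lie in a common 2-dimensional subspace $\Pi\subset T_A\mathbb{R}^d$ and, with $T=\Pi\cap T_Aa$, either $\ell=\ell^*=L$, or $\ell=\ell^*=T$, or $L,T,\ell,\ell^*$ are distinct and harmonic, i.e. the cross-ratio $(L,T;\ell,\ell^* )$ of these four lines of $\Pi$ equals $-1$ (equivalently, $\ell,\ell^*$ are exchanged by the linear involution of $\Pi$ that is the identity on $L$ and minus the identity on $T$). A $k$-periodic orbit of a local projective billiard is a $k$-tuple $(A_1,L_1),\dots,(A_k,L_k)$,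 $(A_j,L_j)\in\alpha_j$, such that for every $j=1,\dots,k$ (indices cyclic) $A_j\ne A_{j\pm1}$, and the lines $A_{j-1}A_j$, $A_jA_{j+1}$ are not tangent to $a_j$ at $A_j$ and are symmetric with respect to $(L_j,T_{A_j}a_j)$. The billiard is $k$-pseudo-reflective if its base points form a $k$-periodic orbit and, for all sufficiently small representatives of the germs, there is a subset of $\alpha_1\times\alpha_2$ of positive Lebesgue measure such that every pair in it extends to a $k$-periodic orbit close to the base orbit. *)

theory Defs
  imports "HOL-Analysis.Analysis"
begin

section \<open>Smooth maps and submanifolds of Euclidean spaces\<close>

text \<open>\<open>Ck n U f\<close> (for open \<open>U\<close>): \<open>f\<close> is \<open>n\<close> times continuously differentiable on \<open>U\<close>. In finite
  dimension it suffices that all directional derivatives \<open>x \<mapsto> f' x v\<close> are of class \<open>n - 1\<close>.\<close>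

primrec Ck :: "nat \<Rightarrow> 'a::euclidean_space set \<Rightarrow> ('a \<Rightarrow> 'b::euclidean_space) \<Rightarrow> bool" where
  "Ck 0 U f \<longleftrightarrow> continuous_on U f"
| "Ck (Suc n) U f \<longleftrightarrow>
     (\<exists>f'. (\<forall>x\<in>U. (f has_derivative f' x) (at x)) \<and> (\<forall>v. Ck n U (\<lambda>x. f' x v)))"

text \<open>On an arbitrary subset, smoothness means having local smooth extensions.\<close>

definition smooth_on :: "'a::euclidean_space set \<Rightarrow> ('a \<Rightarrow> 'b::euclidean_space) \<Rightarrow> bool" where
  "smooth_on S f \<longleftrightarrow>
     (\<forall>x\<in>S. \<exists>U g. open U \<and> x \<in> U \<and> (\<forall>n. Ck n U g) \<and> (\<forall>y\<in>U \<inter> S. g y = f y))"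

definition diffeomorphism ::
  "'a::euclidean_space set \<Rightarrow> 'b::euclidean_space set \<Rightarrow> ('a \<Rightarrow> 'b) \<Rightarrow> ('b \<Rightarrow> 'a) \<Rightarrow> bool" where
  "diffeomorphism S T f g \<longleftrightarrow> homeomorphism S T f g \<and> smooth_on S f \<and> smooth_on T g"

text \<open>A slice chart straightens \<open>S \<inter> U\<close> to an open piece of an \<open>m\<close>-dimensional coordinate subspace.\<close>

definition slice_chart ::
  "nat \<Rightarrow> 'a::euclidean_space set \<Rightarrow> 'a set \<Rightarrow> 'a set \<Rightarrow> ('a \<Rightarrow> 'a) \<Rightarrow> 'a set \<Rightarrow> bool" where
  "slice_chart m S U V \<phi> B \<longleftrightarrow>
     open U \<and> open V \<and> (\<exists>\<psi>. diffeomorphism U V \<phi> \<psi>) \<and>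
     B \<subseteq> Basis \<and> card B = m \<and> \<phi> ` (U \<inter> S) = V \<inter> span B"

definition embedded_submanifold :: "nat \<Rightarrow> 'a::euclidean_space set \<Rightarrow> bool" where
  "embedded_submanifold m S \<longleftrightarrow> (\<forall>x\<in>S. \<exists>U V \<phi> B. x \<in> U \<and> slice_chart m S U V \<phi> B)"

text \<open>Velocities at \<open>A\<close> of smooth curves in \<open>S\<close>.\<close>

definition tangent_space :: "'a::euclidean_space set \<Rightarrow> 'a \<Rightarrow> 'a set" where
  "tangent_space S A =
     {v. \<exists>c \<epsilon>. 0 < \<epsilon> \<and> smooth_on (ball (0::real) \<epsilon>) c \<and> c ` ball 0 \<epsilon> \<subseteq> S \<and> c 0 = A \<and>
           (c has_vector_derivative v) (at 0)}"

text \<open>Lebesgue measure of the coordinate subspace spanned by \<open>B \<subseteq> Basis\<close>, viewed as a measure on the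
  ambient space; for \<open>B = Basis\<close> this is \<^term>\<open>lebesgue\<close>.\<close>

definition span_lebesgue :: "'a::euclidean_space set \<Rightarrow> 'a measure" where
  "span_lebesgue B =
     completion (distr (PiM B (\<lambda>_. lborel)) borel (\<lambda>x. \<Sum>b\<in>B. x b *\<^sub>R b))"

text \<open>A subset of a submanifold is Lebesgue measurable if it is so in all charts, and then has
  positive Lebesgue measure if it has so in some chart; neither notion depends on a choice of a
  smooth density.\<close>

definition positive_lebesgue_measure_in :: "nat \<Rightarrow> 'a::euclidean_space set \<Rightarrow> 'a set \<Rightarrow> bool" where
  "positive_lebesgue_measure_in m S P \<longleftrightarrow>
     P \<subseteq> S \<and>
     (\<forall>U V \<phi> B. slice_chart m S U V \<phi> B \<longrightarrow> \<phi> ` (U \<inter> P) \<in> sets (span_lebesgue B)) \<and>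
     (\<exists>U V \<phi> B. slice_chart m S U V \<phi> B \<and> emeasure (span_lebesgue B) (\<phi> ` (U \<inter> P)) > 0)"


section \<open>The projectivized tangent bundle\<close>

text \<open>A line through \<open>A\<close> is given by its direction, a one-dimensional linear subspace.\<close>

type_synonym 'n framed_point = "(real^'n) \<times> (real^'n) set"

definition proj_tangent_bundle :: "'n::finite framed_point set" where
  "proj_tangent_bundle = {(A, L). subspace L \<and> dim L = 1}"

text \<open>The manifold structure of the projectivized tangent bundle is the one of its standard
  embedding into a Euclidean space, which replaces a line by the matrix of the orthogonal
  projection onto it (see \<open>proj_embed_span\<close> below: in homogeneous coordinates the line \<open>[v]\<close> has the
  matrix \<open>(v\<^sub>i v\<^sub>j / |v|\<^sup>2)\<close>). Topological, smooth and measure-theoretic notions for subsets of the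
  bundle are those of their images.\<close>

definition proj_embed :: "'n::finite framed_point \<Rightarrow> (real^'n) \<times> (real^'n^'n)" where
  "proj_embed p = (fst p, matrix (closest_point (snd p)))"

lemma proj_embed_span:
  fixes v :: "real^'n::finite"
  assumes "v \<noteq> 0"
  shows "proj_embed (A, span {v}) = (A, \<chi> i j. v $ i * v $ j / (v \<bullet> v))"
proof -
  have vv: "v \<bullet> v > 0" using assms by simp
  have cp: "closest_point (span {v}) x = (x \<bullet> v / (v \<bullet> v)) *\<^sub>R v" for x
  proof (rule closest_point_unique[symmetric])
    show "convex (span {v})" "closed (span {v})"
      by (simp_all add: subspace_imp_convex closed_subspace)
    show "(x \<bullet> v / (v \<bullet> v)) *\<^sub>R v \<in> span {v}" by (simp add: span_base span_mul)
    show "\<forall>z\<in>span {v}. dist x ((x \<bullet> v / (v \<bullet> v)) *\<^sub>R v) \<le> dist x z"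
    proof
      fix z assume "z \<in> span {v}"
      then obtain t where t: "z = t *\<^sub>R v" by (auto simp: span_singleton)
      define y where "y = x - (x \<bullet> v / (v \<bullet> v)) *\<^sub>R v"
      define s where "s = x \<bullet> v / (v \<bullet> v) - t"
      have o: "y \<bullet> v = 0" using vv by (simp add: y_def inner_diff_left)
      have xz: "x - z = y + s *\<^sub>R v" by (simp add: y_def s_def t algebra_simps)
      have "(norm y)\<^sup>2 \<le> (norm (y + s *\<^sub>R v))\<^sup>2"
        using o vv by (simp add: power2_norm_eq_inner inner_add_left inner_add_right inner_commute
            mult.assoc[symmetric])
      then have "norm y \<le> norm (y + s *\<^sub>R v)" by (rule power2_le_imp_le) simp
      then show "dist x ((x \<bullet> v / (v \<bullet> v)) *\<^sub>R v) \<le> dist x z"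
        unfolding dist_norm xz y_def[symmetric] .
    qed
  qed
  show ?thesis
    by (simp add: proj_embed_def matrix_def vec_eq_iff cp inner_axis' mult.commute)
qed

lemma inj_on_proj_embed: "inj_on proj_embed proj_tangent_bundle"
proof (rule inj_onI)
  fix p q :: "'n::finite framed_point"
  assume p: "p \<in> proj_tangent_bundle" and q: "q \<in> proj_tangent_bundle"
    and eq: "proj_embed p = proj_embed q"
  have line: "\<exists>v. v \<noteq> 0 \<and> L = span {v}" if lin: "subspace L" "dim L = 1" for L :: "(real^'n) set"
  proof -
    obtain B where B: "B \<subseteq> L" "independent B" "L \<subseteq> span B" "card B = 1"
      using basis_exists[of L] lin(2) by metis
    then obtain v where "B = {v}" by (auto simp: card_1_singleton_iff)
    with B show ?thesis using lin(1) span_minimal[of B L] by (auto simp: dependent_single)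
  qed
  obtain A v where pv: "p = (A, span {v})" "v \<noteq> 0"
    using p line unfolding proj_tangent_bundle_def by blast
  obtain A' w where qw: "q = (A', span {w})" "w \<noteq> 0"
    using q line unfolding proj_tangent_bundle_def by blast
  have A: "A = A'" and E: "v $ i * v $ j / (v \<bullet> v) = w $ i * w $ j / (w \<bullet> w)" for i j
    using eq pv qw by (simp_all add: proj_embed_span vec_eq_iff)
  have *: "x \<in> span {y}" if nz: "y \<noteq> 0" "x \<noteq> 0"
    and E: "\<And>i j. x $ i * x $ j / (x \<bullet> x) = y $ i * y $ j / (y \<bullet> y)" for x y :: "real^'n"
  proof -
    obtain j where j: "x $ j \<noteq> 0" using nz(2) by (auto simp: vec_eq_iff)
    have "x $ i = (y $ j * (x \<bullet> x) / ((y \<bullet> y) * x $ j)) * y $ i" for i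
      using E[of i j] nz j by (simp add: field_simps)
    then have "x = (y $ j * (x \<bullet> x) / ((y \<bullet> y) * x $ j)) *\<^sub>R y"
      unfolding vec_eq_iff vector_scaleR_component real_scaleR_def by blast
    then show ?thesis by (metis span_base span_mul singletonI)
  qed
  have "v \<in> span {w}" "w \<in> span {v}" using *[of w v] *[of v w] E pv qw by auto
  then have "span {v} = span {w}"
    by (meson subset_antisym empty_subsetI insert_subset span_minimal subspace_span)
  then show "p = q" using A pv qw by simp
qed


section \<open>Local projective billiards\<close>

text \<open>\<open>fst ` \<alpha>\<close> is the classical boundary \<open>a\<close> of \<open>\<alpha>\<close>.\<close>

definition line_framed_hypersurface :: "'n::finite framed_point set \<Rightarrow> bool" where
  "line_framed_hypersurface \<alpha> \<longleftrightarrow>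
     \<alpha> \<subseteq> proj_tangent_bundle \<and>
     embedded_submanifold (CARD('n) - 1) (proj_embed ` \<alpha>) \<and>
     connected (proj_embed ` \<alpha>) \<and>
     embedded_submanifold (CARD('n) - 1) (fst ` \<alpha>) \<and>
     (\<exists>g. diffeomorphism (proj_embed ` \<alpha>) (fst ` \<alpha>) fst g) \<and>
     (\<forall>(A, L)\<in>\<alpha>. {x + y |x y. x \<in> L \<and> y \<in> tangent_space (fst ` \<alpha>) A} = UNIV)"

definition same_germ ::
  "'n::finite framed_point \<Rightarrow> 'n framed_point set \<Rightarrow> 'n framed_point set \<Rightarrow> bool" where
  "same_germ p \<alpha> \<beta> \<longleftrightarrow>
     (\<exists>U. open U \<and> proj_embed p \<in> U \<and> {q\<in>\<alpha>. proj_embed q \<in> U} = {q\<in>\<beta>. proj_embed q \<in> U})"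

text \<open>The germs are given by representatives \<open>\<alpha> 0, \<dots>, \<alpha> (k - 1)\<close> and base points
  \<open>p 0, \<dots>, p (k - 1)\<close>.\<close>

definition local_projective_billiard ::
  "nat \<Rightarrow> (nat \<Rightarrow> 'n::finite framed_point set) \<Rightarrow> (nat \<Rightarrow> 'n framed_point) \<Rightarrow> bool" where
  "local_projective_billiard k \<alpha> p \<longleftrightarrow>
     (\<forall>j<k. line_framed_hypersurface (\<alpha> j) \<and> p j \<in> \<alpha> j)"

definition det2 :: "real \<times> real \<Rightarrow> real \<times> real \<Rightarrow> real" where
  "det2 p q = fst p * snd q - snd p * fst q"

text \<open>The lines have homogeneous coordinates \<open>p\<^sub>1, \<dots>, p\<^sub>4\<close> with respect to a basis \<open>(e, f)\<close> of a plane
  containing them. In terms of slopes \<open>z\<^sub>i\<close> the cross-ratio is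
  \<open>((z\<^sub>3 - z\<^sub>1) (z\<^sub>4 - z\<^sub>2)) / ((z\<^sub>4 - z\<^sub>1) (z\<^sub>3 - z\<^sub>2))\<close>. Only used for distinct lines, for which no
  denominator vanishes.\<close>

definition has_cross_ratio ::
  "'a::real_vector set \<Rightarrow> 'a set \<Rightarrow> 'a set \<Rightarrow> 'a set \<Rightarrow> real \<Rightarrow> bool" where
  "has_cross_ratio L1 L2 L3 L4 r \<longleftrightarrow>
     (\<exists>e f p1 p2 p3 p4.
        e \<noteq> f \<and> independent {e, f} \<and>
        L1 = span {fst p1 *\<^sub>R e + snd p1 *\<^sub>R f} \<and> L2 = span {fst p2 *\<^sub>R e + snd p2 *\<^sub>R f} \<and>
        L3 = span {fst p3 *\<^sub>R e + snd p3 *\<^sub>R f} \<and> L4 = span {fst p4 *\<^sub>R e + snd p4 *\<^sub>R f} \<and>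
        r = (det2 p1 p3 * det2 p2 p4) / (det2 p1 p4 * det2 p2 p3))"

text \<open>Symmetry of the lines \<open>l\<close> and \<open>l'\<close> with respect to the line \<open>L\<close> and the hyperplane \<open>H\<close>.\<close>

definition symmetric_lines :: "'a::euclidean_space set \<Rightarrow> 'a set \<Rightarrow> 'a set \<Rightarrow> 'a set \<Rightarrow> bool" where
  "symmetric_lines L H l l' \<longleftrightarrow>
     (\<exists>E. subspace E \<and> dim E = 2 \<and> l \<subseteq> E \<and> l' \<subseteq> E \<and> L \<subseteq> E \<and>
        (let T = E \<inter> H in
           (l = L \<and> l' = L) \<or> (l = T \<and> l' = T) \<or>
           (distinct [L, T, l, l'] \<and> has_cross_ratio L T l l' (- 1))))"

definition periodic_orbit ::
  "nat \<Rightarrow> (nat \<Rightarrow> 'n::finite framed_point set) \<Rightarrow> (nat \<Rightarrow> 'n framed_point) \<Rightarrow> bool" where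
  "periodic_orbit k \<alpha> q \<longleftrightarrow>
     (\<forall>j<k. q j \<in> \<alpha> j \<and>
        (let A = fst (q j); L = snd (q j);
             A_prev = fst (q ((j + k - 1) mod k)); A_next = fst (q ((j + 1) mod k));
             l = span {A_prev - A}; l' = span {A_next - A};
             H = tangent_space (fst ` \<alpha> j) A
         in A \<noteq> A_prev \<and> A \<noteq> A_next \<and> \<not> l \<subseteq> H \<and> \<not> l' \<subseteq> H \<and> symmetric_lines L H l l'))"

text \<open>The first two hypersurfaces have indices \<open>0\<close> and \<open>1\<close>. Orbits are close to the base orbit in the
  sense that they lie on the given representatives \<open>\<beta> j\<close>, which range over all sufficiently small,
  and hence over arbitrarily small, ones.\<close>

definition pseudo_reflective ::
  "nat \<Rightarrow> (nat \<Rightarrow> 'n::finite framed_point set) \<Rightarrow> (nat \<Rightarrow> 'n framed_point) \<Rightarrow> bool" where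
  "pseudo_reflective k \<alpha> p \<longleftrightarrow>
     periodic_orbit k \<alpha> p \<and>
     (\<exists>W. (\<forall>j<k. open (W j) \<and> proj_embed (p j) \<in> W j) \<and>
        (\<forall>\<beta>. local_projective_billiard k \<beta> p \<and>
              (\<forall>j<k. same_germ (p j) (\<alpha> j) (\<beta> j) \<and> proj_embed ` \<beta> j \<subseteq> W j) \<longrightarrow>
           (\<exists>P \<subseteq> \<beta> 0 \<times> \<beta> 1.
              positive_lebesgue_measure_in (2 * (CARD('n) - 1))
                (proj_embed ` \<beta> 0 \<times> proj_embed ` \<beta> 1) (map_prod proj_embed proj_embed ` P) \<and>
              (\<forall>(x, y)\<in>P. \<exists>q. q 0 = x \<and> q 1 = y \<and> periodic_orbit k \<beta> q))))"

end

theory Submission imports Defs begin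

text \<open>
  Normalize the normal \<open>n\<^sub>A\<close> of the hypersurface and the direction \<open>u\<^sub>A\<close> of the line at \<open>A\<close> by \<open>n\<^sub>A \<bullet> u\<^sub>A = 1\<close>, and
  put \<open>f\<^sub>A(X) = (X - A) / (n\<^sub>A \<bullet> (X - A))\<close>. The reflection law at \<open>A\<close> then reads \<open>f\<^sub>A(B) + f\<^sub>A(C) = 2 u\<^sub>A\<close>. Off
  collinear triangles, \<open>C\<close> is a smooth function of \<open>(A, B)\<close>. A smooth function vanishing on a set of pairs
  has vanishing derivatives at almost every point of that set, since on lines its zeros with nonzero derivative
  are isolated; so the three laws may be differentiated repeatedly on a set of positive measure.

  Since \<open>d \<ge> 3\<close>, the triangle can be moved out of its plane. The components normal to the plane of the first
  derivatives give Ceva's condition: \<open>L\<^sub>A\<close>, \<open>L\<^sub>B\<close>, \<open>L\<^sub>C\<close> are concurrent. Those of the mixed second derivatives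
  say that the common point does not move when the triangle moves within its plane with one vertex fixed. This
  determines the second fundamental forms: for \<open>\<tau> = f\<^sub>A(B) - f\<^sub>A(C)\<close>,
  \<open>D n\<^sub>A(\<tau>) \<bullet> \<tau> = 4 (n\<^sub>B \<bullet> (C - B)) / ((n\<^sub>A \<bullet> (C - A)) (n\<^sub>B \<bullet> (A - B)))\<close>. Moving \<open>B\<close> in the plane with \<open>A\<close> fixed
  rescales \<open>\<tau>\<close>, and the two sides have different logarithmic derivatives.
\<close>

section \<open>Smooth functions on open sets\<close>

text \<open>\<open>cproj\<close> is an affine chart on directions with the tangent directions at
  infinity. Harmonic conjugation becomes a point reflection there, whence the midpoint form of the
  law. Write b, c for \<open>nA \<bullet> (B - A)\<close>, \<open>nA \<bullet> (C - A)\<close>. Then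
  2 u_A = (B-A)/b + (C-A)/c, so L_A meets the line BC in the point with weights 1/b at B and 1/c at
  C, and Ceva's condition is an identity between products of such denominators. With the weight at A
  that L_B imposes, the total weight is kappa = 1/b + 1/c + (n_B.(C-B)) / (c (n_B.(A-B))), and the
  common point is A + (2/kappa) u_A. Its immobility for fixed A therefore means that kappa is
  stationary. The set of orbits may have empty interior, so no orbit can be continued along a curve.
  Vertices are moved on straight lines that leave the hypersurfaces, and the laws hold along them
  only to first order. This forces smooth extensions of all data to open sets, and a new null set
  for every differentiation.\<close>

definition smooth_open :: "'a::euclidean_space set \<Rightarrow> ('a \<Rightarrow> 'b::euclidean_space) \<Rightarrow> bool" where
  "smooth_open U f \<longleftrightarrow> (\<forall>n. Ck n U f)"

lemma Ck_subset: "Ck n U f \<Longrightarrow> V \<subseteq> U \<Longrightarrow> Ck n V f"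
proof (induction n arbitrary: f)
  case 0
  then show ?case by (auto intro: continuous_on_subset)
next
  case (Suc n)
  then obtain f' where f': "\<forall>x\<in>U. (f has_derivative f' x) (at x)" "\<forall>v. Ck n U (\<lambda>x. f' x v)"
    by auto
  have "Ck n V (\<lambda>x. f' x v)" for v using Suc.IH Suc.prems(2) f'(2) by blast
  with f'(1) Suc.prems(2) show ?case unfolding Ck.simps by blast
qed

lemma Ck_SucD: "Ck (Suc n) U f \<Longrightarrow> Ck n U f"
proof (induction n arbitrary: f)
  case 0
  then obtain f' where "\<forall>x\<in>U. (f has_derivative f' x) (at x)" by auto
  then show ?case unfolding Ck.simps
    using continuous_at_imp_continuous_on has_derivative_continuous by blast
next
  case (Suc n)
  then obtain f' where f': "\<forall>x\<in>U. (f has_derivative f' x) (at x)" "\<forall>v. Ck (Suc n) U (\<lambda>x. f' x v)"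
    unfolding Ck.simps(2)[of "Suc n"] by blast
  then have "\<forall>v. Ck n U (\<lambda>x. f' x v)" using Suc.IH by blast
  with f' show ?case unfolding Ck.simps(2)[of n] by blast
qed

lemma Ck_cong:
  assumes "open U" "\<And>x. x \<in> U \<Longrightarrow> f x = g x" "Ck n U f"
  shows "Ck n U g"
proof (cases n)
  case 0
  then show ?thesis using assms continuous_on_cong by fastforce
next
  case (Suc m)
  then obtain f' where f': "\<forall>x\<in>U. (f has_derivative f' x) (at x)" "\<forall>v. Ck m U (\<lambda>x. f' x v)"
    using assms(3) by auto
  have "\<forall>x\<in>U. (g has_derivative f' x) (at x)"
    using f'(1) assms(1,2) by (metis has_derivative_transform_within_open)
  with f'(2) show ?thesis unfolding Suc by auto
qed

lemma Ck_Suc_derivD: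
  assumes "open U" "Ck (Suc n) U f" "\<And>x. x \<in> U \<Longrightarrow> (f has_derivative f' x) (at x)"
  shows "Ck n U (\<lambda>x. f' x v)"
proof -
  obtain g where g: "\<forall>x\<in>U. (f has_derivative g x) (at x)" "\<forall>v. Ck n U (\<lambda>x. g x v)"
    using assms(2) by auto
  have "g x v = f' x v" if "x \<in> U" for x
    using has_derivative_unique g(1) assms(3) that by metis
  then show ?thesis using Ck_cong[OF assms(1), of "\<lambda>x. g x v" "\<lambda>x. f' x v" n] g(2) by simp
qed

lemma Ck_local:
  assumes "\<And>x. x \<in> U \<Longrightarrow> \<exists>W. open W \<and> x \<in> W \<and> Ck n W f"
  shows "Ck n U f"
  using assms
proof (induction n arbitrary: f)
  case 0
  show ?case unfolding Ck.simps
  proof (rule continuous_at_imp_continuous_on, rule ballI)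
    fix x assume "x \<in> U"
    then obtain W where "open W" "x \<in> W" "continuous_on W f" using 0 by force
    then show "isCont f x" using continuous_on_eq_continuous_at by blast
  qed
next
  case (Suc n)
  \<comment> \<open>A choice of derivative that does not depend on the neighbourhood, so that the
    local witnesses glue.\<close>
  define f' where "f' = (\<lambda>x. frechet_derivative f (at x))"
  have loc: "\<exists>W. open W \<and> x \<in> W \<and> (\<forall>y\<in>W. (f has_derivative f' y) (at y)) \<and> Ck (Suc n) W f"
    if xU: "x \<in> U" for x
  proof -
    obtain W where W: "open W" "x \<in> W" "Ck (Suc n) W f" using Suc.prems[OF xU] by metis
    then have "\<forall>y\<in>W. (f has_derivative f' y) (at y)"
      unfolding f'_def by (metis Ck.simps(2) frechet_derivative_works differentiable_def)
    with W show ?thesis by blast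
  qed
  have "Ck n U (\<lambda>x. f' x v)" for v
  proof (rule Suc.IH)
    fix x assume "x \<in> U"
    then show "\<exists>W. open W \<and> x \<in> W \<and> Ck n W (\<lambda>x. f' x v)"
      using loc Ck_Suc_derivD by metis
  qed
  moreover have "\<forall>x\<in>U. (f has_derivative f' x) (at x)" using loc by metis
  ultimately show ?case unfolding Ck.simps by blast
qed

lemma Ck_const: "Ck n U (\<lambda>_. c)"
proof (induction n arbitrary: c)
  case (Suc n)
  show ?case unfolding Ck.simps
    by (rule exI[of _ "\<lambda>_ _. 0"]) (use Suc in auto)
qed simp

lemma Ck_linear:
  assumes "bounded_linear f" shows "Ck n U f"
proof (cases n)
  case 0
  then show ?thesis using assms linear_continuous_on by auto
next
  case (Suc m)
  show ?thesis unfolding Suc Ck.simps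
    by (rule exI[of _ "\<lambda>_. f"]) (use Ck_const assms bounded_linear_imp_has_derivative in blast)
qed

lemma Ck_add: "Ck n U f \<Longrightarrow> Ck n U g \<Longrightarrow> Ck n U (\<lambda>x. f x + g x)"
proof (induction n arbitrary: f g)
  case 0
  then show ?case by (auto intro: continuous_intros)
next
  case (Suc n)
  then obtain f' g' where *: "\<forall>x\<in>U. (f has_derivative f' x) (at x)" "\<forall>v. Ck n U (\<lambda>x. f' x v)"
     "\<forall>x\<in>U. (g has_derivative g' x) (at x)" "\<forall>v. Ck n U (\<lambda>x. g' x v)" by auto
  then show ?case unfolding Ck.simps
    by (intro exI[of _ "\<lambda>x v. f' x v + g' x v"]) (auto intro!: Suc.IH has_derivative_add)
qed

lemma Ck_bilinear:
  assumes "bounded_bilinear pr"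
  shows "Ck n U f \<Longrightarrow> Ck n U g \<Longrightarrow> Ck n U (\<lambda>x. pr (f x) (g x))"
proof (induction n arbitrary: f g)
  case 0
  then show ?case by (auto intro: bounded_bilinear.continuous_on[OF assms])
next
  case (Suc n)
  then obtain f' g' where *: "\<forall>x\<in>U. (f has_derivative f' x) (at x)" "\<forall>v. Ck n U (\<lambda>x. f' x v)"
     "\<forall>x\<in>U. (g has_derivative g' x) (at x)" "\<forall>v. Ck n U (\<lambda>x. g' x v)" by auto
  have "Ck n U f" "Ck n U g" using Suc.prems Ck_SucD by blast+
  with * show ?case unfolding Ck.simps
    by (intro exI[of _ "\<lambda>x v. pr (f x) (g' x v) + pr (f' x v) (g x)"])
       (auto intro!: Suc.IH Ck_add bounded_bilinear.FDERIV[OF assms])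
qed

lemma Ck_sum: "finite I \<Longrightarrow> (\<And>i. i \<in> I \<Longrightarrow> Ck n U (f i)) \<Longrightarrow> Ck n U (\<lambda>x. \<Sum>i\<in>I. f i x)"
  by (induction I rule: finite_induct) (auto simp: Ck_const Ck_add)

lemma Ck_linear_compose:
  assumes "bounded_linear l" shows "Ck n U f \<Longrightarrow> Ck n U (\<lambda>x. l (f x))"
proof (induction n arbitrary: f)
  case 0
  then show ?case using bounded_linear.continuous_on[OF assms] by auto
next
  case (Suc n)
  then obtain f' where *: "\<forall>x\<in>U. (f has_derivative f' x) (at x)" "\<forall>v. Ck n U (\<lambda>x. f' x v)" by auto
  then show ?case unfolding Ck.simps
    by (intro exI[of _ "\<lambda>x v. l (f' x v)"])
       (auto intro!: Suc.IH bounded_linear.has_derivative[OF assms])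
qed

lemma deriv_in_coordinates:
  assumes "linear f"
  shows "f v = (\<Sum>i\<in>Basis. (v \<bullet> i) *\<^sub>R f i)"
  by (subst euclidean_representation[of v, symmetric])
     (simp add: linear_sum[OF assms] linear_scale[OF assms])

lemma Ck_compose:
  fixes f :: "'b::euclidean_space \<Rightarrow> 'c::euclidean_space" and g :: "'a::euclidean_space \<Rightarrow> 'b"
  shows "Ck n V f \<Longrightarrow> Ck n U g \<Longrightarrow> g ` U \<subseteq> V \<Longrightarrow> Ck n U (\<lambda>x. f (g x))"
proof (induction n arbitrary: f g)
  case 0
  then show ?case by (auto intro: continuous_on_compose2)
next
  case (Suc n)
  then obtain f' g' where *: "\<forall>x\<in>V. (f has_derivative f' x) (at x)" "\<forall>v. Ck n V (\<lambda>x. f' x v)"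
     "\<forall>x\<in>U. (g has_derivative g' x) (at x)" "\<forall>v. Ck n U (\<lambda>x. g' x v)" by auto
  have g: "Ck n U g" using Suc.prems Ck_SucD by blast
  \<comment> \<open>\<open>Ck\<close> controls a derivative in fixed directions only, while the
    chain rule applies \<open>f'\<close> to the moving direction \<open>g' x v\<close>. Expanding
    that direction in the basis leaves products of functions covered by the induction
    hypothesis.\<close>
  define h where "h = (\<lambda>x v. \<Sum>i\<in>Basis. (g' x v \<bullet> i) *\<^sub>R f' (g x) i)"
  have "((\<lambda>x. f (g x)) has_derivative h x) (at x)" if "x \<in> U" for x
  proof -
    have gx: "g x \<in> V" using that Suc.prems by auto
    have "linear (f' (g x))" using *(1) gx has_derivative_linear by blast
    then have "h x = (\<lambda>v. f' (g x) (g' x v))"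
      unfolding h_def using deriv_in_coordinates by metis
    then show ?thesis using has_derivative_compose[of g "g' x" x UNIV f "f' (g x)"] *(1,3) gx that by auto
  qed
  moreover have "Ck n U (\<lambda>x. h x v)" for v
    unfolding h_def
    by (intro Ck_sum Ck_bilinear[OF bounded_bilinear_scaleR] Ck_linear_compose[OF bounded_linear_inner_left]
        Suc.IH finite_Basis) (use * g Suc.prems in auto)
  ultimately show ?case by auto
qed

lemma Ck_inverse: "Ck n (- {0::real}) inverse"
proof (induction n)
  case 0
  show ?case by (auto intro!: continuous_intros)
next
  case (Suc n)
  have "Ck n (- {0::real}) (\<lambda>x. - (inverse x * v * inverse x))" for v
    by (intro Ck_linear_compose[OF bounded_linear_minus[OF bounded_linear_ident]]
      Ck_bilinear[OF bounded_bilinear_mult] Suc Ck_const)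
  then show ?case unfolding Ck.simps
    by (intro exI[of _ "\<lambda>x v. - (inverse x * v * inverse x)"]) (auto intro!: has_derivative_inverse')
qed

section \<open>Closure properties of smooth functions on open sets\<close>

lemma smooth_open_subset: "smooth_open U f \<Longrightarrow> V \<subseteq> U \<Longrightarrow> smooth_open V f"
  unfolding smooth_open_def using Ck_subset by blast

lemma smooth_open_cong:
  "open U \<Longrightarrow> (\<And>x. x \<in> U \<Longrightarrow> f x = g x) \<Longrightarrow> smooth_open U f \<Longrightarrow> smooth_open U g"
  unfolding smooth_open_def using Ck_cong by blast

lemma smooth_open_local:
  assumes "\<And>x. x \<in> U \<Longrightarrow> \<exists>W. open W \<and> x \<in> W \<and> smooth_open W f"
  shows "smooth_open U f"
  using assms Ck_local unfolding smooth_open_def by (metis (no_types, lifting))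

lemma smooth_open_const: "smooth_open U (\<lambda>_. c)"
  by (simp add: smooth_open_def Ck_const)

lemma smooth_open_linear: "bounded_linear f \<Longrightarrow> smooth_open U f"
  by (simp add: smooth_open_def Ck_linear)

lemma smooth_open_linear_compose:
  "bounded_linear l \<Longrightarrow> smooth_open U f \<Longrightarrow> smooth_open U (\<lambda>x. l (f x))"
  by (simp add: smooth_open_def Ck_linear_compose)

lemma smooth_open_ident: "smooth_open U (\<lambda>x. x)"
  by (intro smooth_open_linear bounded_linear_ident)

lemma smooth_open_fst: "smooth_open U f \<Longrightarrow> smooth_open U (\<lambda>x. fst (f x))"
  by (rule smooth_open_linear_compose[OF bounded_linear_fst])

lemma smooth_open_snd: "smooth_open U f \<Longrightarrow> smooth_open U (\<lambda>x. snd (f x))"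
  by (rule smooth_open_linear_compose[OF bounded_linear_snd])

lemma smooth_open_add: "smooth_open U f \<Longrightarrow> smooth_open U g \<Longrightarrow> smooth_open U (\<lambda>x. f x + g x)"
  by (simp add: smooth_open_def Ck_add)

lemma smooth_open_minus: "smooth_open U f \<Longrightarrow> smooth_open U (\<lambda>x. - f x)"
  by (rule smooth_open_linear_compose[OF bounded_linear_minus[OF bounded_linear_ident]])

lemma smooth_open_diff: "smooth_open U f \<Longrightarrow> smooth_open U g \<Longrightarrow> smooth_open U (\<lambda>x. f x - g x)"
  using smooth_open_add[of U f "\<lambda>x. - g x"] smooth_open_minus by auto

lemma smooth_open_bilinear:
  "bounded_bilinear pr \<Longrightarrow> smooth_open U f \<Longrightarrow> smooth_open U g \<Longrightarrow> smooth_open U (\<lambda>x. pr (f x) (g x))"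
  by (simp add: smooth_open_def Ck_bilinear)

lemmas smooth_open_scaleR = smooth_open_bilinear[OF bounded_bilinear_scaleR]
lemmas smooth_open_inner = smooth_open_bilinear[OF bounded_bilinear_inner]
lemmas smooth_open_mult = smooth_open_bilinear[OF bounded_bilinear_mult[where 'a = real]]

lemma smooth_open_sum:
  "finite I \<Longrightarrow> (\<And>i. i \<in> I \<Longrightarrow> smooth_open U (f i)) \<Longrightarrow> smooth_open U (\<lambda>x. \<Sum>i\<in>I. f i x)"
  by (simp add: smooth_open_def Ck_sum)

lemma smooth_open_compose:
  "smooth_open V f \<Longrightarrow> smooth_open U g \<Longrightarrow> (\<And>x. x \<in> U \<Longrightarrow> g x \<in> V) \<Longrightarrow> smooth_open U (\<lambda>x. f (g x))"
  unfolding smooth_open_def using Ck_compose[of _ V f U g] by blast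

lemma smooth_open_inverse:
  fixes f :: "'a::euclidean_space \<Rightarrow> real"
  shows "smooth_open U f \<Longrightarrow> (\<And>x. x \<in> U \<Longrightarrow> f x \<noteq> 0) \<Longrightarrow> smooth_open U (\<lambda>x. inverse (f x))"
  by (rule smooth_open_compose[where V = "- {0}"]) (auto simp: smooth_open_def Ck_inverse)

lemma smooth_open_divide:
  fixes f :: "'a::euclidean_space \<Rightarrow> real"
  shows "smooth_open U f \<Longrightarrow> smooth_open U g \<Longrightarrow> (\<And>x. x \<in> U \<Longrightarrow> g x \<noteq> 0) \<Longrightarrow> smooth_open U (\<lambda>x. f x / g x)"
  unfolding divide_inverse by (intro smooth_open_mult smooth_open_inverse)

lemma smooth_open_continuous_on: "smooth_open U f \<Longrightarrow> continuous_on U f"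
  unfolding smooth_open_def by (metis Ck.simps(1))

lemma smooth_open_has_derivative:
  assumes "smooth_open U f" "x \<in> U"
  shows "(f has_derivative frechet_derivative f (at x)) (at x)"
proof -
  have "Ck (Suc 0) U f" using assms(1) unfolding smooth_open_def by blast
  then have "f differentiable (at x)" using assms(2) unfolding differentiable_def by auto
  then show ?thesis by (simp add: frechet_derivative_works)
qed

text \<open>The direction \<open>a x\<close> may vary with the point. This is what allows a
  derivative along a smooth tangent field to be differentiated again.\<close>

lemma smooth_open_deriv:
  assumes "open U" "smooth_open U f" "smooth_open U a"
    "\<And>x. x \<in> U \<Longrightarrow> (f has_derivative f' x) (at x)"
  shows "smooth_open U (\<lambda>x. f' x (a x))"
proof -
  have c: "smooth_open U (\<lambda>x. f' x v)" for v
    using assms(2,4) Ck_Suc_derivD[OF assms(1)] unfolding smooth_open_def by blast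
  have "smooth_open U (\<lambda>x. \<Sum>i\<in>Basis. (a x \<bullet> i) *\<^sub>R f' x i)"
    by (intro smooth_open_sum smooth_open_scaleR smooth_open_inner c assms(3) smooth_open_const finite_Basis)
  moreover have "(\<Sum>i\<in>Basis. (a x \<bullet> i) *\<^sub>R f' x i) = f' x (a x)" if "x \<in> U" for x
    using deriv_in_coordinates[OF has_derivative_linear[OF assms(4)[OF that]]] by metis
  ultimately show ?thesis using smooth_open_cong[OF assms(1)] by (metis (no_types, lifting))
qed

lemma smooth_open_Pair:
  assumes "smooth_open U f" "smooth_open U g" shows "smooth_open U (\<lambda>x. (f x, g x))"
proof -
  have "smooth_open U (\<lambda>x. (f x, 0) + (0, g x))"
    by (intro smooth_open_add smooth_open_linear_compose[OF _ assms(1)]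
        smooth_open_linear_compose[OF _ assms(2)] bounded_linear_Pair bounded_linear_ident bounded_linear_zero)
  then show ?thesis by simp
qed

lemma smooth_on_open_iff:
  assumes "open U" shows "smooth_on U f \<longleftrightarrow> smooth_open U f"
proof
  assume *: "smooth_on U f"
  show "smooth_open U f"
  proof (rule smooth_open_local)
    fix x assume "x \<in> U"
    then obtain W g where W: "open W" "x \<in> W" "smooth_open W g" "\<forall>y\<in>W \<inter> U. g y = f y"
      using * unfolding smooth_on_def smooth_open_def by blast
    then have "smooth_open (W \<inter> U) f"
      using smooth_open_cong[of "W \<inter> U" g f] smooth_open_subset[of W g] assms by auto
    then show "\<exists>W. open W \<and> x \<in> W \<and> smooth_open W f"
      using W assms \<open>x \<in> U\<close> by (meson IntI open_Int)
  qed
next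
  assume "smooth_open U f"
  then show "smooth_on U f" unfolding smooth_on_def smooth_open_def using assms by blast
qed

lemma smooth_on_subset: "smooth_on S f \<Longrightarrow> T \<subseteq> S \<Longrightarrow> smooth_on T f"
  unfolding smooth_on_def
proof
  fix x assume *: "\<forall>x\<in>S. \<exists>U g. open U \<and> x \<in> U \<and> (\<forall>n. Ck n U g) \<and> (\<forall>y\<in>U \<inter> S. g y = f y)"
    and "T \<subseteq> S" "x \<in> T"
  from bspec[OF *, of x] obtain U g
    where "open U" "x \<in> U" "\<forall>n. Ck n U g" "\<forall>y\<in>U \<inter> S. g y = f y"
    using \<open>T \<subseteq> S\<close> \<open>x \<in> T\<close> by auto
  then show "\<exists>U g. open U \<and> x \<in> U \<and> (\<forall>n. Ck n U g) \<and> (\<forall>y\<in>U \<inter> T. g y = f y)"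
    using \<open>T \<subseteq> S\<close> by (intro exI[of _ U] exI[of _ g]) auto
qed

section \<open>Infinitesimal geometry of a triangular orbit\<close>

text \<open>The vector on the line of \<open>v\<close> that lies in the affine hyperplane where the
  product with \<open>n\<close> equals 1.\<close>

definition cproj :: "'a::real_inner \<Rightarrow> 'a \<Rightarrow> 'a" where
  "cproj n v = v /\<^sub>R (n \<bullet> v)"

definition dcproj :: "'a::real_inner \<Rightarrow> 'a \<Rightarrow> 'a \<Rightarrow> 'a \<Rightarrow> 'a" where
  "dcproj n n' v v' = v' /\<^sub>R (n \<bullet> v) - ((n' \<bullet> v + n \<bullet> v') / (n \<bullet> v)\<^sup>2) *\<^sub>R v"

lemma has_derivative_cproj:
  assumes "(n has_derivative n') (at x within S)" "(v has_derivative v') (at x within S)" "n x \<bullet> v x \<noteq> 0"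
  shows "((\<lambda>y. cproj (n y) (v y)) has_derivative (\<lambda>h. dcproj (n x) (n' h) (v x) (v' h))) (at x within S)"
  unfolding cproj_def dcproj_def
  by (rule derivative_eq_intros assms refl)+
     (use assms(3) in \<open>auto simp: fun_eq_iff power2_eq_square divide_simps algebra_simps\<close>)

text \<open>If \<open>h\<close> is orthogonal to \<open>v\<close>, only
  \<open>(h \<bullet> v') / (n \<bullet> v)\<close> survives: components normal to the plane of the
  triangle do not see the derivative of \<open>n\<close>.\<close>

lemma inner_dcproj: "h \<bullet> dcproj n n' v v' = (h \<bullet> v') / (n \<bullet> v) - ((n' \<bullet> v + n \<bullet> v') / (n \<bullet> v)\<^sup>2) * (h \<bullet> v)"
  by (simp add: dcproj_def inner_diff_right inner_scaleR_right divide_inverse mult.commute)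

lemma inner_cproj: "h \<bullet> cproj n v = (h \<bullet> v) / (n \<bullet> v)"
  by (simp add: cproj_def inner_scaleR_right divide_inverse mult.commute)

text \<open>Up to scale, \<open>dcproj n 0 v\<close> is the projection onto the kernel of
  \<open>n\<close> along \<open>v\<close>. Sliding a vertex along the edge \<open>v\<close> is thus
  invisible to the law at the other end.\<close>

lemma dcproj_0_eq:
  assumes "n \<bullet> v \<noteq> 0" shows "(n \<bullet> v) *\<^sub>R dcproj n 0 v v' = v' - (n \<bullet> v') *\<^sub>R cproj n v"
  using assms by (simp add: dcproj_def cproj_def scaleR_diff_right power2_eq_square divide_simps)

text \<open>The hypothesis \<open>fC\<close> is used with \<open>c\<^sub>1 a + c\<^sub>2 b = 0\<close>: moving \<open>A\<close> and \<open>B\<close> out of the plane of the triangle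
  while keeping \<open>C\<close> fixed is only possible if \<open>L\<^sub>A\<close>, \<open>L\<^sub>B\<close>, \<open>L\<^sub>C\<close> are concurrent.\<close>

lemma ceva:
  fixes A B C nA uA nB nC h :: "'a::euclidean_space" and c1 c2 :: "'a \<Rightarrow> 'a"
  assumes uA: "nA \<bullet> uA = 1" "2 *\<^sub>R uA = cproj nA (B - A) + cproj nA (C - A)"
    and nz: "nA \<bullet> (B - A) \<noteq> 0" "nA \<bullet> (C - A) \<noteq> 0" "nB \<bullet> (A - B) \<noteq> 0" "nB \<bullet> (C - B) \<noteq> 0"
       "nC \<bullet> (A - C) \<noteq> 0" "nC \<bullet> (B - C) \<noteq> 0"
    and h: "h \<noteq> 0" "h \<bullet> (B - A) = 0" "h \<bullet> (C - A) = 0"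
    and fA: "\<And>b. nB \<bullet> b = 0 \<Longrightarrow> dcproj nA 0 (B - A) b + dcproj nA 0 (C - A) (c2 b) = 0"
    and fB: "\<And>a. nA \<bullet> a = 0 \<Longrightarrow> dcproj nB 0 (A - B) a + dcproj nB 0 (C - B) (c1 a) = 0"
    and fC: "\<And>a b. nA \<bullet> a = 0 \<Longrightarrow> nB \<bullet> b = 0 \<Longrightarrow> c1 a + c2 b = 0 \<Longrightarrow>
        dcproj nC 0 (A - C) a + dcproj nC 0 (B - C) b = 0"
    and tC: "\<And>a. nA \<bullet> a = 0 \<Longrightarrow> nC \<bullet> c1 a = 0" "\<And>b. nB \<bullet> b = 0 \<Longrightarrow> nC \<bullet> c2 b = 0"
  shows "(nA \<bullet> (B - A)) * (nB \<bullet> (C - B)) * (nC \<bullet> (A - C)) = (nA \<bullet> (C - A)) * (nB \<bullet> (A - B)) * (nC \<bullet> (B - C))"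
proof -
  \<comment> \<open>A tangent vector at \<open>A\<close> with the same \<open>h\<close>-component as
    \<open>h\<close>, because \<open>uA\<close> lies in the plane of the triangle.\<close>
  define a where "a = h - (nA \<bullet> h) *\<^sub>R uA"
  have "h \<bullet> (2 *\<^sub>R uA) = 0" unfolding uA by (simp add: inner_add_right inner_cproj h)
  then have huA: "h \<bullet> uA = 0" by simp
  have a: "nA \<bullet> a = 0" "h \<bullet> a \<noteq> 0"
    using uA(1) h(1) by (simp_all add: a_def inner_diff_right huA)
  have hAB: "h \<bullet> A = h \<bullet> B" "h \<bullet> C = h \<bullet> B" using h(2,3) by (simp_all add: inner_diff_right)
  define c where "c = - c1 a"
  \<comment> \<open>\<open>c\<close> is the velocity of \<open>C\<close> that would cancel the one
    caused by \<open>a\<close>. For the law at \<open>A\<close> to hold with \<open>C\<close> moving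
    by \<open>c\<close>, \<open>dcproj nA 0 (B - A) b\<close> has to equal \<open>w\<close> divided
    by \<open>nA \<bullet> (B - A)\<close>.\<close>
  define w where "w = - ((nA \<bullet> (B - A)) / (nA \<bullet> (C - A))) *\<^sub>R (c - (nA \<bullet> c) *\<^sub>R cproj nA (C - A))"
  have nw: "nA \<bullet> w = 0" using nz by (simp add: w_def inner_diff_right inner_cproj)
  \<comment> \<open>The added multiple of the edge AB does not change
    \<open>dcproj nA 0 (B - A) b\<close>; its coefficient is chosen to make \<open>b\<close> tangent
    at \<open>B\<close>.\<close>
  define b where "b = w + ((nB \<bullet> w) * (nA \<bullet> (B - A)) / (nB \<bullet> (A - B))) *\<^sub>R cproj nA (B - A)"
  have "nB \<bullet> (B - A) = - (nB \<bullet> (A - B))" by (simp add: inner_diff_right)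
  then have b: "nB \<bullet> b = 0" using nz by (simp add: b_def inner_add_right inner_cproj)
  have "(nA \<bullet> (B - A)) *\<^sub>R dcproj nA 0 (B - A) b = w"
    unfolding dcproj_0_eq[OF nz(1)] using nz nw by (simp add: b_def inner_add_right inner_cproj)
  then have 1: "dcproj nA 0 (B - A) b = w /\<^sub>R (nA \<bullet> (B - A))" using nz(1) by (metis scaleR_scaleR left_inverse scaleR_one)
  have "dcproj nA 0 (C - A) (c2 b) = - (w /\<^sub>R (nA \<bullet> (B - A)))"
    using fA[OF b] unfolding 1 by (metis eq_neg_iff_add_eq_0 add.commute)
  then have "(nA \<bullet> (C - A)) *\<^sub>R dcproj nA 0 (C - A) (c2 b) = (nA \<bullet> (C - A)) *\<^sub>R (- w /\<^sub>R (nA \<bullet> (B - A)))"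
    by simp
  also have "\<dots> = c - (nA \<bullet> c) *\<^sub>R cproj nA (C - A)" using nz by (simp add: w_def)
  finally have "c2 b - (nA \<bullet> c2 b) *\<^sub>R cproj nA (C - A) = c - (nA \<bullet> c) *\<^sub>R cproj nA (C - A)"
    unfolding dcproj_0_eq[OF nz(2)] .
  then have 2: "c2 b - c = (nA \<bullet> c2 b - nA \<bullet> c) *\<^sub>R cproj nA (C - A)" by (simp add: algebra_simps)
  have nCA: "nC \<bullet> (C - A) = - (nC \<bullet> (A - C))" by (simp add: inner_diff_right)
  \<comment> \<open>The law at \<open>A\<close> leaves \<open>c2 b - c\<close> parallel to the edge
    AC. Both vectors are tangent at \<open>C\<close> and the edge is not, so they agree.\<close>
  have "nC \<bullet> (c2 b - c) = 0" using tC a b by (simp add: inner_diff_right inner_add_right c_def)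
  then have "nA \<bullet> c2 b - nA \<bullet> c = 0" unfolding 2 using nz nCA by (simp add: inner_cproj)
  with 2 have c2: "c1 a + c2 b = 0" by (simp add: c_def add.commute)
  have e1: "(h \<bullet> b) / (nA \<bullet> (B - A)) + (h \<bullet> c2 b) / (nA \<bullet> (C - A)) = 0"
    using arg_cong[OF fA[OF b], of "\<lambda>v. h \<bullet> v"] by (simp add: inner_add_right inner_dcproj h)
  have e2: "(h \<bullet> a) / (nB \<bullet> (A - B)) + (h \<bullet> c1 a) / (nB \<bullet> (C - B)) = 0"
    using arg_cong[OF fB[OF a(1)], of "\<lambda>v. h \<bullet> v"]
    by (simp add: inner_add_right inner_dcproj inner_diff_right[of h] hAB)
  have e3: "(h \<bullet> a) / (nC \<bullet> (A - C)) + (h \<bullet> b) / (nC \<bullet> (B - C)) = 0"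
    using arg_cong[OF fC[OF a(1) b c2], of "\<lambda>v. h \<bullet> v"]
    by (simp add: inner_add_right inner_dcproj inner_diff_right[of h] hAB)
  have e4: "h \<bullet> c2 b = - (h \<bullet> c1 a)" using arg_cong[OF c2, of "\<lambda>v. h \<bullet> v"] by (simp add: inner_add_right)
  define s1 s2 s3 s4 s5 s6 ha hb hc where s: "s1 = nA \<bullet> (B - A)" "s2 = nA \<bullet> (C - A)" "s3 = nB \<bullet> (A - B)"
    "s4 = nB \<bullet> (C - B)" "s5 = nC \<bullet> (A - C)" "s6 = nC \<bullet> (B - C)" "ha = h \<bullet> a" "hb = h \<bullet> b" "hc = h \<bullet> c1 a"
  \<comment> \<open>Each law, with its own vertex at rest, fixes the ratio of two normal velocities.
    Going round the triangle the three ratios combine to Ceva's product.\<close>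
  have "hb = s1 * hc / s2" using e1 nz unfolding e4 s[symmetric] by (simp add: field_simps)
  moreover have "hc = - s4 * ha / s3" using e2 nz unfolding s[symmetric] by (simp add: field_simps eq_neg_iff_add_eq_0)
  moreover have "hb = - s6 * ha / s5" using e3 nz unfolding s[symmetric] by (simp add: field_simps eq_neg_iff_add_eq_0)
  ultimately have "s6 * ha / s5 = s1 * s4 * ha / (s2 * s3)" using nz unfolding s[symmetric] by (simp add: field_simps)
  then have "ha * (s1 * s4 * s5) = ha * (s2 * s3 * s6)" using nz unfolding s[symmetric] by (simp add: field_simps) auto
  then show ?thesis using a(2) unfolding s[symmetric] by simp
qed

text \<open>The coefficients \<open>q\<close> and \<open>q'\<close> hide unknown second derivatives,
  but they multiply \<open>g\<close> and \<open>g'\<close>, whose value and derivative vanish at 0.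
  Without these terms \<open>W\<close> and \<open>W0\<close> give \<open>et = - k * gb / al\<close>
  to first order, and this turns \<open>V\<close> into \<open>- k\<close> times the displayed sum,
  up to a constant.\<close>

lemma kappa_scalar:
  fixes be ga al gb et q q' g g' :: "real \<Rightarrow> real" and k :: real
  assumes d: "(be has_real_derivative be') (at 0)" "(ga has_real_derivative ga') (at 0)"
      "(al has_real_derivative al') (at 0)" "(gb has_real_derivative gb') (at 0)"
      "(et has_real_derivative et') (at 0)" "(q has_real_derivative dq) (at 0)"
      "(q' has_real_derivative dq') (at 0)"
      "(g has_real_derivative 0) (at 0)" "(g' has_real_derivative 0) (at 0)"
    and z: "g 0 = 0" "g' 0 = 0" "k \<noteq> 0" "be 0 \<noteq> 0" "ga 0 \<noteq> 0" "al 0 \<noteq> 0" "gb 0 \<noteq> 0"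
    and V: "((\<lambda>t. - k / be t + (et t - k) / ga t - q t * g t - r) has_real_derivative 0) (at 0)"
    and W: "((\<lambda>t. k / al t + et t / gb t - q' t * g' t) has_real_derivative 0) (at 0)"
    and W0: "k / al 0 + et 0 / gb 0 = 0"
  shows "((\<lambda>t. 1 / be t + 1 / ga t + gb t / (ga t * al t)) has_real_derivative 0) (at 0)"
proof -
  have "((\<lambda>t. - k / be t + (et t - k) / ga t - q t * g t - r) has_real_derivative
      k * be' / (be 0)\<^sup>2 + (et' * ga 0 - (et 0 - k) * ga') / (ga 0)\<^sup>2) (at 0)"
    by (rule derivative_eq_intros d refl | use z in \<open>simp add: power2_eq_square\<close>)+
  from DERIV_unique[OF V this] have 1: "k * be' / (be 0)\<^sup>2 + (et' * ga 0 - (et 0 - k) * ga') / (ga 0)\<^sup>2 = 0" by simp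
  have "((\<lambda>t. k / al t + et t / gb t - q' t * g' t) has_real_derivative
      - k * al' / (al 0)\<^sup>2 + (et' * gb 0 - et 0 * gb') / (gb 0)\<^sup>2) (at 0)"
    by (rule derivative_eq_intros d refl | use z in \<open>simp add: power2_eq_square\<close>)+
  from DERIV_unique[OF W this] have 2: "- k * al' / (al 0)\<^sup>2 + (et' * gb 0 - et 0 * gb') / (gb 0)\<^sup>2 = 0" by simp
  have e: "et 0 = - k * gb 0 / al 0" using W0 z by (simp add: field_simps eq_neg_iff_add_eq_0)
  have "et' = k * al' * gb 0 / (al 0)\<^sup>2 + et 0 * gb' / gb 0"
    using 2 z by (simp add: field_simps power2_eq_square)
  then have e': "et' = k * al' * gb 0 / (al 0)\<^sup>2 - k * gb' / al 0"
    unfolding e using z by simp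
  have "k * (be' / (be 0)\<^sup>2 + ga' / (ga 0)\<^sup>2 + (al' * gb 0 / (al 0)\<^sup>2 - gb' / al 0) / ga 0 + gb 0 * ga' / (al 0 * (ga 0)\<^sup>2)) = 0"
    (is "?l = 0")
  proof -
    have "?l = k * be' / (be 0)\<^sup>2 + (et' * ga 0 - (et 0 - k) * ga') / (ga 0)\<^sup>2"
      unfolding e e' using z(3-) by (simp add: divide_simps) (simp add: algebra_simps power2_eq_square)
    with 1 show ?thesis by simp
  qed
  then have 3: "be' / (be 0)\<^sup>2 + ga' / (ga 0)\<^sup>2 + (al' * gb 0 / (al 0)\<^sup>2 - gb' / al 0) / ga 0 + gb 0 * ga' / (al 0 * (ga 0)\<^sup>2) = 0"
    using z(3) by simp
  have "((\<lambda>t. 1 / be t + 1 / ga t + gb t / (ga t * al t)) has_real_derivative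
      - be' / (be 0)\<^sup>2 - ga' / (ga 0)\<^sup>2 + (gb' * (ga 0 * al 0) - gb 0 * (ga' * al 0 + ga 0 * al')) / (ga 0 * al 0)\<^sup>2) (at 0)"
    by (rule derivative_eq_intros d refl | use z in \<open>simp add: power2_eq_square\<close>)+
  moreover have "- be' / (be 0)\<^sup>2 - ga' / (ga 0)\<^sup>2 + (gb' * (ga 0 * al 0) - gb 0 * (ga' * al 0 + ga 0 * al')) / (ga 0 * al 0)\<^sup>2
     = - (be' / (be 0)\<^sup>2 + ga' / (ga 0)\<^sup>2 + (al' * gb 0 / (al 0)\<^sup>2 - gb' / al 0) / ga 0 + gb 0 * ga' / (al 0 * (ga 0)\<^sup>2))"
    using z(4-) by (simp add: divide_simps) (simp add: algebra_simps power2_eq_square)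
  ultimately show ?thesis unfolding 3 by simp
qed

text \<open>\<open>V\<close> and \<open>W\<close> say that the equations of the reflection laws at \<open>A\<close> and \<open>B\<close>, differentiated along a vector \<open>a\<close>
  tangent at \<open>A\<close> and transversal to the plane of the triangle, are preserved to first order when \<open>B\<close> moves within
  that plane. Their components along a normal \<open>h\<close> of the plane involve no unknown second derivatives.\<close>

lemma kappa:
  fixes A B nA m Du a b h :: "'a::euclidean_space" and Ct ct nBt :: "real \<Rightarrow> 'a"
  defines "Bt \<equiv> \<lambda>t. B + t *\<^sub>R b"
  assumes d: "(Ct has_vector_derivative C') (at 0)" "(ct has_vector_derivative c') (at 0)"
      "(nBt has_vector_derivative nB') (at 0)"
    and nz: "nA \<bullet> (B - A) \<noteq> 0" "nA \<bullet> (Ct 0 - A) \<noteq> 0" "nBt 0 \<bullet> (A - B) \<noteq> 0" "nBt 0 \<bullet> (Ct 0 - B) \<noteq> 0"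
    and h: "h \<bullet> a \<noteq> 0" "h \<bullet> (B - A) = 0" "h \<bullet> (Ct 0 - A) = 0" "h \<bullet> b = 0" "h \<bullet> C' = 0"
    and V: "((\<lambda>t. dcproj nA m (Bt t - A) (- a) + dcproj nA m (Ct t - A) (ct t - a) - 2 *\<^sub>R Du)
          has_vector_derivative 0) (at 0)"
    and W: "((\<lambda>t. dcproj (nBt t) 0 (A - Bt t) a + dcproj (nBt t) 0 (Ct t - Bt t) (ct t))
          has_vector_derivative 0) (at 0)"
    and W0: "dcproj (nBt 0) 0 (A - B) a + dcproj (nBt 0) 0 (Ct 0 - B) (ct 0) = 0"
  shows "((\<lambda>t. 1 / (nA \<bullet> (Bt t - A)) + 1 / (nA \<bullet> (Ct t - A)) +
      (nBt t \<bullet> (Ct t - Bt t)) / ((nA \<bullet> (Ct t - A)) * (nBt t \<bullet> (A - Bt t)))) has_real_derivative 0) (at 0)"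
proof -
  have B': "(Bt has_vector_derivative b) (at 0)"
    unfolding Bt_def by (auto intro!: derivative_eq_intros)
  have [simp]: "Bt 0 = B" by (simp add: Bt_def)
  have inner': "((\<lambda>t. f t \<bullet> g t) has_real_derivative f0 \<bullet> g' + f' \<bullet> g0) (at 0)"
    if "(f has_vector_derivative f') (at 0)" "(g has_vector_derivative g') (at 0)" "f 0 = f0" "g 0 = g0"
    for f g :: "real \<Rightarrow> 'a" and f' g' f0 g0
    using bounded_bilinear.has_vector_derivative[OF bounded_bilinear_inner that(1,2)] that(3,4)
    by (simp add: has_real_derivative_iff_has_vector_derivative)
  note dd = has_vector_derivative_const has_vector_derivative_diff B' d
  have hB: "h \<bullet> (Bt t - A) = 0" "h \<bullet> (A - Bt t) = 0" for t
    using h(2,4) by (simp_all add: Bt_def inner_diff_right inner_add_right)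
  \<comment> \<open>\<open>Bt\<close> never leaves the plane of the triangle. \<open>Ct\<close> may
    leave it, but its component along \<open>h\<close> has vanishing derivative at 0, which disposes
    of the unknown coefficients in \<open>kappa_scalar\<close>.\<close>
  have g: "((\<lambda>t. h \<bullet> (Ct t - A)) has_real_derivative 0) (at 0)"
    using inner'[OF has_vector_derivative_const has_vector_derivative_diff[OF d(1) has_vector_derivative_const] refl refl,
        of h A] h(5) by simp
  have g2: "((\<lambda>t. h \<bullet> (Ct t - Bt t)) has_real_derivative 0) (at 0)"
    using inner'[OF has_vector_derivative_const has_vector_derivative_diff[OF d(1) B'] refl refl, of h] h(4,5)
    by (simp add: inner_diff_right)
  have et: "((\<lambda>t. h \<bullet> ct t) has_real_derivative h \<bullet> c') (at 0)"
    using inner'[OF has_vector_derivative_const d(2) refl refl, of h] by simp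
  have d1: "\<exists>D. ((\<lambda>t. n \<bullet> (Ct t - A)) has_real_derivative D) (at 0)"
       "\<exists>D. ((\<lambda>t. n \<bullet> (ct t - a)) has_real_derivative D) (at 0)"
       "\<exists>D. ((\<lambda>t. n \<bullet> (Bt t - A)) has_real_derivative D) (at 0)" for n
    by (rule exI, rule inner', (rule dd refl)+)+
  have d2: "\<exists>D. ((\<lambda>t. nBt t \<bullet> (A - Bt t)) has_real_derivative D) (at 0)"
       "\<exists>D. ((\<lambda>t. nBt t \<bullet> (Ct t - Bt t)) has_real_derivative D) (at 0)"
       "\<exists>D. ((\<lambda>t. nBt t \<bullet> ct t) has_real_derivative D) (at 0)"
    by (rule exI, rule inner', (rule dd refl)+)+
  have q: "\<exists>D. ((\<lambda>t. (m \<bullet> (Ct t - A) + nA \<bullet> (ct t - a)) / (nA \<bullet> (Ct t - A))\<^sup>2) has_real_derivative D) (at 0)"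
  proof -
    obtain D1 D2 D3 where D: "((\<lambda>t. m \<bullet> (Ct t - A)) has_real_derivative D1) (at 0)"
       "((\<lambda>t. nA \<bullet> (ct t - a)) has_real_derivative D2) (at 0)"
       "((\<lambda>t. nA \<bullet> (Ct t - A)) has_real_derivative D3) (at 0)"
      using d1 by metis
    then show ?thesis
      by (intro exI) (rule derivative_eq_intros D refl | use nz in simp)+
  qed
  have q': "\<exists>D. ((\<lambda>t. (nBt t \<bullet> ct t) / (nBt t \<bullet> (Ct t - Bt t))\<^sup>2) has_real_derivative D) (at 0)"
  proof -
    obtain D1 D2 where D: "((\<lambda>t. nBt t \<bullet> ct t) has_real_derivative D1) (at 0)"
       "((\<lambda>t. nBt t \<bullet> (Ct t - Bt t)) has_real_derivative D2) (at 0)"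
      using d2 by metis
    then show ?thesis
      by (intro exI) (rule derivative_eq_intros D refl | use nz in simp)+
  qed
  have V': "((\<lambda>t. - (h \<bullet> a) / (nA \<bullet> (Bt t - A)) + (h \<bullet> ct t - h \<bullet> a) / (nA \<bullet> (Ct t - A))
        - (m \<bullet> (Ct t - A) + nA \<bullet> (ct t - a)) / (nA \<bullet> (Ct t - A))\<^sup>2 * (h \<bullet> (Ct t - A)) - 2 * (h \<bullet> Du))
        has_real_derivative 0) (at 0)"
    using inner'[OF has_vector_derivative_const[of h] V refl refl]
    by (simp add: inner_add_right inner_diff_right[of _ "_ + _"] inner_dcproj hB)
       (simp add: inner_diff_right[of h _ a] algebra_simps)
  have W': "((\<lambda>t. (h \<bullet> a) / (nBt t \<bullet> (A - Bt t)) + (h \<bullet> ct t) / (nBt t \<bullet> (Ct t - Bt t))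
        - (nBt t \<bullet> ct t) / (nBt t \<bullet> (Ct t - Bt t))\<^sup>2 * (h \<bullet> (Ct t - Bt t)))
        has_real_derivative 0) (at 0)"
    using inner'[OF has_vector_derivative_const[of h] W refl refl]
    by (simp add: inner_add_right inner_dcproj hB add_diff_eq)
  have hAB: "h \<bullet> A = h \<bullet> B" "h \<bullet> Ct 0 = h \<bullet> B" using h(2,3) by (simp_all add: inner_diff_right)
  have W0': "(h \<bullet> a) / (nBt 0 \<bullet> (A - Bt 0)) + (h \<bullet> ct 0) / (nBt 0 \<bullet> (Ct 0 - Bt 0)) = 0"
    using arg_cong[OF W0, of "\<lambda>v. h \<bullet> v"]
    by (simp add: inner_add_right inner_dcproj inner_diff_right[of h] hAB)
  obtain D1 D2 D3 D4 D5 D6 where D: "((\<lambda>t. nA \<bullet> (Bt t - A)) has_real_derivative D1) (at 0)"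
    "((\<lambda>t. nA \<bullet> (Ct t - A)) has_real_derivative D2) (at 0)"
    "((\<lambda>t. nBt t \<bullet> (A - Bt t)) has_real_derivative D3) (at 0)"
    "((\<lambda>t. nBt t \<bullet> (Ct t - Bt t)) has_real_derivative D4) (at 0)"
    "((\<lambda>t. (m \<bullet> (Ct t - A) + nA \<bullet> (ct t - a)) / (nA \<bullet> (Ct t - A))\<^sup>2) has_real_derivative D5) (at 0)"
    "((\<lambda>t. (nBt t \<bullet> ct t) / (nBt t \<bullet> (Ct t - Bt t))\<^sup>2) has_real_derivative D6) (at 0)"
    using d1(1)[of nA] d1(3)[of nA] d2(1,2) q q' by (elim exE) (rule that)
  show ?thesis
    by (rule kappa_scalar[OF D(1-4) et D(5,6) g g2 _ _ h(1) _ _ _ _ V' W' W0'])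
       (use nz h hAB in \<open>auto simp: inner_diff_right\<close>)
qed

text \<open>\<open>K\<close> is the conclusion of \<open>kappa\<close> with \<open>A\<close> and \<open>B\<close> exchanged and \<open>A\<close> moving with velocity \<open>a\<close>, written out;
  \<open>m\<close> is the derivative of the normal \<open>nA\<close> along \<open>a\<close> and \<open>c\<close> the velocity of \<open>C\<close>.\<close>

lemma second_fundamental_form:
  fixes A B C nA nB nC m c :: "'a::euclidean_space"
  defines "a \<equiv> cproj nA (B - A) - cproj nA (C - A)"
  assumes nz: "nA \<bullet> (B - A) \<noteq> 0" "nA \<bullet> (C - A) \<noteq> 0" "nB \<bullet> (A - B) \<noteq> 0" "nB \<bullet> (C - B) \<noteq> 0"
       "nC \<bullet> (A - C) \<noteq> 0" "nC \<bullet> (B - C) \<noteq> 0"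
    and cv: "(nA \<bullet> (B - A)) * (nB \<bullet> (C - B)) * (nC \<bullet> (A - C)) = (nA \<bullet> (C - A)) * (nB \<bullet> (A - B)) * (nC \<bullet> (B - C))"
    and fB: "dcproj nB 0 (A - B) a + dcproj nB 0 (C - B) c = 0"
    and tC: "nC \<bullet> c = 0"
    and be': "be' = m \<bullet> (B - A)" and ga': "ga' = m \<bullet> (C - A) + nA \<bullet> c"
    and al': "al' = nB \<bullet> a" and gb': "gb' = nB \<bullet> c"
    and K: "- al' / (nB \<bullet> (A - B))\<^sup>2 - gb' / (nB \<bullet> (C - B))\<^sup>2
      + (ga' * ((nB \<bullet> (C - B)) * (nA \<bullet> (B - A))) - (nA \<bullet> (C - A)) * (gb' * (nA \<bullet> (B - A)) + (nB \<bullet> (C - B)) * be'))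
        / ((nB \<bullet> (C - B)) * (nA \<bullet> (B - A)))\<^sup>2 = 0"
  shows "m \<bullet> a = 4 * (nB \<bullet> (C - B)) / ((nB \<bullet> (A - B)) * (nA \<bullet> (C - A)))"
proof -
  define be ga al gb ac bc X Z where s: "be = nA \<bullet> (B - A)" "ga = nA \<bullet> (C - A)" "al = nB \<bullet> (A - B)" "gb = nB \<bullet> (C - B)"
    "ac = nC \<bullet> (A - C)" "bc = nC \<bullet> (B - C)" "X = nB \<bullet> c" "Z = nA \<bullet> c"
  have dd: "nB \<bullet> (B - A) = - al" "nB \<bullet> (C - A) = gb - al" "nC \<bullet> (B - A) = bc - ac" "nC \<bullet> (C - A) = - ac"
    "nC \<bullet> (A - B) = ac - bc" "nC \<bullet> (C - B) = - bc" "nA \<bullet> (A - B) = - be" "nA \<bullet> (C - B) = ga - be"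
    by (simp_all add: s inner_diff_right)
  have nz': "be \<noteq> 0" "ga \<noteq> 0" "al \<noteq> 0" "gb \<noteq> 0" "ac \<noteq> 0" "bc \<noteq> 0" using nz by (simp_all add: s)
  have a1: "nB \<bullet> a = - al / be - (gb - al) / ga" "nC \<bullet> a = (bc - ac) / be + ac / ga" "nA \<bullet> a = 0"
    "m \<bullet> a = m \<bullet> (B - A) / be - m \<bullet> (C - A) / ga"
    using nz' by (simp_all add: a_def inner_diff_right[of _ "cproj _ _"] inner_cproj dd s(1,2)[symmetric])
  \<comment> \<open>The law \<open>fB\<close> is tested against \<open>nC\<close>, where
    \<open>tC\<close> removes \<open>c\<close>, and against \<open>nA\<close>, which annihilates
    \<open>a\<close>. The two equations determine the components \<open>X\<close> and
    \<open>Z\<close> of the velocity \<open>c\<close>.\<close>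
  have e1: "((nC \<bullet> a) - (nB \<bullet> a) / al * (ac - bc)) / al + X * bc / gb / gb = 0"
    using arg_cong[OF fB, of "\<lambda>v. nC \<bullet> v"] nz' tC
    by (simp add: inner_add_right inner_dcproj dd s[symmetric]) (simp add: field_simps power2_eq_square)
  have e2: "(nB \<bullet> a) / al * be / al + (Z - X / gb * (ga - be)) / gb = 0"
    using arg_cong[OF fB, of "\<lambda>v. nA \<bullet> v"] nz' a1(3)
    by (simp add: inner_add_right inner_dcproj dd s[symmetric]) (simp add: field_simps power2_eq_square)
  have X: "X = - gb * gb / bc * ((nC \<bullet> a) - (nB \<bullet> a) / al * (ac - bc)) / al"
    using e1 nz' by (simp add: field_simps)
  have Z: "Z = X / gb * (ga - be) - gb * (nB \<bullet> a) * be / al / al"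
    using e2 nz' by (simp add: field_simps)
  \<comment> \<open>Ceva's condition makes \<open>ac\<close> proportional to \<open>bc\<close>, and
    \<open>bc\<close> then cancels from the expression for \<open>X\<close>.\<close>
  have ac: "ac = ga * al * bc / (be * gb)" using cv nz' by (simp add: s[symmetric] field_simps)
  define mB mC where mm: "mB = m \<bullet> (B - A)" "mC = m \<bullet> (C - A)"
  \<comment> \<open>\<open>K\<close> involves \<open>m\<close> only through the combination
    \<open>mB / be - mC / ga\<close>, which is \<open>m \<bullet> a\<close>, so it can be solved for
    it.\<close>
  have K': "mB / be - mC / ga = Z / ga - X / gb - gb * be / ga * ((nB \<bullet> a) / al\<^sup>2 + X / gb\<^sup>2)"
  proof -
    have "- al' / (nB \<bullet> (A - B))\<^sup>2 - gb' / (nB \<bullet> (C - B))\<^sup>2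
      + (ga' * ((nB \<bullet> (C - B)) * (nA \<bullet> (B - A))) - (nA \<bullet> (C - A)) * (gb' * (nA \<bullet> (B - A)) + (nB \<bullet> (C - B)) * be'))
        / ((nB \<bullet> (C - B)) * (nA \<bullet> (B - A)))\<^sup>2
      = ga / (gb * be) * (Z / ga - X / gb - gb * be / ga * ((nB \<bullet> a) / al\<^sup>2 + X / gb\<^sup>2) - (mB / be - mC / ga))"
      using nz' unfolding be' ga' al' gb' s[symmetric] mm[symmetric]
      by (simp add: divide_simps) (simp add: algebra_simps power2_eq_square)
    with K nz' show ?thesis by simp
  qed
  show ?thesis unfolding a1(4) mm[symmetric] K' Z s[symmetric]
    unfolding X a1(1,2) ac
    using nz' by (simp add: divide_simps) (simp add: algebra_simps power2_eq_square)
qed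

text \<open>With \<open>B\<close> moving in the plane of the triangle and \<open>A\<close> fixed, the tangent vector \<open>\<tau>\<close> of the curve of \<open>A\<close> in
  that plane is only rescaled, which determines the logarithmic derivative of the quadratic form \<open>L \<tau> \<bullet> \<tau>\<close>;
  it differs from that of the right-hand side in \<open>M\<close>.\<close>

lemma curvature_contradiction:
  fixes A B nA nC c :: "'a::euclidean_space" and Ct nBt :: "real \<Rightarrow> 'a" and L :: "'a \<Rightarrow> 'a"
  defines "b \<equiv> cproj (nBt 0) (Ct 0 - B) - cproj (nBt 0) (A - B)"
  defines "Bt \<equiv> \<lambda>t. B + t *\<^sub>R b"
  defines "\<tau> \<equiv> \<lambda>t. cproj nA (Bt t - A) - cproj nA (Ct t - A)"
  defines "p \<equiv> \<lambda>t. (nBt t \<bullet> (Ct t - Bt t)) / ((nA \<bullet> (Ct t - A)) * (nBt t \<bullet> (A - Bt t)))"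
  assumes nz: "nA \<bullet> (B - A) \<noteq> 0" "nA \<bullet> (Ct 0 - A) \<noteq> 0" "nBt 0 \<bullet> (A - B) \<noteq> 0" "nBt 0 \<bullet> (Ct 0 - B) \<noteq> 0"
       "nC \<bullet> (A - Ct 0) \<noteq> 0" "nC \<bullet> (B - Ct 0) \<noteq> 0"
    and cv: "(nA \<bullet> (B - A)) * (nBt 0 \<bullet> (Ct 0 - B)) * (nC \<bullet> (A - Ct 0))
      = (nA \<bullet> (Ct 0 - A)) * (nBt 0 \<bullet> (A - B)) * (nC \<bullet> (B - Ct 0))"
    and fA: "dcproj nA 0 (B - A) b + dcproj nA 0 (Ct 0 - A) c = 0"
    and tC: "nC \<bullet> c = 0"
    and C': "(Ct has_vector_derivative c) (at 0)"
    and L: "linear L"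
    and K: "((\<lambda>t. 1 / (nA \<bullet> (Bt t - A)) + 1 / (nA \<bullet> (Ct t - A)) + p t) has_real_derivative 0) (at 0)"
    and M: "((\<lambda>t. L (\<tau> t) \<bullet> \<tau> t - 4 * p t) has_real_derivative 0) (at 0)"
    and M0: "L (\<tau> 0) \<bullet> \<tau> 0 = 4 * p 0"
  shows False
proof -
  define C where "C = Ct 0"
  have [simp]: "Bt 0 = B" by (simp add: Bt_def)
  define be ga al gb ac bc Z where s: "be = nA \<bullet> (B - A)" "ga = nA \<bullet> (C - A)" "al = nBt 0 \<bullet> (A - B)" "gb = nBt 0 \<bullet> (C - B)"
    "ac = nC \<bullet> (A - C)" "bc = nC \<bullet> (B - C)" "Z = nA \<bullet> c"
  have dd: "nC \<bullet> (B - A) = bc - ac" "nC \<bullet> (C - A) = - ac" "nA \<bullet> (A - B) = - be" "nA \<bullet> (C - B) = ga - be"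
    by (simp_all add: s inner_diff_right)
  have nz': "be \<noteq> 0" "ga \<noteq> 0" "al \<noteq> 0" "gb \<noteq> 0" "ac \<noteq> 0" "bc \<noteq> 0" using nz by (simp_all add: s C_def)
  have B': "(Bt has_vector_derivative b) (at 0)"
    unfolding Bt_def by (auto intro!: derivative_eq_intros)
  have cp: "((\<lambda>t. cproj nA (f t - A)) has_vector_derivative dcproj nA 0 (f 0 - A) f') (at 0)"
    if "(f has_vector_derivative f') (at 0)" "nA \<bullet> (f 0 - A) \<noteq> 0" for f f'
  proof -
    have "((\<lambda>t. f t - A) has_derivative (\<lambda>h. h *\<^sub>R f')) (at 0)"
      using that(1) unfolding has_vector_derivative_def by (auto intro!: derivative_eq_intros)
    from has_derivative_cproj[OF has_derivative_const[of nA] this that(2)]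
    have "((\<lambda>t. cproj nA (f t - A)) has_derivative (\<lambda>h. dcproj nA 0 (f 0 - A) (h *\<^sub>R f'))) (at 0)" .
    moreover have "dcproj nA 0 (f 0 - A) (h *\<^sub>R f') = h *\<^sub>R dcproj nA 0 (f 0 - A) f'" for h
      by (simp add: dcproj_def scaleR_diff_right)
    ultimately show ?thesis unfolding has_vector_derivative_def by simp
  qed
  define t' where "t' = dcproj nA 0 (B - A) b - dcproj nA 0 (C - A) c"
  have tau': "(\<tau> has_vector_derivative t') (at 0)"
    unfolding \<tau>_def t'_def C_def using has_vector_derivative_diff[OF cp[OF B'] cp[OF C']] nz by simp
  have e12: "C - B = (C - A) - (B - A)" "A - B = - (B - A)" by simp_all
  have tau0: "\<tau> 0 = (B - A) /\<^sub>R be - (C - A) /\<^sub>R ga" by (simp add: \<tau>_def cproj_def s C_def)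
  have b: "b = (C - A) /\<^sub>R gb - (B - A) /\<^sub>R gb + (B - A) /\<^sub>R al"
  proof -
    have "b = (C - B) /\<^sub>R gb - (A - B) /\<^sub>R al" by (simp add: b_def cproj_def s C_def)
    also have "\<dots> = (C - A) /\<^sub>R gb - (B - A) /\<^sub>R gb + (B - A) /\<^sub>R al"
      unfolding e12 by (simp only: scaleR_diff_right scaleR_minus_right) simp
    finally show ?thesis .
  qed
  have nb: "nA \<bullet> b = ga / gb - be / gb + be / al"
    unfolding b by (simp add: inner_add_right inner_diff_right[of _ "_ /\<^sub>R _"] s[symmetric] divide_inverse mult.commute)
  \<comment> \<open>The normalized direction from \<open>A\<close> to \<open>B\<close> stays on the
    line where the plane of the triangle meets the affine hyperplane of \<open>nA\<close>; its
    velocity is therefore a multiple of \<open>\<tau> 0\<close>.\<close>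
  have db: "dcproj nA 0 (B - A) b = - (ga / (gb * be)) *\<^sub>R \<tau> 0"
  proof -
    have *: "(ga / gb - be / gb + be / al) / be\<^sup>2 = (inverse be) * (inverse al - inverse gb) + ga / (gb * be) / be"
      using nz' by (simp add: field_simps power2_eq_square)
    have c: "ga * (inverse be * (inverse ga * inverse gb)) = inverse be * inverse gb" using nz' by simp
    have "dcproj nA 0 (B - A) b = b /\<^sub>R be - ((inverse be) * (inverse al - inverse gb) + ga / (gb * be) / be) *\<^sub>R (B - A)"
      unfolding dcproj_def s(1)[symmetric] nb[symmetric] * by (simp add: s(1)[symmetric] nb *)
    also have "\<dots> = - (ga / (gb * be)) *\<^sub>R \<tau> 0"
      unfolding tau0 b using nz' by (simp add: algebra_simps divide_inverse c)
    finally show ?thesis .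
  qed
  \<comment> \<open>By \<open>fA\<close> the midpoint of the two normalized directions is at rest,
    so the ends of \<open>\<tau>\<close> move oppositely and the rate doubles.\<close>
  have t': "t' = (- 2 * (ga / (gb * be))) *\<^sub>R \<tau> 0"
  proof -
    have *: "dcproj nA 0 (C - A) c = - dcproj nA 0 (B - A) b"
      using fA unfolding C_def by (metis add.inverse_unique)
    have "t' = (- (ga / (gb * be)) + - (ga / (gb * be))) *\<^sub>R \<tau> 0"
      unfolding t'_def * db by (simp only: diff_minus_eq_add scaleR_add_left)
    then show ?thesis by simp
  qed
  have nCt: "nC \<bullet> \<tau> 0 = (bc - ac) / be + ac / ga"
    unfolding tau0 by (simp add: inner_diff_right[of _ "_ /\<^sub>R _"] dd divide_inverse mult.commute)
  have Z: "Z = ga * ga * ga / (gb * be * ac) * (nC \<bullet> \<tau> 0)"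
  proof -
    have "nC \<bullet> (dcproj nA 0 (B - A) b + dcproj nA 0 (C - A) c) = 0" using fA by (simp add: C_def)
    then have "- (ga / (gb * be)) * (nC \<bullet> \<tau> 0) + Z * ac / ga / ga = 0"
      using nz' tC unfolding inner_add_right db inner_dcproj[of _ _ _ "C - A"] dd
      by (simp add: s[symmetric] power2_eq_square)
    then show ?thesis using nz' by (simp add: field_simps)
  qed
  have bet: "((\<lambda>t. nA \<bullet> (Bt t - A)) has_real_derivative nA \<bullet> b) (at 0)"
    unfolding Bt_def by (auto intro!: derivative_eq_intros simp: inner_add_right inner_diff_right)
  have gat: "((\<lambda>t. nA \<bullet> (Ct t - A)) has_real_derivative Z) (at 0)"
    using bounded_linear.has_vector_derivative[OF bounded_linear_inner_right[of nA]
        has_vector_derivative_diff[OF C' has_vector_derivative_const]]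
    by (simp add: s has_real_derivative_iff_has_vector_derivative)
  \<comment> \<open>Reading the derivative of \<open>p\<close> off \<open>K\<close> avoids
    differentiating \<open>nBt\<close>.\<close>
  have p': "(p has_real_derivative (nA \<bullet> b / be\<^sup>2 + Z / ga\<^sup>2)) (at 0)"
  proof -
    have "((\<lambda>t. 1 / (nA \<bullet> (Bt t - A)) + 1 / (nA \<bullet> (Ct t - A))) has_real_derivative
       - (nA \<bullet> b) / be\<^sup>2 - Z / ga\<^sup>2) (at 0)"
      by (rule derivative_eq_intros bet gat refl | use nz in \<open>simp add: s C_def power2_eq_square\<close>)+
    from DERIV_diff[OF K this] show ?thesis by (simp add: add.commute)
  qed
  have Lq: "((\<lambda>t. L (\<tau> t) \<bullet> \<tau> t) has_real_derivative (L t' \<bullet> \<tau> 0 + L (\<tau> 0) \<bullet> t')) (at 0)"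
    using bounded_bilinear.has_vector_derivative[OF bounded_bilinear_inner
       bounded_linear.has_vector_derivative[OF linear_conv_bounded_linear[THEN iffD1, OF L] tau'] tau']
    by (simp add: has_real_derivative_iff_has_vector_derivative add.commute)
  have "L t' \<bullet> \<tau> 0 + L (\<tau> 0) \<bullet> t' = 4 * (nA \<bullet> b / be\<^sup>2 + Z / ga\<^sup>2)"
    using DERIV_unique[OF M DERIV_diff[OF Lq DERIV_cmult[OF p', of 4]]] by simp
  moreover have "L t' \<bullet> \<tau> 0 + L (\<tau> 0) \<bullet> t' = - 4 * (ga / (gb * be)) * (4 * p 0)"
    unfolding t' linear_scale[OF L] M0[symmetric] by (simp add: mult_ac)
  moreover have "p 0 = gb / (ga * al)" by (simp add: p_def s C_def)
  ultimately have "- 4 * (ga / (gb * be)) * (4 * (gb / (ga * al))) = 4 * (nA \<bullet> b / be\<^sup>2 + Z / ga\<^sup>2)" by simp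
  moreover have "ac = ga * al * bc / (be * gb)" using cv nz' by (simp add: s[symmetric] C_def[symmetric] field_simps)
  \<comment> \<open>With lambda = \<open>ga / (gb * be)\<close>, the form
    \<open>L (\<tau> t) \<bullet> \<tau> t\<close> has logarithmic derivative -4 lambda, twice the
    rate of \<open>\<tau>\<close>, while that of \<open>p\<close> is 2 lambda. Multiplied out, -16 /
    (be al) would have to equal 8 / (be al).\<close>
  ultimately show False unfolding Z nCt nb using nz'
    by (simp add: divide_simps) (simp add: algebra_simps power2_eq_square)
qed

section \<open>Smooth families of triangular orbits\<close>

lemma smooth_open_cproj:
  "smooth_open U n \<Longrightarrow> smooth_open U v \<Longrightarrow> (\<And>x. x \<in> U \<Longrightarrow> n x \<bullet> v x \<noteq> 0) \<Longrightarrow> smooth_open U (\<lambda>x. cproj (n x) (v x))"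
  unfolding cproj_def by (intro smooth_open_scaleR smooth_open_inverse smooth_open_inner)

lemma frechet_derivative_inner_const:
  assumes "smooth_open U F" "x \<in> U"
  shows "frechet_derivative (\<lambda>y. F y \<bullet> i) (at x) h = frechet_derivative F (at x) h \<bullet> i"
proof -
  have "((\<lambda>y. F y \<bullet> i) has_derivative (\<lambda>h. frechet_derivative F (at x) h \<bullet> i)) (at x)"
    by (intro has_derivative_inner_left smooth_open_has_derivative[OF assms])
  from frechet_derivative_at[OF this] show ?thesis by metis
qed

lemma smooth_open_curve:
  assumes "smooth_open U F" "x \<in> U"
  shows "((\<lambda>t. F (x + t *\<^sub>R v)) has_vector_derivative frechet_derivative F (at x) v) (at 0)"
proof -
  have "((\<lambda>t::real. x + t *\<^sub>R v) has_vector_derivative v) (at 0)"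
    by (auto intro!: derivative_eq_intros)
  then have 1: "((\<lambda>t::real. x + t *\<^sub>R v) has_derivative (\<lambda>t. t *\<^sub>R v)) (at 0)"
    by (simp add: has_vector_derivative_def)
  have 2: "(F has_derivative frechet_derivative F (at x)) (at (x + 0 *\<^sub>R v))"
    using smooth_open_has_derivative[OF assms] by simp
  have "((\<lambda>t. F (x + t *\<^sub>R v)) has_derivative (\<lambda>t. frechet_derivative F (at x) (t *\<^sub>R v))) (at 0)"
    using has_derivative_compose[OF 1 2] by (simp add: o_def)
  moreover have "linear (frechet_derivative F (at x))"
    using smooth_open_has_derivative[OF assms] has_derivative_linear by blast
  ultimately show ?thesis unfolding has_vector_derivative_def by (simp add: linear_scale)
qed

text \<open>Every use of \<open>d \<ge> 3\<close> passes through this lemma: it supplies the normal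
  to the plane of the triangle and, for collinear triangles, a tangent direction at \<open>B\<close>
  that leaves their line.\<close>

lemma exists_orthogonal_pair:
  fixes u v :: "'a::euclidean_space"
  assumes "DIM('a) \<ge> 3"
  shows "\<exists>h. h \<noteq> 0 \<and> h \<bullet> u = 0 \<and> h \<bullet> v = 0"
proof -
  have "dim {u, v} \<le> card {u, v}" by (intro dim_le_card') simp
  also have "\<dots> \<le> 2" by (simp add: card_insert_if)
  finally have "dim {u, v} < DIM('a)" using assms by simp
  then obtain h where "h \<noteq> 0" "\<And>y. y \<in> span {u, v} \<Longrightarrow> orthogonal h y"
    using orthogonal_to_subspace_exists by blast
  then show ?thesis by (intro exI[of _ h]) (auto simp: orthogonal_def span_base)
qed

text \<open>\<open>null\<close> is an ideal of negligible sets of pairs \<open>(A, B)\<close>, \<open>C\<close> the third vertex as a function of the first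
  two, and \<open>fC\<close> a defining function of the third hypersurface. The normals \<open>nA\<close>, \<open>nB\<close>, \<open>nC\<close> and
  directions \<open>uA\<close>, \<open>uB\<close>, \<open>uC\<close> of the lines are smooth extensions to open sets.\<close>

locale triangle_family =
  fixes null :: "('a::euclidean_space \<times> 'a) set \<Rightarrow> bool"
    and U Y :: "('a \<times> 'a) set" and VA VB VC :: "'a set"
    and nA uA nB uB nC uC :: "'a \<Rightarrow> 'a" and fC \<rho> :: "'a \<Rightarrow> real" and C :: "'a \<times> 'a \<Rightarrow> 'a"
  assumes dim3: "DIM('a) \<ge> 3"
    and opens: "open U" "open VA" "open VB" "open VC"
    and U: "\<And>x. x \<in> U \<Longrightarrow> fst x \<in> VA" "\<And>x. x \<in> U \<Longrightarrow> snd x \<in> VB" "\<And>x. x \<in> U \<Longrightarrow> C x \<in> VC"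
    and smooth: "smooth_open VA nA" "smooth_open VA uA" "smooth_open VB nB" "smooth_open VB uB"
      "smooth_open VC nC" "smooth_open VC uC" "smooth_open U C" "smooth_open VC fC"
    and fC: "\<And>P. P \<in> VC \<Longrightarrow> (fC has_derivative (\<lambda>v. \<rho> P * (nC P \<bullet> v))) (at P)"
      "\<And>P. P \<in> VC \<Longrightarrow> \<rho> P \<noteq> 0"
    and null_subset: "\<And>S T. null S \<Longrightarrow> T \<subseteq> S \<Longrightarrow> null T"
    and null_Un: "\<And>S T. null S \<Longrightarrow> null T \<Longrightarrow> null (S \<union> T)"
    and null_empty: "null {}"
    and null_deriv: "\<And>F Z. smooth_open U F \<Longrightarrow> Z \<subseteq> Y \<Longrightarrow> \<forall>x\<in>Z. F x = (0::real) \<Longrightarrow>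
      null {x\<in>Z. \<exists>a b. nA (fst x) \<bullet> a = 0 \<and> nB (snd x) \<bullet> b = 0 \<and> frechet_derivative F (at x) (a, b) \<noteq> 0}"
    and Y: "Y \<subseteq> U" "\<not> null Y"
    and nonzero: "\<And>x. x \<in> U \<Longrightarrow> nA (fst x) \<bullet> (snd x - fst x) \<noteq> 0" "\<And>x. x \<in> U \<Longrightarrow> nA (fst x) \<bullet> (C x - fst x) \<noteq> 0"
      "\<And>x. x \<in> U \<Longrightarrow> nB (snd x) \<bullet> (fst x - snd x) \<noteq> 0" "\<And>x. x \<in> U \<Longrightarrow> nB (snd x) \<bullet> (C x - snd x) \<noteq> 0"
      "\<And>x. x \<in> U \<Longrightarrow> nC (C x) \<bullet> (fst x - C x) \<noteq> 0" "\<And>x. x \<in> U \<Longrightarrow> nC (C x) \<bullet> (snd x - C x) \<noteq> 0"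
    and unit: "\<And>x. x \<in> Y \<Longrightarrow> nA (fst x) \<bullet> uA (fst x) = 1" "\<And>x. x \<in> Y \<Longrightarrow> nB (snd x) \<bullet> uB (snd x) = 1"
    and orbit: "\<And>x. x \<in> Y \<Longrightarrow> cproj (nA (fst x)) (snd x - fst x) + cproj (nA (fst x)) (C x - fst x) = 2 *\<^sub>R uA (fst x)"
      "\<And>x. x \<in> Y \<Longrightarrow> cproj (nB (snd x)) (fst x - snd x) + cproj (nB (snd x)) (C x - snd x) = 2 *\<^sub>R uB (snd x)"
      "\<And>x. x \<in> Y \<Longrightarrow> cproj (nC (C x)) (fst x - C x) + cproj (nC (C x)) (snd x - C x) = 2 *\<^sub>R uC (C x)"
      "\<And>x. x \<in> Y \<Longrightarrow> fC (C x) = 0"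
begin

definition EA :: "'a \<times> 'a \<Rightarrow> 'a" where
  "EA x = cproj (nA (fst x)) (snd x - fst x) + cproj (nA (fst x)) (C x - fst x) - 2 *\<^sub>R uA (fst x)"
definition EB :: "'a \<times> 'a \<Rightarrow> 'a" where
  "EB x = cproj (nB (snd x)) (fst x - snd x) + cproj (nB (snd x)) (C x - snd x) - 2 *\<^sub>R uB (snd x)"
definition EC :: "'a \<times> 'a \<Rightarrow> 'a" where
  "EC x = cproj (nC (C x)) (fst x - C x) + cproj (nC (C x)) (snd x - C x) - 2 *\<^sub>R uC (C x)"

text \<open>Only pairs of tangent vectors are tested. In transversal directions the functions depend
  on the chosen extensions of the normals and lines, and \<open>null_deriv\<close> gives no
  control.\<close>

definition flat :: "('a \<times> 'a \<Rightarrow> 'c::euclidean_space) \<Rightarrow> 'a \<times> 'a \<Rightarrow> bool" where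
  "flat F x \<longleftrightarrow> (\<forall>a b. nA (fst x) \<bullet> a = 0 \<longrightarrow> nB (snd x) \<bullet> b = 0 \<longrightarrow> frechet_derivative F (at x) (a, b) = 0)"

abbreviation "dC x \<equiv> frechet_derivative C (at x)"

lemma smooth_compositions:
  "smooth_open U (\<lambda>x. nA (fst x))" "smooth_open U (\<lambda>x. uA (fst x))"
  "smooth_open U (\<lambda>x. nB (snd x))" "smooth_open U (\<lambda>x. uB (snd x))"
  "smooth_open U (\<lambda>x. nC (C x))" "smooth_open U (\<lambda>x. uC (C x))" "smooth_open U (\<lambda>x. fC (C x))"
  by (rule smooth_open_compose[OF smooth(1)] smooth_open_compose[OF smooth(2)] smooth_open_compose[OF smooth(3)]
      smooth_open_compose[OF smooth(4)] smooth_open_compose[OF smooth(5)] smooth_open_compose[OF smooth(6)]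
      smooth_open_compose[OF smooth(8)], intro smooth_open_fst smooth_open_snd smooth_open_ident smooth(7),
      simp add: U)+

lemmas smooth_simps = smooth_compositions smooth(7) smooth_open_ident

lemma smooth_E: "smooth_open U EA" "smooth_open U EB" "smooth_open U EC"
  unfolding EA_def EB_def EC_def
  by (intro smooth_open_add smooth_open_diff smooth_open_cproj smooth_simps nonzero smooth_open_fst smooth_open_snd
      smooth_open_scaleR smooth_open_const; assumption)+

lemma null_UN: "finite I \<Longrightarrow> (\<And>i. i \<in> I \<Longrightarrow> null (S i)) \<Longrightarrow> null (\<Union>i\<in>I. S i)"
  by (induction I rule: finite_induct) (auto simp: null_empty null_Un)

lemma null_not_flat:
  fixes F :: "'a \<times> 'a \<Rightarrow> 'c::euclidean_space"
  assumes "smooth_open U F" "Z \<subseteq> Y" "\<And>x. x \<in> Z \<Longrightarrow> F x = 0"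
  shows "null {x\<in>Z. \<not> flat F x}"
proof -
  let ?bad = "\<lambda>i. {x\<in>Z. \<exists>a b. nA (fst x) \<bullet> a = 0 \<and> nB (snd x) \<bullet> b = 0 \<and>
      frechet_derivative (\<lambda>x. F x \<bullet> i) (at x) (a, b) \<noteq> 0}"
  have "null (\<Union>i\<in>Basis. ?bad i)"
    by (intro null_UN finite_Basis null_deriv smooth_open_inner smooth_open_const assms(1,2))
       (simp add: assms(3))
  moreover have "{x\<in>Z. \<not> flat F x} \<subseteq> (\<Union>i\<in>Basis. ?bad i)"
  proof
    fix x assume "x \<in> {x\<in>Z. \<not> flat F x}"
    then obtain a b where *: "x \<in> Z" "nA (fst x) \<bullet> a = 0" "nB (snd x) \<bullet> b = 0"
        "frechet_derivative F (at x) (a, b) \<noteq> 0" unfolding flat_def by blast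
    then obtain i where "i \<in> Basis" "frechet_derivative F (at x) (a, b) \<bullet> i \<noteq> 0"
      by (metis euclidean_all_zero_iff)
    moreover have "x \<in> U" using * assms(2) Y by auto
    ultimately show "x \<in> (\<Union>i\<in>Basis. ?bad i)"
      using * frechet_derivative_inner_const[OF assms(1)] by auto
  qed
  ultimately show ?thesis using null_subset by blast
qed

lemma dE:
  assumes "x \<in> U"
  shows "frechet_derivative EA (at x) (a, b) =
      dcproj (nA (fst x)) (frechet_derivative nA (at (fst x)) a) (snd x - fst x) (b - a)
      + dcproj (nA (fst x)) (frechet_derivative nA (at (fst x)) a) (C x - fst x) (dC x (a, b) - a)
      - 2 *\<^sub>R frechet_derivative uA (at (fst x)) a"
    and "frechet_derivative EB (at x) (a, b) =
      dcproj (nB (snd x)) (frechet_derivative nB (at (snd x)) b) (fst x - snd x) (a - b)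
      + dcproj (nB (snd x)) (frechet_derivative nB (at (snd x)) b) (C x - snd x) (dC x (a, b) - b)
      - 2 *\<^sub>R frechet_derivative uB (at (snd x)) b"
    and "frechet_derivative EC (at x) (a, b) =
      dcproj (nC (C x)) (frechet_derivative nC (at (C x)) (dC x (a, b))) (fst x - C x) (a - dC x (a, b))
      + dcproj (nC (C x)) (frechet_derivative nC (at (C x)) (dC x (a, b))) (snd x - C x) (b - dC x (a, b))
      - 2 *\<^sub>R frechet_derivative uC (at (C x)) (dC x (a, b))"
    and "frechet_derivative (\<lambda>x. fC (C x)) (at x) (a, b) = \<rho> (C x) * (nC (C x) \<bullet> dC x (a, b))"
proof -
  have comp: "((\<lambda>x. g (f x)) has_derivative (\<lambda>h. frechet_derivative g (at (f x)) (f' h))) (at x)"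
    if "(f has_derivative f') (at x)" "smooth_open V g" "f x \<in> V" for f :: "'a \<times> 'a \<Rightarrow> 'a" and f' g V
    using has_derivative_compose[OF that(1) smooth_open_has_derivative[OF that(2,3)]] by (simp add: o_def)
  have f: "((\<lambda>x. fst x) has_derivative fst) (at x)" "((\<lambda>x. snd x) has_derivative snd) (at x)"
    by (auto intro!: derivative_eq_intros)
  have Cd: "(C has_derivative dC x) (at x)" using smooth_open_has_derivative[OF smooth(7) assms] .
  note der = comp[OF f(1) smooth(1) U(1)[OF assms]] comp[OF f(1) smooth(2) U(1)[OF assms]]
    comp[OF f(2) smooth(3) U(2)[OF assms]] comp[OF f(2) smooth(4) U(2)[OF assms]]
    comp[OF Cd smooth(5) U(3)[OF assms]] comp[OF Cd smooth(6) U(3)[OF assms]]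
  note r = has_derivative_add has_derivative_diff has_derivative_scaleR_right has_derivative_cproj
  have "(EA has_derivative (\<lambda>h.
      dcproj (nA (fst x)) (frechet_derivative nA (at (fst x)) (fst h)) (snd x - fst x) (snd h - fst h)
      + dcproj (nA (fst x)) (frechet_derivative nA (at (fst x)) (fst h)) (C x - fst x) (dC x h - fst h)
      - 2 *\<^sub>R frechet_derivative uA (at (fst x)) (fst h))) (at x)"
    unfolding EA_def by (intro r der f Cd nonzero assms)
  from fun_cong[OF frechet_derivative_at[OF this], of "(a, b)"]
  show "frechet_derivative EA (at x) (a, b) =
      dcproj (nA (fst x)) (frechet_derivative nA (at (fst x)) a) (snd x - fst x) (b - a)
      + dcproj (nA (fst x)) (frechet_derivative nA (at (fst x)) a) (C x - fst x) (dC x (a, b) - a)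
      - 2 *\<^sub>R frechet_derivative uA (at (fst x)) a" by simp
  have "(EB has_derivative (\<lambda>h.
      dcproj (nB (snd x)) (frechet_derivative nB (at (snd x)) (snd h)) (fst x - snd x) (fst h - snd h)
      + dcproj (nB (snd x)) (frechet_derivative nB (at (snd x)) (snd h)) (C x - snd x) (dC x h - snd h)
      - 2 *\<^sub>R frechet_derivative uB (at (snd x)) (snd h))) (at x)"
    unfolding EB_def by (intro r der f Cd nonzero assms)
  from fun_cong[OF frechet_derivative_at[OF this], of "(a, b)"]
  show "frechet_derivative EB (at x) (a, b) =
      dcproj (nB (snd x)) (frechet_derivative nB (at (snd x)) b) (fst x - snd x) (a - b)
      + dcproj (nB (snd x)) (frechet_derivative nB (at (snd x)) b) (C x - snd x) (dC x (a, b) - b)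
      - 2 *\<^sub>R frechet_derivative uB (at (snd x)) b" by simp
  have "(EC has_derivative (\<lambda>h.
      dcproj (nC (C x)) (frechet_derivative nC (at (C x)) (dC x h)) (fst x - C x) (fst h - dC x h)
      + dcproj (nC (C x)) (frechet_derivative nC (at (C x)) (dC x h)) (snd x - C x) (snd h - dC x h)
      - 2 *\<^sub>R frechet_derivative uC (at (C x)) (dC x h))) (at x)"
    unfolding EC_def by (intro r der f Cd nonzero assms)
  from fun_cong[OF frechet_derivative_at[OF this], of "(a, b)"]
  show "frechet_derivative EC (at x) (a, b) =
      dcproj (nC (C x)) (frechet_derivative nC (at (C x)) (dC x (a, b))) (fst x - C x) (a - dC x (a, b))
      + dcproj (nC (C x)) (frechet_derivative nC (at (C x)) (dC x (a, b))) (snd x - C x) (b - dC x (a, b))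
      - 2 *\<^sub>R frechet_derivative uC (at (C x)) (dC x (a, b))" by simp
  have "((\<lambda>x. fC (C x)) has_derivative (\<lambda>h. \<rho> (C x) * (nC (C x) \<bullet> dC x h))) (at x)"
    using has_derivative_compose[OF Cd fC(1)[OF U(3)[OF assms]]] by (simp add: o_def)
  from fun_cong[OF frechet_derivative_at[OF this], of "(a, b)"]
  show "frechet_derivative (\<lambda>x. fC (C x)) (at x) (a, b) = \<rho> (C x) * (nC (C x) \<bullet> dC x (a, b))" by simp
qed

end

lemma has_real_derivative_inner:
  fixes f g :: "real \<Rightarrow> 'a::real_inner"
  assumes "(f has_vector_derivative f') (at x)" "(g has_vector_derivative g') (at x)"
  shows "((\<lambda>t. f t \<bullet> g t) has_real_derivative (f x \<bullet> g' + f' \<bullet> g x)) (at x)"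
  using bounded_bilinear.has_vector_derivative[OF bounded_bilinear_inner assms]
  by (simp add: has_real_derivative_iff_has_vector_derivative)

context triangle_family
begin

lemma linear_frechet_derivative: "smooth_open V F \<Longrightarrow> x \<in> V \<Longrightarrow> linear (frechet_derivative F (at x))"
  using smooth_open_has_derivative has_derivative_linear by blast

section \<open>First-order consequences of the reflection laws\<close>

definition "Y1 = {x\<in>Y. flat EA x \<and> flat EB x \<and> flat EC x \<and> flat (\<lambda>x. fC (C x)) x}"

lemma not_null_Y1: "\<not> null Y1"
proof
  assume "null Y1"
  have "null {x\<in>Y. \<not> flat EA x}" "null {x\<in>Y. \<not> flat EB x}" "null {x\<in>Y. \<not> flat EC x}"
    by (rule null_not_flat, rule smooth_E, simp, simp add: EA_def EB_def EC_def orbit)+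
  moreover have "null {x\<in>Y. \<not> flat (\<lambda>x. fC (C x)) x}"
    by (rule null_not_flat) (simp_all add: smooth_compositions orbit)
  ultimately have "null (Y1 \<union> {x\<in>Y. \<not> flat EA x} \<union> {x\<in>Y. \<not> flat EB x} \<union> {x\<in>Y. \<not> flat EC x}
      \<union> {x\<in>Y. \<not> flat (\<lambda>x. fC (C x)) x})"
    using \<open>null Y1\<close> by (intro null_Un)
  moreover have "Y \<subseteq> Y1 \<union> {x\<in>Y. \<not> flat EA x} \<union> {x\<in>Y. \<not> flat EB x} \<union> {x\<in>Y. \<not> flat EC x}
      \<union> {x\<in>Y. \<not> flat (\<lambda>x. fC (C x)) x}"
    by (auto simp: Y1_def)
  ultimately show False using null_subset Y by blast
qed

lemma Y1_D: "x \<in> Y1 \<Longrightarrow> x \<in> Y" "x \<in> Y1 \<Longrightarrow> x \<in> U"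
  using Y by (auto simp: Y1_def)

lemma dC_split: "x \<in> U \<Longrightarrow> dC x (a, b) = dC x (a, 0) + dC x (0, b)"
  using linear_add[OF linear_frechet_derivative[OF smooth(7)], of x "(a, 0)" "(0, b)"] by simp

lemma frechet_derivative_0:
  assumes "x \<in> U"
  shows "frechet_derivative nA (at (fst x)) 0 = 0" "frechet_derivative uA (at (fst x)) 0 = 0"
    "frechet_derivative nB (at (snd x)) 0 = 0" "frechet_derivative uB (at (snd x)) 0 = 0"
    "frechet_derivative nC (at (C x)) 0 = 0" "frechet_derivative uC (at (C x)) 0 = 0"
  by (intro linear_0 linear_frechet_derivative smooth U assms;
      (rule smooth)?; simp add: U assms)+

text \<open>For each law the test pair keeps its own vertex at rest, so that the derivatives of its
  normal and line drop out: \<open>(0, b)\<close> for \<open>A\<close>, \<open>(a, 0)\<close> for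
  \<open>B\<close>, and for \<open>C\<close> the pairs whose effects on \<open>C\<close> cancel. The
  last two identities come from \<open>fC\<close>.\<close>

lemma first_order:
  assumes x: "x \<in> Y1"
  shows "nB (snd x) \<bullet> b = 0 \<Longrightarrow>
      dcproj (nA (fst x)) 0 (snd x - fst x) b + dcproj (nA (fst x)) 0 (C x - fst x) (dC x (0, b)) = 0"
    and "nA (fst x) \<bullet> a = 0 \<Longrightarrow>
      dcproj (nB (snd x)) 0 (fst x - snd x) a + dcproj (nB (snd x)) 0 (C x - snd x) (dC x (a, 0)) = 0"
    and "nA (fst x) \<bullet> a = 0 \<Longrightarrow> nB (snd x) \<bullet> b = 0 \<Longrightarrow> dC x (a, 0) + dC x (0, b) = 0 \<Longrightarrow>
      dcproj (nC (C x)) 0 (fst x - C x) a + dcproj (nC (C x)) 0 (snd x - C x) b = 0"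
    and "nA (fst x) \<bullet> a = 0 \<Longrightarrow> nC (C x) \<bullet> dC x (a, 0) = 0"
    and "nB (snd x) \<bullet> b = 0 \<Longrightarrow> nC (C x) \<bullet> dC x (0, b) = 0"
proof -
  have xU: "x \<in> U" using x Y1_D by blast
  have fl: "flat EA x" "flat EB x" "flat EC x" "flat (\<lambda>x. fC (C x)) x" using x by (auto simp: Y1_def)
  note d = dE[OF xU] frechet_derivative_0[OF xU]
  show "dcproj (nA (fst x)) 0 (snd x - fst x) b + dcproj (nA (fst x)) 0 (C x - fst x) (dC x (0, b)) = 0"
    if "nB (snd x) \<bullet> b = 0"
    using fl(1)[unfolded flat_def, rule_format, of 0 b] that by (simp add: d)
  show "dcproj (nB (snd x)) 0 (fst x - snd x) a + dcproj (nB (snd x)) 0 (C x - snd x) (dC x (a, 0)) = 0"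
    if "nA (fst x) \<bullet> a = 0"
    using fl(2)[unfolded flat_def, rule_format, of a 0] that by (simp add: d)
  show "dcproj (nC (C x)) 0 (fst x - C x) a + dcproj (nC (C x)) 0 (snd x - C x) b = 0"
    if "nA (fst x) \<bullet> a = 0" "nB (snd x) \<bullet> b = 0" "dC x (a, 0) + dC x (0, b) = 0"
    using fl(3)[unfolded flat_def, rule_format, of a b] that by (simp add: d dC_split[OF xU, of a b])
  show "nC (C x) \<bullet> dC x (a, 0) = 0" if "nA (fst x) \<bullet> a = 0"
    using fl(4)[unfolded flat_def, rule_format, of a 0] that by (simp add: d fC(2)[OF U(3)[OF xU]])
  show "nC (C x) \<bullet> dC x (0, b) = 0" if "nB (snd x) \<bullet> b = 0"
    using fl(4)[unfolded flat_def, rule_format, of 0 b] that by (simp add: d fC(2)[OF U(3)[OF xU]])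
qed

lemma ceva_Y1:
  assumes "x \<in> Y1"
  shows "(nA (fst x) \<bullet> (snd x - fst x)) * (nB (snd x) \<bullet> (C x - snd x)) * (nC (C x) \<bullet> (fst x - C x))
    = (nA (fst x) \<bullet> (C x - fst x)) * (nB (snd x) \<bullet> (fst x - snd x)) * (nC (C x) \<bullet> (snd x - C x))"
proof -
  have x: "x \<in> U" "x \<in> Y" using assms Y1_D by blast+
  obtain h where "h \<noteq> 0" "h \<bullet> (snd x - fst x) = 0" "h \<bullet> (C x - fst x) = 0"
    using exists_orthogonal_pair[OF dim3] by metis
  then show ?thesis
    by (rule ceva[OF unit(1)[OF x(2)] orbit(1)[OF x(2), symmetric] nonzero[OF x(1)]])
       (use first_order[OF assms] in blast)+
qed

section \<open>Mixed second-order consequences\<close>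

definition "PA A i = i - (nA A \<bullet> i) *\<^sub>R uA A"
definition "PB B i = i - (nB B \<bullet> i) *\<^sub>R uB B"

text \<open>The projections \<open>PA (fst x) i\<close> vary smoothly over all of \<open>U\<close>
  and span the tangent hyperplane at points of \<open>Y\<close>. Derivatives along them are again
  smooth functions on \<open>U\<close>, to which \<open>null_not_flat\<close> applies.\<close>

definition "derivA F i x = frechet_derivative F (at x) (PA (fst x) i, 0)"
definition "derivB F i x = frechet_derivative F (at x) (0, PB (snd x) i)"

lemma smooth_deriv:
  assumes "smooth_open U F" shows "smooth_open U (derivA F i)" "smooth_open U (derivB F i)"
  unfolding derivA_def derivB_def PA_def PB_def
  by (rule smooth_open_deriv[OF opens(1) assms _ smooth_open_has_derivative[OF assms]],
      intro smooth_open_Pair smooth_open_diff smooth_open_scaleR smooth_open_inner smooth_open_const smooth_simps,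
      assumption)+

lemma P_tangent: "x \<in> Y \<Longrightarrow> nA (fst x) \<bullet> PA (fst x) i = 0" "x \<in> Y \<Longrightarrow> nB (snd x) \<bullet> PB (snd x) i = 0"
  by (simp_all add: PA_def PB_def inner_diff_right unit)

lemma deriv_0:
  assumes "x \<in> Y" "flat F x" shows "derivA F i x = 0" "derivB F i x = 0"
  using assms P_tangent unfolding derivA_def derivB_def flat_def by auto

definition "Y2 = {x\<in>Y1. \<forall>i\<in>Basis. flat (derivA EA i) x \<and> flat (derivA EB i) x \<and> flat (derivB EA i) x \<and> flat (derivB EB i) x}"

lemma not_null_Y2: "\<not> null Y2"
proof
  assume "null Y2"
  let ?N = "\<Union>i\<in>Basis. {x\<in>Y1. \<not> flat (derivA EA i) x} \<union> {x\<in>Y1. \<not> flat (derivA EB i) x} \<union>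
      {x\<in>Y1. \<not> flat (derivB EA i) x} \<union> {x\<in>Y1. \<not> flat (derivB EB i) x}"
  have "null ?N"
    by (intro null_UN finite_Basis null_Un null_not_flat smooth_deriv smooth_E)
       (auto simp: Y1_def intro!: deriv_0)
  then have "null (Y2 \<union> ?N)" using \<open>null Y2\<close> null_Un by blast
  moreover have "Y1 \<subseteq> Y2 \<union> ?N" by (auto simp: Y2_def)
  ultimately show False using not_null_Y1 null_subset by blast
qed

lemma curves:
  fixes a b
  assumes x: "(A, B) \<in> U" and F: "smooth_open U F"
  shows "((\<lambda>t. F (A + t *\<^sub>R a, B)) has_vector_derivative frechet_derivative F (at (A, B)) (a, 0)) (at 0)"
    and "((\<lambda>t. F (A, B + t *\<^sub>R b)) has_vector_derivative frechet_derivative F (at (A, B)) (0, b)) (at 0)"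
  using smooth_open_curve[OF F x, of "(a, 0)"] smooth_open_curve[OF F x, of "(0, b)"] by simp_all

lemma open_curves:
  "open {t. (A, B + t *\<^sub>R b) \<in> U}" "open {t. (A + t *\<^sub>R a, B) \<in> U}"
  by (intro open_vimage[OF opens(1), unfolded vimage_def] continuous_intros)+

text \<open>\<open>A\<close> is fixed along the curve, and with it the field \<open>PA A i\<close>,
  so the mixed second derivative has no term from a varying direction. The curve may leave the
  hypersurface; only its velocity \<open>b\<close> has to be tangent.\<close>

lemma flat_derivA_curve:
  fixes F :: "'a \<times> 'a \<Rightarrow> 'c::euclidean_space"
  assumes x: "(A, B) \<in> Y" and F: "smooth_open U F" and fl: "\<And>i. i \<in> Basis \<Longrightarrow> flat (derivA F i) (A, B)"
    and a: "nA A \<bullet> a = 0" and b: "nB B \<bullet> b = 0"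
  shows "((\<lambda>t. frechet_derivative F (at (A, B + t *\<^sub>R b)) (a, 0)) has_vector_derivative 0) (at 0)"
proof -
  have xU: "(A, B) \<in> U" using x Y by auto
  have "((\<lambda>t. derivA F i (A, B + t *\<^sub>R b)) has_vector_derivative 0) (at 0)" if "i \<in> Basis" for i
    using curves(2)[OF xU smooth_deriv(1)[OF F], of i b] fl[OF that] b by (simp add: flat_def)
  then have "((\<lambda>t. \<Sum>i\<in>Basis. (a \<bullet> i) *\<^sub>R derivA F i (A, B + t *\<^sub>R b)) has_vector_derivative
     (\<Sum>i\<in>Basis. (a \<bullet> i) *\<^sub>R 0)) (at 0)"
    by (intro has_vector_derivative_sum bounded_linear.has_vector_derivative[OF bounded_linear_scaleR_right])
  then have 1: "((\<lambda>t. \<Sum>i\<in>Basis. (a \<bullet> i) *\<^sub>R derivA F i (A, B + t *\<^sub>R b)) has_vector_derivative 0) (at 0)" by simp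
  have Pa: "(\<Sum>i\<in>Basis. (a \<bullet> i) *\<^sub>R PA A i) = a"
  proof -
    have "linear (PA A)" unfolding PA_def
      by (intro linearI) (auto simp: inner_add_right algebra_simps)
    from deriv_in_coordinates[OF this, of a] show ?thesis using a by (simp add: PA_def)
  qed
  have "(\<Sum>i\<in>Basis. (a \<bullet> i) *\<^sub>R derivA F i (A, B + t *\<^sub>R b)) = frechet_derivative F (at (A, B + t *\<^sub>R b)) (a, 0)"
    if "t \<in> {t. (A, B + t *\<^sub>R b) \<in> U}" for t
  proof -
    have l: "linear (frechet_derivative F (at (A, B + t *\<^sub>R b)))"
      using linear_frechet_derivative[OF F] that by auto
    have "(\<Sum>i\<in>Basis. (a \<bullet> i) *\<^sub>R (PA A i, 0 :: 'a)) = (a, 0)"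
      using Pa by (simp add: sum_prod)
    then show ?thesis unfolding derivA_def by (simp flip: linear_scale[OF l] linear_sum[OF l])
  qed
  from has_vector_derivative_transform_within_open[OF 1 open_curves(1) _ this] show ?thesis using xU by simp
qed

lemma flat_derivB_curve:
  fixes F :: "'a \<times> 'a \<Rightarrow> 'c::euclidean_space"
  assumes x: "(A, B) \<in> Y" and F: "smooth_open U F" and fl: "\<And>i. i \<in> Basis \<Longrightarrow> flat (derivB F i) (A, B)"
    and a: "nA A \<bullet> a = 0" and b: "nB B \<bullet> b = 0"
  shows "((\<lambda>t. frechet_derivative F (at (A + t *\<^sub>R a, B)) (0, b)) has_vector_derivative 0) (at 0)"
proof -
  have xU: "(A, B) \<in> U" using x Y by auto
  have "((\<lambda>t. derivB F i (A + t *\<^sub>R a, B)) has_vector_derivative 0) (at 0)" if "i \<in> Basis" for i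
    using curves(1)[OF xU smooth_deriv(2)[OF F], of i a] fl[OF that] a by (simp add: flat_def)
  then have "((\<lambda>t. \<Sum>i\<in>Basis. (b \<bullet> i) *\<^sub>R derivB F i (A + t *\<^sub>R a, B)) has_vector_derivative
     (\<Sum>i\<in>Basis. (b \<bullet> i) *\<^sub>R 0)) (at 0)"
    by (intro has_vector_derivative_sum bounded_linear.has_vector_derivative[OF bounded_linear_scaleR_right])
  then have 1: "((\<lambda>t. \<Sum>i\<in>Basis. (b \<bullet> i) *\<^sub>R derivB F i (A + t *\<^sub>R a, B)) has_vector_derivative 0) (at 0)" by simp
  have Pb: "(\<Sum>i\<in>Basis. (b \<bullet> i) *\<^sub>R PB B i) = b"
  proof -
    have "linear (PB B)" unfolding PB_def
      by (intro linearI) (auto simp: inner_add_right algebra_simps)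
    from deriv_in_coordinates[OF this, of b] show ?thesis using b by (simp add: PB_def)
  qed
  have "(\<Sum>i\<in>Basis. (b \<bullet> i) *\<^sub>R derivB F i (A + t *\<^sub>R a, B)) = frechet_derivative F (at (A + t *\<^sub>R a, B)) (0, b)"
    if "t \<in> {t. (A + t *\<^sub>R a, B) \<in> U}" for t
  proof -
    have l: "linear (frechet_derivative F (at (A + t *\<^sub>R a, B)))"
      using linear_frechet_derivative[OF F] that by auto
    have "(\<Sum>i\<in>Basis. (b \<bullet> i) *\<^sub>R (0 :: 'a, PB B i)) = (0, b)"
      using Pb by (simp add: sum_prod)
    then show ?thesis unfolding derivB_def by (simp flip: linear_scale[OF l] linear_sum[OF l])
  qed
  from has_vector_derivative_transform_within_open[OF 1 open_curves(2) _ this] show ?thesis using xU by simp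
qed

lemma kappa_A:
  assumes x: "(A, B) \<in> Y2" and b: "nB B \<bullet> b = 0"
    and plane: "\<And>h. h \<bullet> (B - A) = 0 \<Longrightarrow> h \<bullet> (C (A, B) - A) = 0 \<Longrightarrow> h \<bullet> b = 0"
  shows "((\<lambda>t. 1 / (nA A \<bullet> (B + t *\<^sub>R b - A)) + 1 / (nA A \<bullet> (C (A, B + t *\<^sub>R b) - A)) +
      (nB (B + t *\<^sub>R b) \<bullet> (C (A, B + t *\<^sub>R b) - (B + t *\<^sub>R b))) /
      ((nA A \<bullet> (C (A, B + t *\<^sub>R b) - A)) * (nB (B + t *\<^sub>R b) \<bullet> (A - (B + t *\<^sub>R b))))) has_real_derivative 0) (at 0)"
proof -
  have xY: "(A, B) \<in> Y1" "(A, B) \<in> Y" "(A, B) \<in> U" using x Y1_D by (auto simp: Y2_def)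
  obtain h where h: "h \<noteq> 0" "h \<bullet> (B - A) = 0" "h \<bullet> (C (A, B) - A) = 0"
    using exists_orthogonal_pair[OF dim3] by metis
  \<comment> \<open>Tangent at \<open>A\<close> but transversal to the plane: \<open>uA A\<close> is
    orthogonal to \<open>h\<close>, so the projection preserves the
    \<open>h\<close>-component.\<close>
  define a where "a = PA A h"
  have "h \<bullet> (2 *\<^sub>R uA A) = 0"
    using orbit(1)[OF xY(2)] h by (simp flip: orbit(1)[OF xY(2), simplified] add: inner_add_right inner_cproj)
  then have ha: "h \<bullet> a \<noteq> 0" using h(1) by (simp add: a_def PA_def inner_diff_right)
  have a: "nA A \<bullet> a = 0" using P_tangent(1)[OF xY(2)] by (simp add: a_def)
  have Cd: "((\<lambda>t. C (A, B + t *\<^sub>R b)) has_vector_derivative dC (A, B) (0, b)) (at 0)"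
    by (rule curves[OF xY(3) smooth(7)])
  have "smooth_open U (\<lambda>x. dC x (a, 0))"
    by (rule smooth_open_deriv[OF opens(1) smooth(7) smooth_open_const smooth_open_has_derivative[OF smooth(7)]])
  note cd = curves(2)[OF xY(3) this, of b]
  note nd = curves(2)[OF xY(3) smooth_compositions(3), of b]
  have hb: "h \<bullet> b = 0" using plane h by blast
  \<comment> \<open>The law at \<open>A\<close>, with \<open>A\<close> fixed, forces
    \<open>C\<close> to start moving within the plane when \<open>B\<close> does.\<close>
  have hC: "h \<bullet> dC (A, B) (0, b) = 0"
    using arg_cong[OF first_order(1)[OF xY(1), of b], of "\<lambda>v. h \<bullet> v"] b h hb nonzero(2)[OF xY(3)]
    by (simp add: inner_add_right inner_dcproj)
  have fl: "flat (derivA EA i) (A, B)" "flat (derivA EB i) (A, B)" if "i \<in> Basis" for i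
    using x that by (auto simp: Y2_def)
  have "((\<lambda>t. dcproj (nA A) (frechet_derivative nA (at A) a) (B + t *\<^sub>R b - A) (- a)
      + dcproj (nA A) (frechet_derivative nA (at A) a) (C (A, B + t *\<^sub>R b) - A) (dC (A, B + t *\<^sub>R b) (a, 0) - a)
      - 2 *\<^sub>R frechet_derivative uA (at A) a) has_vector_derivative 0) (at 0)"
    by (rule has_vector_derivative_transform_within_open[OF flat_derivA_curve[OF xY(2) smooth_E(1) fl(1) a b] open_curves(1)[where A = A and B = B and b = b]])
       (use xY(3) in \<open>auto simp: dE\<close>)
  moreover have "((\<lambda>t. dcproj (nB (B + t *\<^sub>R b)) 0 (A - (B + t *\<^sub>R b)) a
      + dcproj (nB (B + t *\<^sub>R b)) 0 (C (A, B + t *\<^sub>R b) - (B + t *\<^sub>R b)) (dC (A, B + t *\<^sub>R b) (a, 0))) has_vector_derivative 0) (at 0)"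
    by (rule has_vector_derivative_transform_within_open[OF flat_derivA_curve[OF xY(2) smooth_E(2) fl(2) a b] open_curves(1)[where A = A and B = B and b = b]])
       (use xY(3) frechet_derivative_0(3,4) in \<open>force simp: dE\<close>)+
  ultimately show ?thesis
    using kappa[OF Cd cd _ _ _ _ _ ha h(2) _ hb hC, of "\<lambda>t. nB (B + t *\<^sub>R b)" _ "nA A" "frechet_derivative nA (at A) a"
        "frechet_derivative uA (at A) a"] nd nonzero[OF xY(3)] h first_order(2)[OF xY(1), of a] a by simp
qed

lemma kappa_B:
  assumes x: "(A, B) \<in> Y2" and a: "nA A \<bullet> a = 0"
    and plane: "\<And>h. h \<bullet> (A - B) = 0 \<Longrightarrow> h \<bullet> (C (A, B) - B) = 0 \<Longrightarrow> h \<bullet> a = 0"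
  shows "((\<lambda>t. 1 / (nB B \<bullet> (A + t *\<^sub>R a - B)) + 1 / (nB B \<bullet> (C (A + t *\<^sub>R a, B) - B)) +
      (nA (A + t *\<^sub>R a) \<bullet> (C (A + t *\<^sub>R a, B) - (A + t *\<^sub>R a))) /
      ((nB B \<bullet> (C (A + t *\<^sub>R a, B) - B)) * (nA (A + t *\<^sub>R a) \<bullet> (B - (A + t *\<^sub>R a))))) has_real_derivative 0) (at 0)"
proof -
  have xY: "(A, B) \<in> Y1" "(A, B) \<in> Y" "(A, B) \<in> U" using x Y1_D by (auto simp: Y2_def)
  obtain h where h: "h \<noteq> 0" "h \<bullet> (A - B) = 0" "h \<bullet> (C (A, B) - B) = 0"
    using exists_orthogonal_pair[OF dim3] by metis
  define b where "b = PB B h"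
  have "h \<bullet> (2 *\<^sub>R uB B) = 0"
    using orbit(2)[OF xY(2)] h by (simp flip: orbit(2)[OF xY(2), simplified] add: inner_add_right inner_cproj)
  then have hb: "h \<bullet> b \<noteq> 0" using h(1) by (simp add: b_def PB_def inner_diff_right)
  have b: "nB B \<bullet> b = 0" using P_tangent(2)[OF xY(2)] by (simp add: b_def)
  have Cd: "((\<lambda>t. C (A + t *\<^sub>R a, B)) has_vector_derivative dC (A, B) (a, 0)) (at 0)"
    by (rule curves[OF xY(3) smooth(7)])
  have "smooth_open U (\<lambda>x. dC x (0, b))"
    by (rule smooth_open_deriv[OF opens(1) smooth(7) smooth_open_const smooth_open_has_derivative[OF smooth(7)]])
  note cd = curves(1)[OF xY(3) this, of a]
  note nd = curves(1)[OF xY(3) smooth_compositions(1), of a]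
  have ha: "h \<bullet> a = 0" using plane h by blast
  have hC: "h \<bullet> dC (A, B) (a, 0) = 0"
    using arg_cong[OF first_order(2)[OF xY(1), of a], of "\<lambda>v. h \<bullet> v"] a h ha nonzero(4)[OF xY(3)]
    by (simp add: inner_add_right inner_dcproj)
  have fl: "flat (derivB EA i) (A, B)" "flat (derivB EB i) (A, B)" if "i \<in> Basis" for i
    using x that by (auto simp: Y2_def)
  have "((\<lambda>t. dcproj (nB B) (frechet_derivative nB (at B) b) (A + t *\<^sub>R a - B) (- b)
      + dcproj (nB B) (frechet_derivative nB (at B) b) (C (A + t *\<^sub>R a, B) - B) (dC (A + t *\<^sub>R a, B) (0, b) - b)
      - 2 *\<^sub>R frechet_derivative uB (at B) b) has_vector_derivative 0) (at 0)"
    by (rule has_vector_derivative_transform_within_open[OF flat_derivB_curve[OF xY(2) smooth_E(2) fl(2) a b] open_curves(2)[where A = A and B = B and a = a]])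
       (use xY(3) in \<open>auto simp: dE\<close>)
  moreover have "((\<lambda>t. dcproj (nA (A + t *\<^sub>R a)) 0 (B - (A + t *\<^sub>R a)) b
      + dcproj (nA (A + t *\<^sub>R a)) 0 (C (A + t *\<^sub>R a, B) - (A + t *\<^sub>R a)) (dC (A + t *\<^sub>R a, B) (0, b))) has_vector_derivative 0) (at 0)"
    by (rule has_vector_derivative_transform_within_open[OF flat_derivB_curve[OF xY(2) smooth_E(1) fl(1) a b] open_curves(2)[where A = A and B = B and a = a]])
       (use xY(3) frechet_derivative_0(1,2) in \<open>force simp: dE\<close>)+
  ultimately show ?thesis
    using kappa[OF Cd cd _ _ _ _ _ hb h(2) _ ha hC, of "\<lambda>t. nA (A + t *\<^sub>R a)" _ "nB B" "frechet_derivative nB (at B) b"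
        "frechet_derivative uB (at B) b"] nd nonzero[OF xY(3)] h first_order(1)[OF xY(1), of b] b by simp
qed

section \<open>The second fundamental form at the first vertex and the contradiction\<close>

definition "\<tau> x = cproj (nA (fst x)) (snd x - fst x) - cproj (nA (fst x)) (C x - fst x)"

text \<open>The defect in the formula for the second fundamental form, written as a smooth function
  on \<open>U\<close> so that its vanishing can be differentiated once more.\<close>

definition "M x = frechet_derivative nA (at (fst x)) (\<tau> x) \<bullet> \<tau> x
  - 4 * ((nB (snd x) \<bullet> (C x - snd x)) / ((nA (fst x) \<bullet> (C x - fst x)) * (nB (snd x) \<bullet> (fst x - snd x))))"

lemma smooth_tau: "smooth_open U \<tau>"
  unfolding \<tau>_def
  by (intro smooth_open_diff smooth_open_cproj smooth_simps nonzero smooth_open_fst smooth_open_snd; assumption)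

lemma smooth_M: "smooth_open U M"
proof -
  have "((\<lambda>x. nA (fst x)) has_derivative (\<lambda>h. frechet_derivative nA (at (fst x)) (fst h))) (at x)" if "x \<in> U" for x
    using has_derivative_compose[OF has_derivative_fst[OF has_derivative_ident]
        smooth_open_has_derivative[OF smooth(1) U(1)[OF that]]] by (simp add: o_def)
  from smooth_open_deriv[OF opens(1) smooth_compositions(1) smooth_open_Pair[OF smooth_tau smooth_open_const[of _ 0]] this]
  have "smooth_open U (\<lambda>x. frechet_derivative nA (at (fst x)) (\<tau> x))" by simp
  then show ?thesis unfolding M_def
    by (intro smooth_open_diff smooth_open_inner smooth_tau smooth_open_mult smooth_open_divide smooth_open_const
      smooth_simps smooth_open_fst smooth_open_snd) (simp_all add: nonzero)
qed

text \<open>\<open>A\<close> moves along its in-plane tangent \<open>\<tau>\<close> while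
  \<open>B\<close> is fixed. Comparing the explicit derivative of the sum in \<open>kappa_B\<close>
  with 0 yields hypothesis \<open>K\<close> of \<open>second_fundamental_form\<close>.\<close>

lemma M_eq_0:
  assumes "x \<in> Y2" shows "M x = 0"
proof -
  obtain A B where x: "x = (A, B)" by force
  have xY: "(A, B) \<in> Y1" "(A, B) \<in> Y" "(A, B) \<in> U" using assms x Y1_D by (auto simp: Y2_def)
  note nz = nonzero[OF xY(3), simplified]
  define a where "a = \<tau> (A, B)"
  define c where "c = dC (A, B) (a, 0)"
  define m where "m = frechet_derivative nA (at A) a"
  have a: "nA A \<bullet> a = 0" using nz by (simp add: a_def \<tau>_def inner_diff_right[of _ "cproj _ _"] inner_cproj)
  have "h \<bullet> a = 0" if "h \<bullet> (A - B) = 0" "h \<bullet> (C (A, B) - B) = 0" for h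
  proof -
    have "h \<bullet> (B - A) = 0" "h \<bullet> (C (A, B) - A) = 0" using that by (simp_all add: inner_diff_right)
    then show ?thesis by (simp add: a_def \<tau>_def inner_diff_right[of _ "cproj _ _"] inner_cproj)
  qed
  note K = kappa_B[OF assms[unfolded x] a this]
  have A': "((\<lambda>t. A + t *\<^sub>R a) has_vector_derivative a) (at 0)" by (auto intro!: derivative_eq_intros)
  have C': "((\<lambda>t. C (A + t *\<^sub>R a, B)) has_vector_derivative c) (at 0)"
    unfolding c_def by (rule curves[OF xY(3) smooth(7)])
  have n': "((\<lambda>t. nA (A + t *\<^sub>R a)) has_vector_derivative m) (at 0)"
    unfolding m_def by (rule smooth_open_curve[OF smooth(1)]) (use U(1)[OF xY(3)] in simp)
  have d: "((\<lambda>t. nB B \<bullet> (A + t *\<^sub>R a - B)) has_real_derivative nB B \<bullet> a) (at 0)"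
      "((\<lambda>t. nB B \<bullet> (C (A + t *\<^sub>R a, B) - B)) has_real_derivative nB B \<bullet> c) (at 0)"
      "((\<lambda>t. nA (A + t *\<^sub>R a) \<bullet> (C (A + t *\<^sub>R a, B) - (A + t *\<^sub>R a))) has_real_derivative m \<bullet> (C (A, B) - A) + nA A \<bullet> c) (at 0)"
      "((\<lambda>t. nA (A + t *\<^sub>R a) \<bullet> (B - (A + t *\<^sub>R a))) has_real_derivative m \<bullet> (B - A)) (at 0)"
    using has_real_derivative_inner[OF has_vector_derivative_const[of "nB B"] has_vector_derivative_diff[OF A' has_vector_derivative_const[of B]]]
      has_real_derivative_inner[OF has_vector_derivative_const[of "nB B"] has_vector_derivative_diff[OF C' has_vector_derivative_const[of B]]]
      has_real_derivative_inner[OF n' has_vector_derivative_diff[OF C' A']]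
      has_real_derivative_inner[OF n' has_vector_derivative_diff[OF has_vector_derivative_const[of B] A']]
    by (simp_all add: inner_diff_right[of _ c] a add.commute)
  have "((\<lambda>t. 1 / (nB B \<bullet> (A + t *\<^sub>R a - B)) + 1 / (nB B \<bullet> (C (A + t *\<^sub>R a, B) - B)) +
      (nA (A + t *\<^sub>R a) \<bullet> (C (A + t *\<^sub>R a, B) - (A + t *\<^sub>R a))) /
      ((nB B \<bullet> (C (A + t *\<^sub>R a, B) - B)) * (nA (A + t *\<^sub>R a) \<bullet> (B - (A + t *\<^sub>R a))))) has_real_derivative
      - (nB B \<bullet> a) / (nB B \<bullet> (A - B))\<^sup>2 - (nB B \<bullet> c) / (nB B \<bullet> (C (A, B) - B))\<^sup>2
      + ((m \<bullet> (C (A, B) - A) + nA A \<bullet> c) * ((nB B \<bullet> (C (A, B) - B)) * (nA A \<bullet> (B - A)))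
        - (nA A \<bullet> (C (A, B) - A)) * ((nB B \<bullet> c) * (nA A \<bullet> (B - A)) + (nB B \<bullet> (C (A, B) - B)) * (m \<bullet> (B - A))))
        / ((nB B \<bullet> (C (A, B) - B)) * (nA A \<bullet> (B - A)))\<^sup>2) (at 0)"
    by (rule derivative_eq_intros d refl | use nz in \<open>simp add: power2_eq_square\<close>)+
  from DERIV_unique[OF this K]
  have "m \<bullet> a = 4 * (nB B \<bullet> (C (A, B) - B)) / ((nB B \<bullet> (A - B)) * (nA A \<bullet> (C (A, B) - A)))"
    using first_order(2)[OF xY(1), of a] first_order(4)[OF xY(1), of a] a ceva_Y1[OF xY(1)]
    unfolding a_def \<tau>_def fst_conv snd_conv
    by (intro second_fundamental_form[OF nz, where c = c]) (simp_all add: c_def a_def \<tau>_def)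
  then show ?thesis by (simp add: x M_def m_def a_def mult.commute)
qed

text \<open>One point of \<open>Y2\<close> where \<open>M\<close> is flat suffices: moving
  \<open>B\<close> in the plane of that triangle with \<open>A\<close> fixed puts
  \<open>kappa_A\<close> and the derivative of \<open>M\<close> into
  \<open>curvature_contradiction\<close>.\<close>

lemma no_triangle_family: False
proof -
  have "null {x\<in>Y2. \<not> flat M x}"
    by (rule null_not_flat[OF smooth_M]) (auto simp: Y2_def Y1_def M_eq_0)
  moreover have "{x\<in>Y2. flat M x} \<noteq> {}"
  proof
    assume "{x\<in>Y2. flat M x} = {}"
    then have "{x\<in>Y2. \<not> flat M x} = Y2" by auto
    with calculation show False using not_null_Y2 by simp
  qed
  ultimately obtain A B where x: "(A, B) \<in> Y2" and fl: "flat M (A, B)" by auto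
  have xY: "(A, B) \<in> Y1" "(A, B) \<in> Y" "(A, B) \<in> U" using x Y1_D by (auto simp: Y2_def)
  note nz = nonzero[OF xY(3), simplified]
  define b where "b = cproj (nB B) (C (A, B) - B) - cproj (nB B) (A - B)"
  have b: "nB B \<bullet> b = 0" using nz by (simp add: b_def inner_diff_right[of _ "cproj _ _"] inner_cproj)
  have "h \<bullet> b = 0" if "h \<bullet> (B - A) = 0" "h \<bullet> (C (A, B) - A) = 0" for h
  proof -
    have "h \<bullet> (A - B) = 0" "h \<bullet> (C (A, B) - B) = 0" using that by (simp_all add: inner_diff_right)
    then show ?thesis by (simp add: b_def inner_diff_right[of _ "cproj _ _"] inner_cproj)
  qed
  note K = kappa_A[OF x b this]
  have "((\<lambda>t. M (A, B + t *\<^sub>R b)) has_vector_derivative 0) (at 0)"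
    using curves(2)[OF xY(3) smooth_M, of b] fl b by (simp add: flat_def)
  then have M: "((\<lambda>t. M (A, B + t *\<^sub>R b)) has_real_derivative 0) (at 0)"
    by (simp add: has_real_derivative_iff_has_vector_derivative)
  have L: "linear (frechet_derivative nA (at A))"
    using linear_frechet_derivative[OF smooth(1)] U(1)[OF xY(3)] by simp
  show False
    using curvature_contradiction[where A = A and B = B and nA = "nA A" and nC = "nC (C (A, B))"
        and c = "dC (A, B) (0, b)" and Ct = "\<lambda>t. C (A, B + t *\<^sub>R b)" and nBt = "\<lambda>t. nB (B + t *\<^sub>R b)"
        and L = "frechet_derivative nA (at A)"]
      nz ceva_Y1[OF xY(1)] first_order(1)[OF xY(1), of b] first_order(5)[OF xY(1), of b] b
      curves(2)[OF xY(3) smooth(7), of b] L K M M_eq_0[OF x]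
    unfolding M_def \<tau>_def by (simp add: b_def[symmetric])
qed

end

section \<open>Vanishing of derivatives almost everywhere\<close>

text \<open>Countably many of the isolating neighbourhoods cover \<open>S\<close>, and each contains
  at most one of its points.\<close>

lemma countable_if_isolated:
  fixes S :: "'a::second_countable_topology set"
  assumes "\<And>x. x \<in> S \<Longrightarrow> \<exists>W. open W \<and> x \<in> W \<and> S \<inter> W \<subseteq> {x}"
  shows "countable S"
proof -
  obtain W where W: "\<And>x. x \<in> S \<Longrightarrow> open (W x) \<and> x \<in> W x \<and> S \<inter> W x \<subseteq> {x}"
    using assms by metis
  obtain F where F: "F \<subseteq> W ` S" "countable F" "\<Union>F = \<Union>(W ` S)"
    using Lindelof[of "W ` S"] W by blast
  obtain T where T: "T \<subseteq> S" "countable T" "F = W ` T"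
    using F(1,2) by (metis countable_subset_image)
  have "x \<in> T" if "x \<in> S" for x
  proof -
    have "x \<in> \<Union>(W ` T)" using F(3) T(3) W that by blast
    then obtain y where "y \<in> T" "x \<in> W y" by blast
    then show ?thesis using W[of y] T(1) that by blast
  qed
  then have "S \<subseteq> T" by blast
  then show ?thesis using T countable_subset by blast
qed

lemma countable_simple_zeros:
  fixes h h' :: "real \<Rightarrow> real"
  assumes "\<And>t. t \<in> S \<Longrightarrow> (h has_real_derivative h' t) (at t) \<and> h t = 0 \<and> h' t \<noteq> 0"
  shows "countable S"
proof (rule countable_if_isolated)
  fix t assume t: "t \<in> S"
  then have "((\<lambda>y. (h y - h t) / (y - t)) \<longlongrightarrow> h' t) (at t)"
    using assms unfolding has_field_derivative_iff by blast
  then have "\<forall>\<^sub>F y in at t. (h y - h t) / (y - t) \<noteq> 0"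
    using tendsto_imp_eventually_ne assms[OF t] by blast
  then obtain W where W: "open W" "t \<in> W" "\<And>y. y \<in> W \<Longrightarrow> y \<noteq> t \<Longrightarrow> (h y - h t) / (y - t) \<noteq> 0"
    unfolding eventually_at_topological by auto
  have "y = t" if "y \<in> S" "y \<in> W" for y
  proof (rule ccontr)
    assume "y \<noteq> t"
    from W(3)[OF that(2) this] show False using assms[OF that(1)] assms[OF t] by simp
  qed
  then have "S \<inter> W \<subseteq> {t}" by blast
  then show "\<exists>W. open W \<and> t \<in> W \<and> S \<inter> W \<subseteq> {t}" by (intro exI[of _ W] conjI W(1,2))
qed

text \<open>Fubini with the coordinate \<open>b\<close> innermost: every line parallel to
  \<open>b\<close> meets the set in countably many points.\<close>

lemma null_simple_zeros:
  fixes G :: "'a::euclidean_space \<Rightarrow> real"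
  assumes V: "open V" and B: "B \<subseteq> Basis" "b \<in> B"
    and G: "\<And>z. z \<in> V \<Longrightarrow> (G has_derivative G' z) (at z)"
    and G': "continuous_on V (\<lambda>z. G' z b)"
  shows "{z\<in>V \<inter> span B. G z = 0 \<and> G' z b \<noteq> 0} \<in> null_sets (span_lebesgue B)" (is "?N \<in> _")
proof -
  have finB: "finite B" using finite_subset[OF B(1) finite_Basis] .
  define B' where "B' = B - {b}"
  have B': "B = insert b B'" "finite B'" "b \<notin> B'" using B finB by (auto simp: B'_def)
  have cG: "continuous_on V G"
    using G by (intro continuous_at_imp_continuous_on ballI has_derivative_continuous)
  have "?N = (V \<inter> (\<lambda>z. G' z b) -` (- {0})) \<inter> span B - (V \<inter> G -` (- {0}))" by auto
  moreover have "open (V \<inter> (\<lambda>z. G' z b) -` (- {0}))" "open (V \<inter> G -` (- {0}))"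
    using continuous_open_preimage V G' cG by blast+
  moreover have "closed (span B)" by (rule closed_span)
  ultimately have Nb: "?N \<in> sets borel" by auto
  interpret product_sigma_finite "\<lambda>_::'a. lborel :: real measure" ..
  let ?P = "PiM B (\<lambda>_. lborel :: real measure)"
  let ?f = "\<lambda>x::'a \<Rightarrow> real. \<Sum>c\<in>B. x c *\<^sub>R c"
  have fm: "?f \<in> measurable ?P borel" by measurable
  have Nm: "?f -` ?N \<inter> space ?P \<in> sets ?P" using measurable_sets[OF fm Nb] .
  have inner0: "(\<integral>\<^sup>+y. indicator ?N (?f (x(b := y))) \<partial>lborel) = 0" for x :: "'a \<Rightarrow> real"
  proof -
    define w where "w = (\<Sum>c\<in>B'. x c *\<^sub>R c)"
    have f: "?f (x(b := y)) = w + y *\<^sub>R b" for y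
      using B' by (simp add: w_def add.commute) (rule sum.cong, auto)
    have "countable {y. w + y *\<^sub>R b \<in> ?N}"
    proof (rule countable_simple_zeros[where h = "\<lambda>y. G (w + y *\<^sub>R b)" and h' = "\<lambda>y. G' (w + y *\<^sub>R b) b"])
      fix t assume "t \<in> {y. w + y *\<^sub>R b \<in> ?N}"
      then have t: "w + t *\<^sub>R b \<in> V" "G (w + t *\<^sub>R b) = 0" "G' (w + t *\<^sub>R b) b \<noteq> 0" by auto
      have "((\<lambda>y. w + y *\<^sub>R b) has_derivative (\<lambda>y. y *\<^sub>R b)) (at t)" by (auto intro!: derivative_eq_intros)
      from has_derivative_compose[OF this G[OF t(1)]]
      have "((\<lambda>y. G (w + y *\<^sub>R b)) has_derivative (\<lambda>y. G' (w + t *\<^sub>R b) (y *\<^sub>R b))) (at t)" .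
      moreover have "G' (w + t *\<^sub>R b) (y *\<^sub>R b) = G' (w + t *\<^sub>R b) b * y" for y
        using linear_scale[OF has_derivative_linear[OF G[OF t(1)]]] by simp
      ultimately show "((\<lambda>y. G (w + y *\<^sub>R b)) has_real_derivative G' (w + t *\<^sub>R b) b) (at t) \<and>
          G (w + t *\<^sub>R b) = 0 \<and> G' (w + t *\<^sub>R b) b \<noteq> 0"
        using t by (simp add: has_field_derivative_def)
    qed
    then have "{y. w + y *\<^sub>R b \<in> ?N} \<in> null_sets lborel" by (rule countable_imp_null_set_lborel)
    then have "AE y in lborel. y \<notin> {y. w + y *\<^sub>R b \<in> ?N}" by (rule AE_not_in)
    then have "AE y in lborel. indicator ?N (?f (x(b := y))) = (0::ennreal)"
    proof eventually_elim
      case (elim y)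
      then show ?case unfolding f by (simp add: indicator_def)
    qed
    then have "(\<integral>\<^sup>+y. indicator ?N (?f (x(b := y))) \<partial>lborel) = (\<integral>\<^sup>+y. 0 \<partial>(lborel :: real measure))"
      by (rule nn_integral_cong_AE)
    then show ?thesis by simp
  qed
  have "emeasure ?P (?f -` ?N \<inter> space ?P) = (\<integral>\<^sup>+x. indicator (?f -` ?N \<inter> space ?P) x \<partial>?P)"
    using Nm by simp
  also have "\<dots> = (\<integral>\<^sup>+x. indicator ?N (?f x) \<partial>?P)"
    by (rule nn_integral_cong) (auto simp: indicator_def)
  also have "\<dots> = (\<integral>\<^sup>+x. (\<integral>\<^sup>+y. indicator ?N (?f (x(b := y))) \<partial>lborel) \<partial>PiM B' (\<lambda>_. lborel))"
  proof -
    have "(\<lambda>x. indicator ?N (?f x) :: ennreal) \<in> borel_measurable ?P"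
      using measurable_compose[OF fm borel_measurable_indicator[OF Nb]] .
    then show ?thesis
      using product_nn_integral_insert[OF B'(2,3), of "\<lambda>x. indicator ?N (?f x)"] unfolding B'(1) by simp
  qed
  also have "\<dots> = 0" unfolding inner0 by simp
  finally have "?f -` ?N \<inter> space ?P \<in> null_sets ?P" using Nm by (intro null_setsI)
  then have "?N \<in> null_sets (distr ?P borel ?f)"
    using null_sets_distr_iff[OF fm] Nb by simp
  then show ?thesis unfolding span_lebesgue_def by (rule null_sets_completionI)
qed

lemma null_sets_span_lebesgue_subset:
  "N \<in> null_sets (span_lebesgue B) \<Longrightarrow> S \<subseteq> N \<Longrightarrow> S \<in> null_sets (span_lebesgue B)"
  unfolding span_lebesgue_def using null_sets_completion_subset by blast

text \<open>Smallness of a set of pairs of base points is measured in chart coordinates, with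
  \<open>X\<close> sending a coordinate point to its pair. This provides the ideal
  \<open>null\<close> of \<open>triangle_family\<close>.\<close>

definition param_null :: "'e::euclidean_space set \<Rightarrow> 'e set \<Rightarrow> ('e \<Rightarrow> 'x) \<Rightarrow> 'x set \<Rightarrow> bool" where
  "param_null B V X S \<longleftrightarrow> {z\<in>V \<inter> span B. X z \<in> S} \<in> null_sets (span_lebesgue B)"

lemma param_null_subset: "param_null B V X S \<Longrightarrow> T \<subseteq> S \<Longrightarrow> param_null B V X T"
  unfolding param_null_def by (erule null_sets_span_lebesgue_subset) auto

lemma param_null_UN:
  assumes "countable I" "\<And>i. i \<in> I \<Longrightarrow> param_null B V X (S i)"
  shows "param_null B V X (\<Union>i\<in>I. S i)"
proof -
  have "(\<Union>i\<in>I. {z\<in>V \<inter> span B. X z \<in> S i}) \<in> null_sets (span_lebesgue B)"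
    using assms unfolding param_null_def by (intro null_sets_UN') auto
  then show ?thesis unfolding param_null_def by (rule null_sets_span_lebesgue_subset) auto
qed

lemma param_null_Un: "param_null B V X S \<Longrightarrow> param_null B V X T \<Longrightarrow> param_null B V X (S \<union> T)"
  using param_null_UN[of "{True, False}" B V X "\<lambda>i. if i then S else T"] by (simp add: Un_commute)

lemma param_null_empty: "param_null B V X {}"
  by (simp add: param_null_def)

text \<open>Otherwise countably many open sets meeting \<open>S\<close> in null sets would cover it.
  The lemma supplies a point around which local data can be chosen while the set stays
  non-null.\<close>

lemma not_param_null_localize:
  fixes X :: "'e::euclidean_space \<Rightarrow> 'x::second_countable_topology"
  assumes "\<not> param_null B V X S"
  obtains (1) x where "x \<in> S" "\<And>W. open W \<Longrightarrow> x \<in> W \<Longrightarrow> \<not> param_null B V X (S \<inter> W)"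
proof (rule ccontr)
  assume *: "\<not> thesis"
  have "\<exists>W. open W \<and> x \<in> W \<and> param_null B V X (S \<inter> W)" if "x \<in> S" for x
    using * \<open>x \<in> S\<close> 1 by blast
  then obtain W where W: "\<And>x. x \<in> S \<Longrightarrow> open (W x) \<and> x \<in> W x \<and> param_null B V X (S \<inter> W x)"
    by metis
  obtain F where F: "F \<subseteq> W ` S" "countable F" "\<Union>F = \<Union>(W ` S)"
    using Lindelof[of "W ` S"] W by blast
  obtain T where T: "T \<subseteq> S" "countable T" "F = W ` T"
    using F(1,2) by (metis countable_subset_image)
  have "param_null B V X (\<Union>x\<in>T. S \<inter> W x)" using T W by (intro param_null_UN) auto
  moreover have "S \<subseteq> (\<Union>x\<in>T. S \<inter> W x)" using F(3) T W by auto
  ultimately show False using assms param_null_subset by blast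
qed

text \<open>By \<open>T\<close>, a nonzero derivative of \<open>F\<close> along a vector in
  \<open>T\<close> becomes a nonzero derivative of \<open>F \<circ> X\<close> along some vector of
  \<open>span B\<close>, hence along some \<open>b \<in> B\<close>, where
  \<open>null_simple_zeros\<close> applies.\<close>

lemma param_null_deriv:
  fixes X :: "'e::euclidean_space \<Rightarrow> 'x::euclidean_space" and F :: "'x \<Rightarrow> real"
  assumes V: "open V" and B: "B \<subseteq> Basis" and X: "smooth_open V X"
    and U: "open U" "smooth_open U F" and Z: "Z \<subseteq> U" "\<And>x. x \<in> Z \<Longrightarrow> F x = 0"
    and T: "\<And>z v. z \<in> V \<inter> span B \<Longrightarrow> X z \<in> Z \<Longrightarrow> v \<in> T (X z) \<Longrightarrow> \<exists>\<xi>\<in>span B. frechet_derivative X (at z) \<xi> = v"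
  shows "param_null B V X {x\<in>Z. \<exists>v\<in>T x. frechet_derivative F (at x) v \<noteq> 0}"
proof -
  define V' where "V' = V \<inter> X -` U"
  have V': "open V'" unfolding V'_def
    using continuous_open_preimage smooth_open_continuous_on[OF X] V U(1) by blast
  define G where "G = (\<lambda>z. F (X z))"
  have G: "smooth_open V' G" unfolding G_def
    by (rule smooth_open_compose[OF U(2) smooth_open_subset[OF X]]) (auto simp: V'_def)
  let ?N = "\<lambda>b. {z\<in>V' \<inter> span B. G z = 0 \<and> frechet_derivative G (at z) b \<noteq> 0}"
  have "?N b \<in> null_sets (span_lebesgue B)" if "b \<in> B" for b
    by (rule null_simple_zeros[OF V' B that smooth_open_has_derivative[OF G]])
       (auto intro!: smooth_open_continuous_on smooth_open_deriv[OF V' G smooth_open_const smooth_open_has_derivative[OF G]])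
  then have N: "(\<Union>b\<in>B. ?N b) \<in> null_sets (span_lebesgue B)"
    using B finite_subset[OF B finite_Basis] by (intro null_sets_UN' countable_finite)
  have "{z\<in>V \<inter> span B. X z \<in> {x\<in>Z. \<exists>v\<in>T x. frechet_derivative F (at x) v \<noteq> 0}} \<subseteq> (\<Union>b\<in>B. ?N b)"
  proof
    fix z assume "z \<in> {z\<in>V \<inter> span B. X z \<in> {x\<in>Z. \<exists>v\<in>T x. frechet_derivative F (at x) v \<noteq> 0}}"
    then obtain v where z: "z \<in> V" "z \<in> span B" "X z \<in> Z" "v \<in> T (X z)" "frechet_derivative F (at (X z)) v \<noteq> 0"
      by auto
    obtain \<xi> where \<xi>: "\<xi> \<in> span B" "frechet_derivative X (at z) \<xi> = v" using T z by blast
    have zV': "z \<in> V'" using z Z by (auto simp: V'_def)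
    have "(G has_derivative (\<lambda>h. frechet_derivative F (at (X z)) (frechet_derivative X (at z) h))) (at z)"
      unfolding G_def
      using has_derivative_compose[OF smooth_open_has_derivative[OF X z(1)] smooth_open_has_derivative[OF U(2), of "X z"]]
        z Z by auto
    from fun_cong[OF frechet_derivative_at[OF this], of \<xi>]
    have "frechet_derivative G (at z) \<xi> \<noteq> 0" using \<xi> z by simp
    moreover have "linear (frechet_derivative G (at z))"
      using smooth_open_has_derivative[OF G zV'] has_derivative_linear by blast
    ultimately obtain b where "b \<in> B" "frechet_derivative G (at z) b \<noteq> 0"
      using linear_eq_0_on_span \<xi>(1) by blast
    then show "z \<in> (\<Union>b\<in>B. ?N b)" using zV' z Z by (auto simp: G_def)
  qed
  then show ?thesis unfolding param_null_def using null_sets_span_lebesgue_subset[OF N] by blast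
qed

section \<open>Line-framed hypersurfaces\<close>

lemma isCont_eventually_in_open:
  assumes "isCont c x" "open W" "c x \<in> W"
  shows "\<forall>\<^sub>F t in nhds x. c t \<in> W"
  using topological_tendstoD[OF assms(1)[unfolded isCont_def tendsto_at_iff_tendsto_nhds] assms(2,3)] .

lemma tangent_space_derivative_0:
  assumes "v \<in> tangent_space S A" "(f has_derivative f') (at A)" "open W" "A \<in> W"
    and "\<And>x. x \<in> S \<inter> W \<Longrightarrow> f x = 0"
  shows "f' v = 0"
proof -
  obtain c \<epsilon> where c: "0 < \<epsilon>" "c ` ball 0 \<epsilon> \<subseteq> S" "c 0 = A" "(c has_vector_derivative v) (at (0::real))"
    using assms(1) unfolding tangent_space_def by blast
  have "isCont c 0" using c(4) has_vector_derivative_continuous by blast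
  then have "\<forall>\<^sub>F t in nhds 0. c t \<in> W"
    by (rule isCont_eventually_in_open) (use assms(3,4) c(3) in auto)
  moreover have "\<forall>\<^sub>F t in nhds 0. t \<in> ball 0 \<epsilon>" using c(1) by (intro eventually_nhds_in_open) auto
  ultimately have ev: "\<forall>\<^sub>F t in nhds 0. f (c t) = 0"
    by eventually_elim (use c(2) assms(5) in blast)
  have "((\<lambda>t. f (c t)) has_vector_derivative f' v) (at 0)"
  proof -
    have "((\<lambda>t. f (c t)) has_derivative (\<lambda>t. f' (t *\<^sub>R v))) (at 0)"
      using has_derivative_compose[of c _ 0 UNIV f f'] c(3,4) assms(2) unfolding has_vector_derivative_def by auto
    then show ?thesis
      using linear_scale[OF has_derivative_linear[OF assms(2)]] unfolding has_vector_derivative_def by simp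
  qed
  moreover have "((\<lambda>t. f (c t)) has_vector_derivative 0) (at 0)"
    using has_vector_derivative_const[of 0 "at 0"] ev eventually_nhds_x_imp_x[OF ev]
    by (subst has_vector_derivative_cong_ev[where g = "\<lambda>_. 0"]) auto
  ultimately show ?thesis using vector_derivative_unique_at by blast
qed

lemma smooth_on_curve:
  fixes g :: "'a::euclidean_space \<Rightarrow> 'b::euclidean_space" and c :: "real \<Rightarrow> 'a"
  assumes "smooth_on S g" "0 < \<epsilon>" "c ` ball 0 \<epsilon> \<subseteq> S" "(c has_vector_derivative v) (at 0)"
  shows "\<exists>w. ((\<lambda>t. g (c t)) has_vector_derivative w) (at 0)"
proof -
  have "c 0 \<in> S" using assms(2,3) by auto
  with assms(1) obtain W h where W: "open W" "c 0 \<in> W" "smooth_open W h" "\<forall>y\<in>W \<inter> S. h y = g y"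
    unfolding smooth_on_def smooth_open_def by meson
  have "isCont c 0" using assms(4) has_vector_derivative_continuous by blast
  then have "\<forall>\<^sub>F t in nhds 0. c t \<in> W"
    by (rule isCont_eventually_in_open) (use W in auto)
  moreover have "\<forall>\<^sub>F t in nhds 0. t \<in> ball 0 \<epsilon>" using assms(2) by (intro eventually_nhds_in_open) auto
  ultimately have ev: "\<forall>\<^sub>F t in nhds 0. g (c t) = h (c t)"
    by eventually_elim (use W(4) assms(3) in \<open>auto simp: image_subset_iff\<close>)
  let ?h' = "frechet_derivative h (at (c 0))"
  have h: "(h has_derivative ?h') (at (c 0))" using smooth_open_has_derivative W by blast
  have "((\<lambda>t. h (c t)) has_derivative (\<lambda>t. ?h' (t *\<^sub>R v))) (at 0)"
    using has_derivative_compose[of c _ 0 UNIV h] assms(4) h unfolding has_vector_derivative_def by auto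
  then have "((\<lambda>t. h (c t)) has_vector_derivative ?h' v) (at 0)"
    using linear_scale[OF has_derivative_linear[OF h]] unfolding has_vector_derivative_def by simp
  then have "((\<lambda>t. g (c t)) has_vector_derivative ?h' v) (at 0)"
    using ev eventually_nhds_x_imp_x[OF ev]
    by (subst has_vector_derivative_cong_ev[where g = "\<lambda>t. h (c t)"]) auto
  then show ?thesis by blast
qed

lemma proj_tangent_bundle_span:
  assumes "(A, L) \<in> proj_tangent_bundle"
  obtains w where "w \<noteq> 0" "L = span {w}"
proof -
  have L: "subspace L" "dim L = 1" using assms by (auto simp: proj_tangent_bundle_def)
  obtain B where B: "B \<subseteq> L" "independent B" "L \<subseteq> span B" "card B = 1"
    using basis_exists[of L] L(2) by metis
  then obtain w where w: "B = {w}" by (auto simp: card_1_singleton_iff)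
  then have "w \<noteq> 0" using B(2) by (auto simp: dependent_single)
  moreover have "L = span {w}" using B w L(1) span_minimal[of B L] by auto
  ultimately show thesis using that by blast
qed

lemma span_singleton_eq:
  assumes "(w::'a::real_vector) \<noteq> 0" "u \<in> span {w}" "u \<noteq> 0" shows "span {w} = span {u}"
proof -
  obtain k where k: "u = k *\<^sub>R w" using assms by (auto simp: span_singleton)
  then have "w = inverse k *\<^sub>R u" using assms by auto
  then have "w \<in> span {u}" by (metis span_base span_mul singletonI)
  then show ?thesis using assms by (meson subset_antisym empty_subsetI insert_subset span_minimal subspace_span)
qed

lemma proj_embed_apply:
  assumes "(w::real^'n::finite) \<noteq> 0"
  shows "snd (proj_embed (A, span {w})) *v v = ((w \<bullet> v) / (w \<bullet> w)) *\<^sub>R w"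
  unfolding proj_embed_span[OF assms]
  by (simp add: vec_eq_iff matrix_vector_mult_def inner_vec_def sum_divide_distrib sum_distrib_left
      sum_distrib_right mult_ac)

text \<open>A chart coordinate outside \<open>B\<close> vanishes on \<open>S\<close>; one exists
  because \<open>m < DIM('a)\<close>. Its gradient is nonzero because \<open>\<phi>\<close> has a
  smooth inverse.\<close>

lemma slice_chart_defining_function:
  assumes ch: "slice_chart m S U V \<phi> B" and m: "m < DIM('a)" and A: "A \<in> U"
  obtains f :: "'a::euclidean_space \<Rightarrow> real" and g where "smooth_open U f" "smooth_open U g"
    "\<And>P. P \<in> U \<Longrightarrow> (f has_derivative (\<lambda>v. g P \<bullet> v)) (at P)" "\<And>P. P \<in> U \<Longrightarrow> g P \<noteq> 0"
    "\<And>P. P \<in> U \<inter> S \<Longrightarrow> f P = 0"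
proof -
  obtain \<psi> where UV: "open U" "open V" "B \<subseteq> Basis" "card B = m" "\<phi> ` (U \<inter> S) = V \<inter> span B"
    and \<psi>: "homeomorphism U V \<phi> \<psi>" "smooth_open U \<phi>" "smooth_open V \<psi>"
    using ch unfolding slice_chart_def diffeomorphism_def by (metis smooth_on_open_iff)
  obtain b where b: "b \<in> Basis" "b \<notin> B"
    using m UV(3,4) by (metis less_irrefl subsetI subset_antisym)
  define f where "f = (\<lambda>x. \<phi> x \<bullet> b)"
  define g where "g = (\<lambda>x. \<Sum>i\<in>Basis. (frechet_derivative \<phi> (at x) i \<bullet> b) *\<^sub>R i)"
  have d: "(\<phi> has_derivative frechet_derivative \<phi> (at P)) (at P)" if "P \<in> U" for P
    using smooth_open_has_derivative[OF \<psi>(2) that] .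
  have g: "g P \<bullet> v = frechet_derivative \<phi> (at P) v \<bullet> b" if "P \<in> U" for P v
  proof -
    have "frechet_derivative \<phi> (at P) v \<bullet> b = (\<Sum>i\<in>Basis. (v \<bullet> i) * (frechet_derivative \<phi> (at P) i \<bullet> b))"
      by (subst deriv_in_coordinates[OF has_derivative_linear[OF d[OF that]]]) (simp add: inner_sum_left)
    then show ?thesis by (simp add: g_def inner_sum_left inner_commute[of v] mult.commute)
  qed
  have "smooth_open U f" unfolding f_def by (intro smooth_open_inner \<psi> smooth_open_const)
  moreover have "smooth_open U g" unfolding g_def
    by (intro smooth_open_sum finite_Basis smooth_open_scaleR smooth_open_inner smooth_open_const
        smooth_open_deriv[OF UV(1) \<psi>(2) smooth_open_const d])
  moreover have "(f has_derivative (\<lambda>v. g P \<bullet> v)) (at P)" if "P \<in> U" for P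
    unfolding f_def g[OF that] by (intro has_derivative_inner_left d that)
  moreover have "g P \<noteq> 0" if P: "P \<in> U" for P
  proof
    assume "g P = 0"
    have V: "\<phi> P \<in> V" "\<psi> (\<phi> P) = P" using \<psi>(1) P by (auto simp: homeomorphism_def)
    have "((\<lambda>x. \<phi> (\<psi> x)) has_derivative
        (\<lambda>h. frechet_derivative \<phi> (at P) (frechet_derivative \<psi> (at (\<phi> P)) h))) (at (\<phi> P))"
      using has_derivative_compose[OF smooth_open_has_derivative[OF \<psi>(3) V(1)], of \<phi>] d[OF P] V(2) by simp
    moreover have "((\<lambda>x. \<phi> (\<psi> x)) has_derivative (\<lambda>h. h)) (at (\<phi> P))"
      by (rule has_derivative_transform_within_open[OF has_derivative_ident UV(2) V(1)])
         (use \<psi>(1) in \<open>auto simp: homeomorphism_def\<close>)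
    ultimately have "frechet_derivative \<phi> (at P) (frechet_derivative \<psi> (at (\<phi> P)) b) = b"
      using has_derivative_unique by metis
    then have "g P \<bullet> frechet_derivative \<psi> (at (\<phi> P)) b = 1" using g[OF P] b by simp
    then show False using \<open>g P = 0\<close> by simp
  qed
  moreover have "f P = 0" if "P \<in> U \<inter> S" for P
  proof -
    have "\<phi> P \<in> span B" using UV(5) that by blast
    then show ?thesis unfolding f_def span_substd_basis[OF UV(3)] using b by auto
  qed
  ultimately show thesis using that by blast
qed

text \<open>Transversality enters twice: it permits the normalization
  \<open>n A \<bullet> u A = 1\<close>, and it turns the inclusion of the tangent space in the
  kernel of \<open>n A\<close> into an equality.\<close>

lemma line_framed_hypersurface_local:
  fixes \<beta> :: "'n::finite framed_point set"
  assumes \<beta>: "line_framed_hypersurface \<beta>" and A0: "A0 \<in> fst ` \<beta>"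
  obtains W n u f \<rho> where "open W" "A0 \<in> W" "smooth_open W n" "smooth_open W u" "smooth_open W f"
    "\<And>P. P \<in> W \<Longrightarrow> (f has_derivative (\<lambda>v. \<rho> P * (n P \<bullet> v))) (at P)" "\<And>P. P \<in> W \<Longrightarrow> \<rho> P \<noteq> (0::real)"
    "\<And>A L. (A, L) \<in> \<beta> \<Longrightarrow> A \<in> W \<Longrightarrow> n A \<bullet> u A = 1 \<and> L = span {u A} \<and>
        tangent_space (fst ` \<beta>) A = {v. n A \<bullet> v = 0} \<and> f A = (0::real)"
proof -
  have tb: "\<beta> \<subseteq> proj_tangent_bundle" and em: "embedded_submanifold (CARD('n) - 1) (fst ` \<beta>)"
    and tr': "\<forall>(A, L)\<in>\<beta>. {x + y |x y. x \<in> L \<and> y \<in> tangent_space (fst ` \<beta>) A} = UNIV"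
    using \<beta> unfolding line_framed_hypersurface_def by blast+
  have tr: "{x + y |x y. x \<in> L \<and> y \<in> tangent_space (fst ` \<beta>) A} = UNIV" if "(A, L) \<in> \<beta>" for A L
    using bspec[OF tr' that] unfolding prod.case .
  obtain g where g: "homeomorphism (proj_embed ` \<beta>) (fst ` \<beta>) fst g" "smooth_on (fst ` \<beta>) g"
    using \<beta> by (auto simp: line_framed_hypersurface_def diffeomorphism_def)
  obtain L0 where L0: "(A0, L0) \<in> \<beta>" using A0 by force
  obtain u0 where u0: "u0 \<noteq> 0" "L0 = span {u0}" using proj_tangent_bundle_span tb L0 by (metis subsetD)
  obtain U V \<phi> B where ch: "A0 \<in> U" "slice_chart (CARD('n) - 1) (fst ` \<beta>) U V \<phi> B"
    using em A0 unfolding embedded_submanifold_def by blast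
  have "CARD('n) - 1 < DIM(real^'n)" by simp
  from slice_chart_defining_function[OF ch(2) this ch(1)] obtain f h where
    f: "smooth_open U f" "smooth_open U h" "\<And>P. P \<in> U \<Longrightarrow> (f has_derivative (\<lambda>v. h P \<bullet> v)) (at P)"
      "\<And>P. P \<in> U \<Longrightarrow> h P \<noteq> 0" "\<And>P. P \<in> U \<inter> fst ` \<beta> \<Longrightarrow> f P = 0" by metis
  obtain W1 g1 where W1: "open W1" "A0 \<in> W1" "smooth_open W1 g1" "\<And>y. y \<in> W1 \<inter> fst ` \<beta> \<Longrightarrow> g1 y = g y"
    using g(2) A0 unfolding smooth_on_def smooth_open_def by meson
  have U: "open U" using ch(2) by (simp add: slice_chart_def)
  \<comment> \<open>A smooth choice of direction: the projection onto the line over each point,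
    extended smoothly, is applied to the fixed vector \<open>u0\<close> spanning the line over
    \<open>A0\<close>. It stays nonzero near \<open>A0\<close>.\<close>
  define u where "u = (\<lambda>x. snd (g1 x) *v u0)"
  have "bounded_linear (\<lambda>M :: real^'n^'n. M *v u0)"
    by (rule linear_conv_bounded_linear[THEN iffD1], rule linearI)
       (simp_all add: matrix_vector_mult_add_rdistrib scaleR_matrix_vector_assoc)
  then have su: "smooth_open W1 u" unfolding u_def
    by (intro smooth_open_linear_compose[of "\<lambda>M. M *v u0"] smooth_open_snd W1)
  have u: "u A = ((w \<bullet> u0) / (w \<bullet> w)) *\<^sub>R w" if "(A, span {w}) \<in> \<beta>" "w \<noteq> 0" "A \<in> W1" for A w
  proof -
    have "g A = proj_embed (A, span {w})"
      using g(1) that unfolding homeomorphism_def by (force simp: proj_embed_def)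
    moreover have "g1 A = g A" using W1(4) that by force
    ultimately show ?thesis unfolding u_def using proj_embed_apply[OF that(2)] by simp
  qed
  have uA0: "u A0 = u0" using u[of A0 u0] L0 u0 W1 by simp
  have ker: "h A \<bullet> v = 0" if "A \<in> U" "v \<in> tangent_space (fst ` \<beta>) A" for A v
    using tangent_space_derivative_0[OF that(2) f(3)[OF that(1)] U that(1)] f(5) by blast
  have trans: "h A \<bullet> w \<noteq> 0" if Aw: "(A, span {w}) \<in> \<beta>" "A \<in> U" for A w
  proof
    assume *: "h A \<bullet> w = 0"
    have "h A \<bullet> v = 0" for v
    proof -
      obtain x y where "x \<in> span {w}" "y \<in> tangent_space (fst ` \<beta>) A" "v = x + y"
        using tr[OF Aw(1)] by blast
      then show ?thesis using * ker[OF Aw(2)] by (auto simp: span_singleton inner_add_right)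
    qed
    then have "h A = 0" using inner_eq_zero_iff by blast
    then show False using f(4) Aw by blast
  qed
  define W where "W = (U \<inter> W1) \<inter> (\<lambda>x. h x \<bullet> u x) -` (- {0})"
  have shu: "smooth_open (U \<inter> W1) (\<lambda>x. h x \<bullet> u x)"
    by (intro smooth_open_inner smooth_open_subset[OF f(2)] smooth_open_subset[OF su]) auto
  have W: "open W" "W \<subseteq> U" "W \<subseteq> W1" "\<And>x. x \<in> W \<Longrightarrow> h x \<bullet> u x \<noteq> 0"
    unfolding W_def using continuous_open_preimage[OF smooth_open_continuous_on[OF shu]] U W1(1) by auto
  have A0W: "A0 \<in> W" unfolding W_def using ch(1) W1(2) uA0 trans[of A0 u0] L0 u0 by auto
  define n where "n = (\<lambda>x. h x /\<^sub>R (h x \<bullet> u x))"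
  show thesis
  proof (rule that[of W n u f "\<lambda>x. h x \<bullet> u x"])
    show "smooth_open W n" unfolding n_def
      using W by (intro smooth_open_scaleR smooth_open_inverse smooth_open_subset[OF shu] smooth_open_subset[OF f(2)]) auto
    show "smooth_open W u" "smooth_open W f" using W smooth_open_subset su f by blast+
    show "(f has_derivative (\<lambda>v. (h P \<bullet> u P) * (n P \<bullet> v))) (at P)" if "P \<in> W" for P
    proof -
      have "(\<lambda>v. (h P \<bullet> u P) * (n P \<bullet> v)) = (\<lambda>v. h P \<bullet> v)"
        using W(4)[OF that] by (intro ext) (simp add: n_def)
      then show ?thesis using f(3)[of P] W(2) that by auto
    qed
    show "n A \<bullet> u A = 1 \<and> L = span {u A} \<and> tangent_space (fst ` \<beta>) A = {v. n A \<bullet> v = 0} \<and> f A = 0"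
      if AL: "(A, L) \<in> \<beta>" "A \<in> W" for A L
    proof -
      obtain w where w: "w \<noteq> 0" "L = span {w}" using proj_tangent_bundle_span tb AL(1) by (metis subsetD)
      have "u A \<in> span {w}" using u[of A w] AL w W by (auto simp: span_singleton)
      moreover have "u A \<noteq> 0" using W(4)[OF AL(2)] by auto
      ultimately have L: "L = span {u A}" using span_singleton_eq w by metis
      have 1: "n A \<bullet> u A = 1" using W(4)[OF AL(2)] by (simp add: n_def)
      have sub: "n A \<bullet> v = 0" if "v \<in> tangent_space (fst ` \<beta>) A" for v
        using ker[OF _ that] AL W by (auto simp: n_def)
      have "v \<in> tangent_space (fst ` \<beta>) A" if v: "n A \<bullet> v = 0" for v
      proof -
        obtain x y where xy: "x \<in> span {u A}" "y \<in> tangent_space (fst ` \<beta>) A" "v = x + y"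
          using tr[OF AL(1)] L by blast
        then obtain k where k: "x = k *\<^sub>R u A" by (auto simp: span_singleton)
        have "k = 0" using v sub[OF xy(2)] 1 by (simp add: xy(3) k inner_add_right)
        then show ?thesis using xy k by simp
      qed
      then have "tangent_space (fst ` \<beta>) A = {v. n A \<bullet> v = 0}" using sub by blast
      moreover have "A \<in> fst ` \<beta>" using AL(1) by force
      then have "f A = 0" using f(5) AL(2) W(2) by blast
      ultimately show ?thesis using 1 L by blast
    qed
  qed (use W A0W in auto)
qed

text \<open>On the affine line where the common plane meets the hyperplane of \<open>n\<close>, the
  line \<open>T\<close> is at infinity; a cross-ratio of -1 then makes \<open>u\<close> the midpoint
  of the other two points.\<close>

lemma symmetric_lines_cproj:
  fixes u n p q :: "'a::euclidean_space"
  assumes "symmetric_lines (span {u}) {v. n \<bullet> v = 0} (span {p}) (span {q})"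
    and nu: "n \<bullet> u = 1" and np: "n \<bullet> p \<noteq> 0" "n \<bullet> q \<noteq> 0"
  shows "cproj n p + cproj n q = 2 *\<^sub>R u"
proof -
  have cp: "cproj n v = u" if "v \<in> span {u}" "n \<bullet> v \<noteq> 0" for v
    using that nu by (auto simp: span_singleton cproj_def)
  obtain E where E: "subspace E" "dim E = 2"
    "(span {p} = span {u} \<and> span {q} = span {u}) \<or>
     (span {p} = E \<inter> {v. n \<bullet> v = 0} \<and> span {q} = E \<inter> {v. n \<bullet> v = 0}) \<or>
     (distinct [span {u}, E \<inter> {v. n \<bullet> v = 0}, span {p}, span {q}] \<and>
      has_cross_ratio (span {u}) (E \<inter> {v. n \<bullet> v = 0}) (span {p}) (span {q}) (- 1))"
    using assms(1) unfolding symmetric_lines_def Let_def by blast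
  consider "span {p} = span {u}" "span {q} = span {u}" | "span {p} = E \<inter> {v. n \<bullet> v = 0}"
    | "has_cross_ratio (span {u}) (E \<inter> {v. n \<bullet> v = 0}) (span {p}) (span {q}) (- 1)"
    using E(3) by blast
  then show ?thesis
  proof cases
    case 1
    then have "p \<in> span {u}" "q \<in> span {u}" using span_base[of _ "{p}"] span_base[of _ "{q}"] by auto
    then show ?thesis using cp np by (simp add: scaleR_2)
  next
    case 2
    then have "n \<bullet> p = 0" using span_base[of p "{p}"] by auto
    then show ?thesis using np by simp
  next
    case 3
    then obtain e f p1 p2 p3 p4 where sp: "span {u} = span {fst p1 *\<^sub>R e + snd p1 *\<^sub>R f}"
      "E \<inter> {v. n \<bullet> v = 0} = span {fst p2 *\<^sub>R e + snd p2 *\<^sub>R f}"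
      "span {p} = span {fst p3 *\<^sub>R e + snd p3 *\<^sub>R f}" "span {q} = span {fst p4 *\<^sub>R e + snd p4 *\<^sub>R f}"
      and cr: "- 1 = (det2 p1 p3 * det2 p2 p4) / (det2 p1 p4 * det2 p2 p3)" and ind: "e \<noteq> f" "independent {e, f}"
      unfolding has_cross_ratio_def by blast
    define w where "w = (\<lambda>p :: real \<times> real. fst p *\<^sub>R e + snd p *\<^sub>R f)"
    \<comment> \<open>Cramer's rule in the plane spanned by \<open>e\<close> and
      \<open>f\<close>.\<close>
    have rel: "det2 p1 p2 *\<^sub>R w p = det2 p p2 *\<^sub>R w p1 + det2 p1 p *\<^sub>R w p2" for p
      by (simp add: w_def det2_def algebra_simps)
    have nz: "det2 p1 p4 \<noteq> 0" "det2 p2 p3 \<noteq> 0" using cr by auto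
    have har: "det2 p1 p3 * det2 p2 p4 = - (det2 p1 p4 * det2 p2 p3)" using cr nz by (simp add: field_simps)
    have n2: "n \<bullet> w p2 = 0"
      using sp(2) span_base[of "w p2" "{w p2}"] by (auto simp: w_def)
    obtain k3 where k3: "p = k3 *\<^sub>R w p3" using sp(3) span_base[of p "{p}"] by (auto simp: w_def span_singleton)
    obtain k4 where k4: "q = k4 *\<^sub>R w p4" using sp(4) span_base[of q "{q}"] by (auto simp: w_def span_singleton)
    obtain k1 where k1: "u = k1 *\<^sub>R w p1" using sp(1) span_base[of u "{u}"] by (auto simp: w_def span_singleton)
    have k1': "k1 * (n \<bullet> w p1) = 1" using nu k1 by simp
    have d12: "det2 p1 p2 \<noteq> 0"
    proof
      assume "det2 p1 p2 = 0"
      then have "det2 p3 p2 *\<^sub>R w p1 + det2 p1 p3 *\<^sub>R w p2 = 0" using rel[of p3] by simp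
      from arg_cong[OF this, of "\<lambda>v. n \<bullet> v"] have "det2 p3 p2 * (n \<bullet> w p1) = 0" by (simp add: inner_add_right n2)
      then show False using k1' nz(2) by (auto simp: det2_def mult.commute)
    qed
    have d42: "det2 p4 p2 \<noteq> 0"
    proof
      assume "det2 p4 p2 = 0"
      then have "det2 p1 p2 * (n \<bullet> w p4) = 0"
        using arg_cong[OF rel[of p4], of "\<lambda>v. n \<bullet> v"] by (simp add: inner_add_right n2)
      then show False using d12 np(2) k4 by auto
    qed
    \<comment> \<open>The coefficient of \<open>w p2\<close> is the affine parameter of the line
      \<open>p\<close>, with origin \<open>u\<close>. Harmonicity makes the parameters of
      \<open>p3\<close> and \<open>p4\<close> opposite.\<close>
    have c: "cproj n (k *\<^sub>R w p) = u + ((det2 p1 p / det2 p p2) * k1) *\<^sub>R w p2"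
      if "k \<noteq> 0" "det2 p p2 \<noteq> 0" for k p
    proof -
      have "w p = inverse (det2 p1 p2) *\<^sub>R (det2 p1 p2 *\<^sub>R w p)" using d12 by simp
      then have wp: "w p = (det2 p p2 / det2 p1 p2) *\<^sub>R w p1 + (det2 p1 p / det2 p1 p2) *\<^sub>R w p2"
        unfolding rel by (simp add: scaleR_add_right divide_inverse mult.commute)
      have "n \<bullet> w p1 = inverse k1" using k1' by (metis inverse_unique mult.commute)
      then have "n \<bullet> w p = det2 p p2 / det2 p1 p2 * inverse k1" unfolding wp by (simp add: inner_add_right n2)
      then have "cproj n (k *\<^sub>R w p) = (k1 * (det2 p1 p2 / det2 p p2)) *\<^sub>R w p"
        using that(1) by (simp add: cproj_def divide_inverse mult_ac)
      also have "\<dots> = u + ((det2 p1 p / det2 p p2) * k1) *\<^sub>R w p2"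
        unfolding wp k1 using that(2) d12 by (simp add: scaleR_add_right)
      finally show ?thesis .
    qed
    have "det2 p3 p2 \<noteq> 0" using nz(2) by (auto simp: det2_def mult.commute)
    moreover have "k3 \<noteq> 0" "k4 \<noteq> 0" using np k3 k4 by auto
    ultimately have "cproj n p + cproj n q = 2 *\<^sub>R u + ((det2 p1 p3 / det2 p3 p2 + det2 p1 p4 / det2 p4 p2) * k1) *\<^sub>R w p2"
      unfolding k3 k4 using c d42 by (simp add: scaleR_2 algebra_simps)
    moreover have "det2 p1 p3 / det2 p3 p2 + det2 p1 p4 / det2 p4 p2 = 0"
    proof -
      have s: "det2 p3 p2 = - det2 p2 p3" "det2 p4 p2 = - det2 p2 p4" by (simp_all add: det2_def)
      show ?thesis using har nz(2) d42 unfolding s by (simp add: field_simps)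
    qed
    ultimately show ?thesis by simp
  qed
qed

lemma smooth_on_open_slice:
  assumes "slice_chart m S U V \<phi> B"
  obtains \<psi> where "homeomorphism U V \<phi> \<psi>" "smooth_open U \<phi>" "smooth_open V \<psi>"
    "open U" "open V" "B \<subseteq> Basis" "\<phi> ` (U \<inter> S) = V \<inter> span B"
  using assms unfolding slice_chart_def diffeomorphism_def by (metis smooth_on_open_iff)

text \<open>Read in the chart, the curve stays in \<open>span B\<close>, hence so does its velocity
  \<open>\<xi>\<close>, and the derivative of \<open>\<psi>\<close> takes \<open>\<xi>\<close> back
  to \<open>s'\<close>.\<close>

lemma slice_chart_lift:
  fixes s :: "real \<Rightarrow> 'a::euclidean_space"
  assumes \<psi>: "homeomorphism U V \<phi> \<psi>" "smooth_open U \<phi>" "smooth_open V \<psi>"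
    and UV: "open U" "open V" "B \<subseteq> Basis" "\<phi> ` (U \<inter> S) = V \<inter> span B"
    and z: "z \<in> V" and s: "s 0 = \<psi> z" "(s has_vector_derivative s') (at 0)" "\<forall>\<^sub>F t in nhds 0. s t \<in> S"
  shows "\<exists>\<xi>\<in>span B. frechet_derivative \<psi> (at z) \<xi> = s'"
proof -
  define \<xi> where "\<xi> = frechet_derivative \<phi> (at (\<psi> z)) s'"
  have zU: "\<psi> z \<in> U" "\<phi> (\<psi> z) = z" using \<psi>(1) z by (auto simp: homeomorphism_def)
  have d\<phi>: "(\<phi> has_derivative frechet_derivative \<phi> (at (\<psi> z))) (at (\<psi> z))"
    using smooth_open_has_derivative[OF \<psi>(2) zU(1)] .
  have d\<psi>: "(\<psi> has_derivative frechet_derivative \<psi> (at z)) (at z)"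
    using smooth_open_has_derivative[OF \<psi>(3) z] .
  have "isCont s 0" using s(2) has_vector_derivative_continuous by blast
  then have evU: "\<forall>\<^sub>F t in nhds 0. s t \<in> U"
    by (rule isCont_eventually_in_open) (use UV zU s in auto)
  have "((\<lambda>t. \<phi> (s t)) has_derivative (\<lambda>t. frechet_derivative \<phi> (at (\<psi> z)) (t *\<^sub>R s'))) (at 0)"
    using has_derivative_compose[of s _ 0 UNIV \<phi>] s(1,2) d\<phi> unfolding has_vector_derivative_def by auto
  then have \<phi>s: "((\<lambda>t. \<phi> (s t)) has_vector_derivative \<xi>) (at 0)"
    using linear_scale[OF has_derivative_linear[OF d\<phi>]] unfolding has_vector_derivative_def \<xi>_def by simp
  have "\<xi> \<bullet> i = 0" if i: "i \<in> Basis" "i \<notin> B" for i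
  proof -
    from evU s(3) have ev: "\<forall>\<^sub>F t in nhds 0. \<phi> (s t) \<bullet> i = 0"
    proof eventually_elim
      case (elim t)
      then have "\<phi> (s t) \<in> span B" using UV(4) by blast
      then show ?case unfolding span_substd_basis[OF UV(3)] using i by blast
    qed
    have "((\<lambda>t. \<phi> (s t) \<bullet> i) has_vector_derivative \<xi> \<bullet> i) (at 0)"
      by (rule bounded_linear.has_vector_derivative[OF bounded_linear_inner_left \<phi>s])
    moreover have "((\<lambda>t. \<phi> (s t) \<bullet> i) has_vector_derivative 0) (at 0)"
      using has_vector_derivative_const[of 0 "at 0"] ev eventually_nhds_x_imp_x[OF ev]
      by (subst has_vector_derivative_cong_ev[where g = "\<lambda>_. 0"]) auto
    ultimately show ?thesis using vector_derivative_unique_at by blast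
  qed
  then have "\<xi> \<in> span B" unfolding span_substd_basis[OF UV(3)] by blast
  moreover have "frechet_derivative \<psi> (at z) \<xi> = s'"
  proof -
    have "((\<lambda>t. \<psi> (\<phi> (s t))) has_derivative (\<lambda>t. frechet_derivative \<psi> (at z) (t *\<^sub>R \<xi>))) (at 0)"
      using has_derivative_compose[of "\<lambda>t. \<phi> (s t)" _ 0 UNIV \<psi>] s(1) zU(2) d\<psi> \<phi>s unfolding has_vector_derivative_def by auto
    then have "((\<lambda>t. \<psi> (\<phi> (s t))) has_vector_derivative frechet_derivative \<psi> (at z) \<xi>) (at 0)"
      using linear_scale[OF has_derivative_linear[OF d\<psi>]] unfolding has_vector_derivative_def by simp
    moreover have "((\<lambda>t. \<psi> (\<phi> (s t))) has_vector_derivative s') (at 0)"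
    proof -
      have ev: "\<forall>\<^sub>F t in nhds 0. \<psi> (\<phi> (s t)) = s t"
        using evU by eventually_elim (use \<psi>(1) in \<open>auto simp: homeomorphism_def\<close>)
      show ?thesis
        using s(2) ev eventually_nhds_x_imp_x[OF ev]
        by (subst has_vector_derivative_cong_ev[where g = s]) auto
    qed
    ultimately show ?thesis using vector_derivative_unique_at by blast
  qed
  ultimately show ?thesis by blast
qed

text \<open>Tangent vectors are given on the classical boundary, whereas the measure lives on the
  framed hypersurface. The inverse of the projection carries the curve from one to the
  other.\<close>

lemma tangent_space_framed_lift:
  fixes \<beta> :: "'n::finite framed_point set"
  assumes \<beta>: "line_framed_hypersurface \<beta>" and q: "q \<in> proj_embed ` \<beta>" and v: "v \<in> tangent_space (fst ` \<beta>) (fst q)"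
  shows "\<exists>s s'. s (0::real) = q \<and> (s has_vector_derivative s') (at 0) \<and> (\<forall>\<^sub>F t in nhds 0. s t \<in> proj_embed ` \<beta>) \<and> fst s' = v"
proof -
  obtain g where g: "homeomorphism (proj_embed ` \<beta>) (fst ` \<beta>) fst g" "smooth_on (fst ` \<beta>) g"
    using \<beta> by (auto simp: line_framed_hypersurface_def diffeomorphism_def)
  obtain c \<epsilon> where c: "0 < \<epsilon>" "c ` ball 0 \<epsilon> \<subseteq> fst ` \<beta>" "c 0 = fst q" "(c has_vector_derivative v) (at (0::real))"
    using v unfolding tangent_space_def by blast
  obtain s' where s': "((\<lambda>t. g (c t)) has_vector_derivative s') (at 0)"
    using smooth_on_curve[OF g(2) c(1,2,4)] by blast
  have ev0: "\<forall>\<^sub>F t in nhds 0. t \<in> ball 0 \<epsilon>" using c(1) by (intro eventually_nhds_in_open) auto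
  then have ev: "\<forall>\<^sub>F t in nhds 0. g (c t) \<in> proj_embed ` \<beta>"
    by eventually_elim (use c(2) homeomorphism_image2[OF g(1)] in blast)
  have "((\<lambda>t. fst (g (c t))) has_vector_derivative fst s') (at 0)"
    by (rule bounded_linear.has_vector_derivative[OF bounded_linear_fst s'])
  moreover have "((\<lambda>t. fst (g (c t))) has_vector_derivative v) (at 0)"
  proof -
    have ev1: "\<forall>\<^sub>F t in nhds 0. fst (g (c t)) = c t"
      using ev0 by eventually_elim (use c(2) homeomorphism_apply2[OF g(1)] in blast)
    show ?thesis
      using c(4) ev1 eventually_nhds_x_imp_x[OF ev1]
      by (subst has_vector_derivative_cong_ev[where g = c]) auto
  qed
  ultimately have "fst s' = v" using vector_derivative_unique_at by blast
  moreover have "g (c 0) = q" using g(1) q c(3) by (auto simp: homeomorphism_def)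
  ultimately show ?thesis using s' ev by (intro exI[of _ "\<lambda>t. g (c t)"] exI[of _ s']) simp
qed

section \<open>Restriction to open sets and small representatives of germs\<close>

lemma slice_chart_Int_open:
  assumes "slice_chart m S U V \<phi> B" "open W"
  shows "slice_chart m (S \<inter> W) (U \<inter> W) (\<phi> ` (U \<inter> W)) \<phi> B"
proof -
  obtain \<psi> where \<psi>: "homeomorphism U V \<phi> \<psi>" "smooth_open U \<phi>" "smooth_open V \<psi>"
    and UV: "open U" "open V" "B \<subseteq> Basis" "\<phi> ` (U \<inter> S) = V \<inter> span B"
    using smooth_on_open_slice[OF assms(1)] .
  have im: "\<phi> ` (U \<inter> W) = V \<inter> \<psi> -` W"
    using \<psi>(1) by (force simp: homeomorphism_def)
  have opV: "open (\<phi> ` (U \<inter> W))" unfolding im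
    using continuous_open_preimage[OF smooth_open_continuous_on[OF \<psi>(3)] UV(2) assms(2)] .
  have opU: "open (U \<inter> W)" using UV(1) assms(2) by auto
  have "homeomorphism (U \<inter> W) (\<phi> ` (U \<inter> W)) \<phi> \<psi>"
    by (rule homeomorphism_of_subsets[OF \<psi>(1)]) auto
  moreover have "smooth_open (U \<inter> W) \<phi>" "smooth_open (\<phi> ` (U \<inter> W)) \<psi>"
    using smooth_open_subset[OF \<psi>(2)] smooth_open_subset[OF \<psi>(3)] im by auto
  ultimately have "diffeomorphism (U \<inter> W) (\<phi> ` (U \<inter> W)) \<phi> \<psi>"
    unfolding diffeomorphism_def by (simp add: smooth_on_open_iff opU opV)
  moreover have "\<phi> ` (U \<inter> W \<inter> (S \<inter> W)) = \<phi> ` (U \<inter> W) \<inter> span B"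
  proof
    show "\<phi> ` (U \<inter> W \<inter> (S \<inter> W)) \<subseteq> \<phi> ` (U \<inter> W) \<inter> span B" using UV(4) by blast
    show "\<phi> ` (U \<inter> W) \<inter> span B \<subseteq> \<phi> ` (U \<inter> W \<inter> (S \<inter> W))"
    proof
      fix y assume "y \<in> \<phi> ` (U \<inter> W) \<inter> span B"
      then obtain x where x: "x \<in> U" "x \<in> W" "y = \<phi> x" "\<phi> x \<in> V \<inter> span B" using im by blast
      then have "\<phi> x \<in> \<phi> ` (U \<inter> S)" unfolding UV(4) by blast
      then obtain x' where x': "\<phi> x = \<phi> x'" "x' \<in> U \<inter> S" by (rule imageE)
      have "\<psi> (\<phi> x') = x'" "\<psi> (\<phi> x) = x" using homeomorphism_apply1[OF \<psi>(1)] x(1) x'(2) by blast+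
      then have "x' = x" using x'(1) by simp
      then show "y \<in> \<phi> ` (U \<inter> W \<inter> (S \<inter> W))" using x x' by blast
    qed
  qed
  ultimately show ?thesis using assms(1) opU opV unfolding slice_chart_def by blast
qed

lemma embedded_submanifold_Int_open:
  assumes "embedded_submanifold m S" "open W"
  shows "embedded_submanifold m (S \<inter> W)"
  unfolding embedded_submanifold_def
proof
  fix x assume x: "x \<in> S \<inter> W"
  then obtain U V \<phi> B where "x \<in> U" "slice_chart m S U V \<phi> B"
    using assms(1) unfolding embedded_submanifold_def by blast
  then show "\<exists>U V \<phi> B. x \<in> U \<and> slice_chart m (S \<inter> W) U V \<phi> B"
    using slice_chart_Int_open[OF _ assms(2)] x by blast
qed

lemma tangent_space_Int_open:
  assumes "open W" "A \<in> W"
  shows "tangent_space S A \<subseteq> tangent_space (S \<inter> W) A"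
proof
  fix v assume "v \<in> tangent_space S A"
  then obtain c \<epsilon> where c: "0 < \<epsilon>" "smooth_on (ball 0 \<epsilon>) c" "c ` ball 0 \<epsilon> \<subseteq> S" "c 0 = A"
      "(c has_vector_derivative v) (at (0::real))"
    unfolding tangent_space_def by blast
  have "isCont c 0" using c(5) has_vector_derivative_continuous by blast
  then have "\<forall>\<^sub>F t in nhds 0. c t \<in> W" by (rule isCont_eventually_in_open) (use assms c in auto)
  then obtain \<delta> where \<delta>: "0 < \<delta>" "\<And>t. dist t 0 < \<delta> \<Longrightarrow> c t \<in> W" unfolding eventually_nhds_metric by blast
  have sub: "ball 0 (min \<epsilon> \<delta>) \<subseteq> (ball 0 \<epsilon> :: real set)" by auto
  have "c ` ball 0 (min \<epsilon> \<delta>) \<subseteq> S \<inter> W"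
    using c(3) sub \<delta>(2) by (auto simp: dist_commute)
  then show "v \<in> tangent_space (S \<inter> W) A"
    unfolding tangent_space_def using c(1,4,5) \<delta>(1) smooth_on_subset[OF c(2) sub]
    by (intro CollectI exI[of _ c] exI[of _ "min \<epsilon> \<delta>"]) simp
qed

text \<open>Framed hypersurfaces have to be connected, so intersecting with \<open>W\<close> is not
  enough. The part of a chart over a small ball is connected because a ball meets
  \<open>span B\<close> in a convex set.\<close>

lemma line_framed_hypersurface_shrink:
  fixes \<alpha> :: "'n::finite framed_point set"
  assumes \<alpha>: "line_framed_hypersurface \<alpha>" and p: "p \<in> \<alpha>" and W: "open W" "proj_embed p \<in> W"
  obtains \<beta> where "line_framed_hypersurface \<beta>" "p \<in> \<beta>" "same_germ p \<alpha> \<beta>" "proj_embed ` \<beta> \<subseteq> W"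
proof -
  let ?S = "proj_embed ` \<alpha>"
  have tb: "\<alpha> \<subseteq> proj_tangent_bundle" and em: "embedded_submanifold (CARD('n) - 1) ?S"
    and em': "embedded_submanifold (CARD('n) - 1) (fst ` \<alpha>)"
    and tr: "\<forall>(A, L)\<in>\<alpha>. {x + y |x y. x \<in> L \<and> y \<in> tangent_space (fst ` \<alpha>) A} = UNIV"
    using \<alpha> unfolding line_framed_hypersurface_def by blast+
  obtain g where g: "homeomorphism ?S (fst ` \<alpha>) fst g" "smooth_on ?S fst" "smooth_on (fst ` \<alpha>) g"
    using \<alpha> by (auto simp: line_framed_hypersurface_def diffeomorphism_def)
  obtain U V \<phi> B where ch: "proj_embed p \<in> U" "slice_chart (CARD('n) - 1) ?S U V \<phi> B"
    using em p unfolding embedded_submanifold_def by blast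
  obtain \<psi> where \<psi>: "homeomorphism U V \<phi> \<psi>" "smooth_open U \<phi>" "smooth_open V \<psi>"
    and UV: "open U" "open V" "B \<subseteq> Basis" "\<phi> ` (U \<inter> ?S) = V \<inter> span B"
    using smooth_on_open_slice[OF ch(2)] .
  have "open (V \<inter> \<psi> -` W)"
    using continuous_open_preimage[OF smooth_open_continuous_on[OF \<psi>(3)] UV(2) W(1)] .
  moreover have "\<phi> (proj_embed p) \<in> V \<inter> \<psi> -` W" using \<psi>(1) ch(1) W(2) by (auto simp: homeomorphism_def)
  ultimately obtain r where r: "0 < r" "ball (\<phi> (proj_embed p)) r \<subseteq> V \<inter> \<psi> -` W"
    using open_contains_ball by blast
  let ?D = "ball (\<phi> (proj_embed p)) r"
  define U0 where "U0 = U \<inter> \<phi> -` ?D"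
  have oU0: "open U0" unfolding U0_def
    by (rule continuous_open_preimage[OF smooth_open_continuous_on[OF \<psi>(2)] UV(1)]) simp
  have pU0: "proj_embed p \<in> U0" using ch(1) r(1) by (simp add: U0_def)
  have U0W: "U0 \<subseteq> W"
  proof
    fix x assume "x \<in> U0"
    then have "x \<in> U" "\<psi> (\<phi> x) \<in> W" using r(2) by (auto simp: U0_def)
    then show "x \<in> W" using \<psi>(1) by (auto simp: homeomorphism_def)
  qed
  define \<beta> where "\<beta> = {q\<in>\<alpha>. proj_embed q \<in> U0}"
  have im: "proj_embed ` \<beta> = ?S \<inter> U0" by (auto simp: \<beta>_def)
  have conn: "connected (?S \<inter> U0)"
  proof -
    have "?S \<inter> U0 = \<psi> ` (?D \<inter> span B)"
    proof
      show "?S \<inter> U0 \<subseteq> \<psi> ` (?D \<inter> span B)"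
      proof
        fix x assume x: "x \<in> ?S \<inter> U0"
        then have "\<phi> x \<in> ?D" "\<phi> x \<in> span B" "\<psi> (\<phi> x) = x"
          using UV(4) \<psi>(1) by (auto simp: U0_def homeomorphism_def)
        then show "x \<in> \<psi> ` (?D \<inter> span B)" by (metis IntI image_eqI)
      qed
      show "\<psi> ` (?D \<inter> span B) \<subseteq> ?S \<inter> U0"
      proof
        fix x assume "x \<in> \<psi> ` (?D \<inter> span B)"
        then obtain z where z: "z \<in> ?D" "z \<in> span B" "x = \<psi> z" by blast
        then have zV: "z \<in> V" using r(2) by blast
        then have "z \<in> \<phi> ` (U \<inter> ?S)" unfolding UV(4) using z(2) by blast
        then obtain y where y: "z = \<phi> y" "y \<in> U \<inter> ?S" by (rule imageE)
        then have "x = y" using \<psi>(1) z by (auto simp: homeomorphism_def)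
        then show "x \<in> ?S \<inter> U0" using y z by (simp add: U0_def)
      qed
    qed
    moreover have "connected (?D \<inter> span B)"
      by (intro convex_connected convex_Int convex_ball subspace_imp_convex subspace_span)
    moreover have "continuous_on (?D \<inter> span B) \<psi>"
      using continuous_on_subset[OF smooth_open_continuous_on[OF \<psi>(3)]] r(2) by blast
    ultimately show ?thesis using connected_continuous_image by metis
  qed
  have fst_im: "fst ` proj_embed ` \<gamma> = fst ` \<gamma>" for \<gamma> :: "'n framed_point set"
    by (force simp: proj_embed_def)
  have "openin (top_of_set (fst ` \<alpha>)) (fst ` (?S \<inter> U0))"
    by (rule homeomorphism_imp_open_map[OF g(1)]) (use oU0 in \<open>auto simp: openin_open\<close>)
  then obtain U1 where U1: "open U1" "fst ` \<beta> = fst ` \<alpha> \<inter> U1"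
    unfolding openin_open using fst_im[of \<beta>] im by auto
  have "homeomorphism (?S \<inter> U0) (fst ` \<beta>) fst g"
    by (rule homeomorphism_of_subsets[OF g(1)]) (use fst_im[of \<beta>] im U1 in auto)
  then have "diffeomorphism (proj_embed ` \<beta>) (fst ` \<beta>) fst g"
    unfolding diffeomorphism_def im
    using smooth_on_subset[OF g(2), of "?S \<inter> U0"] smooth_on_subset[OF g(3), of "fst ` \<beta>"] U1(2) by auto
  moreover have "\<forall>(A, L)\<in>\<beta>. {x + y |x y. x \<in> L \<and> y \<in> tangent_space (fst ` \<beta>) A} = UNIV"
  proof (rule ballI, rule case_prodI2)
    fix q A L assume "q \<in> \<beta>" "q = (A, L)"
    then have AL: "(A, L) \<in> \<beta>" "(A, L) \<in> \<alpha>" by (auto simp: \<beta>_def)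
    have "A \<in> U1" using AL(1) U1(2) by force
    then have "tangent_space (fst ` \<alpha>) A \<subseteq> tangent_space (fst ` \<beta>) A"
      using tangent_space_Int_open[OF U1(1)] U1(2) by metis
    then have sub: "{x + y |x y. x \<in> L \<and> y \<in> tangent_space (fst ` \<alpha>) A} \<subseteq> {x + y |x y. x \<in> L \<and> y \<in> tangent_space (fst ` \<beta>) A}"
      by blast
    have e: "{x + y |x y. x \<in> L \<and> y \<in> tangent_space (fst ` \<alpha>) A} = UNIV"
      using bspec[OF tr AL(2)] unfolding prod.case .
    show "{x + y |x y. x \<in> L \<and> y \<in> tangent_space (fst ` \<beta>) A} = UNIV"
      by (rule top.extremum_uniqueI) (rule sub[unfolded e])
  qed
  moreover have "\<beta> \<subseteq> proj_tangent_bundle" using tb by (auto simp: \<beta>_def)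
  moreover have "embedded_submanifold (CARD('n) - 1) (proj_embed ` \<beta>)"
    unfolding im by (rule embedded_submanifold_Int_open[OF em oU0])
  moreover have "embedded_submanifold (CARD('n) - 1) (fst ` \<beta>)"
    unfolding U1(2) by (rule embedded_submanifold_Int_open[OF em' U1(1)])
  moreover have "connected (proj_embed ` \<beta>)" unfolding im by (rule conn)
  ultimately have "line_framed_hypersurface \<beta>"
    unfolding line_framed_hypersurface_def by blast
  moreover have "same_germ p \<alpha> \<beta>" unfolding same_germ_def
    by (rule exI[of _ U0]) (use oU0 pU0 in \<open>auto simp: \<beta>_def\<close>)
  moreover have "p \<in> \<beta>" using p pU0 by (simp add: \<beta>_def)
  moreover have "proj_embed ` \<beta> \<subseteq> W" unfolding im using U0W by blast
  ultimately show thesis using that by blast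
qed

text \<open>The chart of the product that detects positive measure is arbitrary and need not respect
  the two factors. \<open>X\<close> keeps only the two base points, and lifting tangent vectors one
  factor at a time shows that its derivative reaches all tangent pairs.\<close>

lemma product_parametrization:
  fixes \<beta>0 \<beta>1 :: "'n::finite framed_point set"
  assumes \<beta>: "line_framed_hypersurface \<beta>0" "line_framed_hypersurface \<beta>1"
    and ch: "slice_chart m (proj_embed ` \<beta>0 \<times> proj_embed ` \<beta>1) U V \<phi> B"
  obtains X where "open V" "B \<subseteq> Basis" "smooth_open V X"
    "\<And>z v w. z \<in> V \<inter> span B \<Longrightarrow> v \<in> tangent_space (fst ` \<beta>0) (fst (X z)) \<Longrightarrow>
        w \<in> tangent_space (fst ` \<beta>1) (snd (X z)) \<Longrightarrow> \<exists>\<xi>\<in>span B. frechet_derivative X (at z) \<xi> = (v, w)"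
    "\<And>x y. x \<in> \<beta>0 \<Longrightarrow> y \<in> \<beta>1 \<Longrightarrow> (proj_embed x, proj_embed y) \<in> U \<Longrightarrow>
        \<phi> (proj_embed x, proj_embed y) \<in> V \<inter> span B \<and> X (\<phi> (proj_embed x, proj_embed y)) = (fst x, fst y)"
proof -
  let ?S = "proj_embed ` \<beta>0 \<times> proj_embed ` \<beta>1"
  obtain \<psi> where \<psi>: "homeomorphism U V \<phi> \<psi>" "smooth_open U \<phi>" "smooth_open V \<psi>"
    and UV: "open U" "open V" "B \<subseteq> Basis" "\<phi> ` (U \<inter> ?S) = V \<inter> span B"
    using smooth_on_open_slice[OF ch] .
  define X where "X = (\<lambda>z. (fst (fst (\<psi> z)), fst (snd (\<psi> z))))"
  show thesis
  proof (rule that[of X])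
    show "smooth_open V X" unfolding X_def
      by (intro smooth_open_Pair smooth_open_fst smooth_open_snd \<psi>)
    show "\<exists>\<xi>\<in>span B. frechet_derivative X (at z) \<xi> = (v, w)"
      if z: "z \<in> V \<inter> span B" and v: "v \<in> tangent_space (fst ` \<beta>0) (fst (X z))"
        and w: "w \<in> tangent_space (fst ` \<beta>1) (snd (X z))" for z v w
    proof -
      have "z \<in> \<phi> ` (U \<inter> ?S)" unfolding UV(4) by (rule z)
      then obtain y where y: "z = \<phi> y" "y \<in> U \<inter> ?S" by (rule imageE)
      have "\<psi> z = y" unfolding y(1) using homeomorphism_apply1[OF \<psi>(1)] y(2) by blast
      then have zS: "fst (\<psi> z) \<in> proj_embed ` \<beta>0" "snd (\<psi> z) \<in> proj_embed ` \<beta>1" using y(2) by auto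
      obtain s0 s0' where s0: "s0 (0::real) = fst (\<psi> z)" "(s0 has_vector_derivative s0') (at 0)"
          "\<forall>\<^sub>F t in nhds 0. s0 t \<in> proj_embed ` \<beta>0" "fst s0' = v"
        using tangent_space_framed_lift[OF \<beta>(1) zS(1), of v] v by (auto simp: X_def)
      obtain s1 s1' where s1: "s1 (0::real) = snd (\<psi> z)" "(s1 has_vector_derivative s1') (at 0)"
          "\<forall>\<^sub>F t in nhds 0. s1 t \<in> proj_embed ` \<beta>1" "fst s1' = w"
        using tangent_space_framed_lift[OF \<beta>(2) zS(2), of w] w by (auto simp: X_def)
      have ev: "\<forall>\<^sub>F t in nhds 0. (s0 t, s1 t) \<in> ?S" using s0(3) s1(3) by eventually_elim auto
      have "\<exists>\<xi>\<in>span B. frechet_derivative \<psi> (at z) \<xi> = (s0', s1')"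
        by (rule slice_chart_lift[OF \<psi> UV _ _ has_vector_derivative_Pair[OF s0(2) s1(2)] ev])
           (use z s0(1) s1(1) in auto)
      then obtain \<xi> where \<xi>: "\<xi> \<in> span B" "frechet_derivative \<psi> (at z) \<xi> = (s0', s1')" by blast
      have "(X has_derivative (\<lambda>h. (fst (fst (frechet_derivative \<psi> (at z) h)), fst (snd (frechet_derivative \<psi> (at z) h))))) (at z)"
        unfolding X_def using smooth_open_has_derivative[OF \<psi>(3), of z] z
        by (intro has_derivative_Pair has_derivative_fst has_derivative_snd) auto
      from fun_cong[OF frechet_derivative_at[OF this], of \<xi>] show ?thesis
        using \<xi> s0(4) s1(4) by (intro bexI[of _ \<xi>]) auto
    qed
    show "\<phi> (proj_embed x, proj_embed y) \<in> V \<inter> span B \<and> X (\<phi> (proj_embed x, proj_embed y)) = (fst x, fst y)"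
      if "x \<in> \<beta>0" "y \<in> \<beta>1" "(proj_embed x, proj_embed y) \<in> U" for x y
    proof -
      have "(proj_embed x, proj_embed y) \<in> U \<inter> ?S" using that by blast
      then have "\<phi> (proj_embed x, proj_embed y) \<in> V \<inter> span B" using UV(4) by blast
      moreover have "\<psi> (\<phi> (proj_embed x, proj_embed y)) = (proj_embed x, proj_embed y)"
        using homeomorphism_apply1[OF \<psi>(1) that(3)] .
      ultimately show ?thesis by (simp add: X_def proj_embed_def)
    qed
  qed (use UV in auto)
qed

section \<open>Triangular orbits\<close>

lemma orbit_vertex:
  fixes u n p q :: "'a::euclidean_space"
  assumes "n \<bullet> u = 1" "L = span {u}" "H = {v. n \<bullet> v = 0}"
    and "\<not> span {p} \<subseteq> H" "\<not> span {q} \<subseteq> H" "symmetric_lines L H (span {p}) (span {q})"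
  shows "n \<bullet> p \<noteq> 0" "n \<bullet> q \<noteq> 0" "cproj n p + cproj n q = 2 *\<^sub>R u"
proof -
  show np: "n \<bullet> p \<noteq> 0" "n \<bullet> q \<noteq> 0" using assms(3-5) by (auto simp: span_singleton)
  show "cproj n p + cproj n q = 2 *\<^sub>R u"
    using symmetric_lines_cproj[OF _ assms(1) np] assms(2,3,6) by simp
qed

lemma periodic_orbit_3:
  assumes "periodic_orbit 3 \<beta> q"
  defines "A \<equiv> \<lambda>j. fst (q j)" and "H \<equiv> \<lambda>j. tangent_space (fst ` \<beta> j) (fst (q j))"
  shows "q 0 \<in> \<beta> 0" "q 1 \<in> \<beta> 1" "q 2 \<in> \<beta> 2"
    "\<not> span {A 1 - A 0} \<subseteq> H 0" "\<not> span {A 2 - A 0} \<subseteq> H 0"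
    "symmetric_lines (snd (q 0)) (H 0) (span {A 2 - A 0}) (span {A 1 - A 0})"
    "\<not> span {A 0 - A 1} \<subseteq> H 1" "\<not> span {A 2 - A 1} \<subseteq> H 1"
    "symmetric_lines (snd (q 1)) (H 1) (span {A 0 - A 1}) (span {A 2 - A 1})"
    "\<not> span {A 0 - A 2} \<subseteq> H 2" "\<not> span {A 1 - A 2} \<subseteq> H 2"
    "symmetric_lines (snd (q 2)) (H 2) (span {A 1 - A 2}) (span {A 0 - A 2})"
proof -
  note po = assms(1)[unfolded periodic_orbit_def Let_def, rule_format]
  show "q 0 \<in> \<beta> 0" "\<not> span {A 1 - A 0} \<subseteq> H 0" "\<not> span {A 2 - A 0} \<subseteq> H 0"
    "symmetric_lines (snd (q 0)) (H 0) (span {A 2 - A 0}) (span {A 1 - A 0})"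
    using po[of 0] by (simp_all add: A_def H_def)
  show "q 1 \<in> \<beta> 1" "\<not> span {A 0 - A 1} \<subseteq> H 1" "\<not> span {A 2 - A 1} \<subseteq> H 1"
    "symmetric_lines (snd (q 1)) (H 1) (span {A 0 - A 1}) (span {A 2 - A 1})"
    using po[of 1] by (simp_all add: A_def H_def numeral_2_eq_2)
  show "q 2 \<in> \<beta> 2" "\<not> span {A 0 - A 2} \<subseteq> H 2" "\<not> span {A 1 - A 2} \<subseteq> H 2"
    "symmetric_lines (snd (q 2)) (H 2) (span {A 1 - A 2}) (span {A 0 - A 2})"
    using po[of 2] by (simp_all add: A_def H_def)
qed

lemma open_nonzero: "open S \<Longrightarrow> smooth_open S f \<Longrightarrow> open {x\<in>S. f x \<noteq> (0::real)}"
  using continuous_open_preimage[OF smooth_open_continuous_on, of S f "- {0}"]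
  by (simp add: Int_def vimage_def open_Compl)

text \<open>Equality case of Cauchy-Schwarz, in the polynomial form in which the Gram determinant
  \<open>D\<close> of the edge directions at \<open>C\<close> appears below.\<close>

lemma parallel_if_gram_0:
  fixes g g' :: "'a::euclidean_space"
  assumes "g \<noteq> 0" "g' \<noteq> 0" "(g' \<bullet> g') * (g \<bullet> g) - (g \<bullet> g') * (g \<bullet> g') = 0"
  obtains \<mu> where "g' = \<mu> *\<^sub>R g"
proof -
  let ?k = "(g \<bullet> g) *\<^sub>R g' - (g \<bullet> g') *\<^sub>R g"
  have "?k \<bullet> ?k = (g \<bullet> g) * ((g' \<bullet> g') * (g \<bullet> g) - (g \<bullet> g') * (g \<bullet> g'))"
    by (simp add: inner_diff_left inner_diff_right inner_commute[of g' g] algebra_simps)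
  then have "?k = 0" unfolding assms(3) by simp
  then have k: "(g \<bullet> g) *\<^sub>R g' = (g \<bullet> g') *\<^sub>R g" by simp
  have "g' = inverse (g \<bullet> g) *\<^sub>R ((g \<bullet> g) *\<^sub>R g')" using assms(1) by simp
  also have "\<dots> = ((g \<bullet> g') / (g \<bullet> g)) *\<^sub>R g" unfolding k by (simp add: divide_inverse mult.commute)
  finally have "g' = ((g \<bullet> g') / (g \<bullet> g)) *\<^sub>R g" .
  then show thesis using that by blast
qed

text \<open>A non-null set of orbits could be cut down around suitable points until the normals, the
  lines and the third vertex are smooth and no denominator vanishes, which is the situation of
  \<open>triangle_family\<close>.\<close>

lemma triangular_orbits_null:
  fixes \<beta> :: "nat \<Rightarrow> 'n::finite framed_point set" and X :: "'e::euclidean_space \<Rightarrow> (real^'n) \<times> (real^'n)"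
  assumes card: "CARD('n) \<ge> 3"
    and lf: "line_framed_hypersurface (\<beta> 0)" "line_framed_hypersurface (\<beta> 1)" "line_framed_hypersurface (\<beta> 2)"
    and V: "open V" "E \<subseteq> Basis" "smooth_open V X"
    and lift: "\<And>z v w. z \<in> V \<inter> span E \<Longrightarrow> v \<in> tangent_space (fst ` \<beta> 0) (fst (X z)) \<Longrightarrow>
        w \<in> tangent_space (fst ` \<beta> 1) (snd (X z)) \<Longrightarrow> \<exists>\<xi>\<in>span E. frechet_derivative X (at z) \<xi> = (v, w)"
  shows "param_null E V X {x. \<exists>q. periodic_orbit 3 \<beta> q \<and> fst (q 0) = fst x \<and> fst (q 1) = snd x}"
proof (rule ccontr)
  define O1 where "O1 = {x. \<exists>q. periodic_orbit 3 \<beta> q \<and> fst (q 0) = fst x \<and> fst (q 1) = snd x}"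
  let ?null = "param_null E V X"
  assume "\<not> ?null {x. \<exists>q. periodic_orbit 3 \<beta> q \<and> fst (q 0) = fst x \<and> fst (q 1) = snd x}"
  then have "\<not> ?null O1" by (simp add: O1_def)
  then obtain x0 where x0: "x0 \<in> O1" and loc0: "\<And>W. open W \<Longrightarrow> x0 \<in> W \<Longrightarrow> \<not> ?null (O1 \<inter> W)"
    using not_param_null_localize by blast
  have dim: "DIM(real^'n) \<ge> 3" using card by simp
  have O1_a: "fst x \<in> fst ` \<beta> 0" "snd x \<in> fst ` \<beta> 1" if x: "x \<in> O1" for x
  proof -
    obtain q where q: "periodic_orbit 3 \<beta> q" "fst (q 0) = fst x" "fst (q 1) = snd x"
      using x unfolding O1_def by blast
    show "fst x \<in> fst ` \<beta> 0" "snd x \<in> fst ` \<beta> 1"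
      unfolding q(2,3)[symmetric] by (intro imageI periodic_orbit_3(1,2)[OF q(1)])+
  qed
  obtain WA nA uA fA \<rho>A where WA: "open WA" "fst x0 \<in> WA" "smooth_open WA nA" "smooth_open WA uA" "smooth_open WA fA"
      "\<And>P. P \<in> WA \<Longrightarrow> (fA has_derivative (\<lambda>v. \<rho>A P * (nA P \<bullet> v))) (at P)" "\<And>P. P \<in> WA \<Longrightarrow> \<rho>A P \<noteq> 0"
    and dA: "\<And>A L. (A, L) \<in> \<beta> 0 \<Longrightarrow> A \<in> WA \<Longrightarrow> nA A \<bullet> uA A = 1 \<and> L = span {uA A} \<and>
        tangent_space (fst ` \<beta> 0) A = {v. nA A \<bullet> v = 0} \<and> fA A = (0::real)"
    by (rule line_framed_hypersurface_local[OF lf(1) O1_a(1)[OF x0]]) (rule that)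
  obtain WB nB uB fB \<rho>B where WB: "open WB" "snd x0 \<in> WB" "smooth_open WB nB" "smooth_open WB uB" "smooth_open WB fB"
      "\<And>P. P \<in> WB \<Longrightarrow> (fB has_derivative (\<lambda>v. \<rho>B P * (nB P \<bullet> v))) (at P)" "\<And>P. P \<in> WB \<Longrightarrow> \<rho>B P \<noteq> 0"
    and dB: "\<And>A L. (A, L) \<in> \<beta> 1 \<Longrightarrow> A \<in> WB \<Longrightarrow> nB A \<bullet> uB A = 1 \<and> L = span {uB A} \<and>
        tangent_space (fst ` \<beta> 1) A = {v. nB A \<bullet> v = 0} \<and> fB A = (0::real)"
    by (rule line_framed_hypersurface_local[OF lf(2) O1_a(2)[OF x0]]) (rule that)
  define O2 where "O2 = O1 \<inter> (WA \<times> WB)"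
  have "\<not> ?null O2" unfolding O2_def by (rule loc0) (use WA WB in \<open>auto simp: open_Times mem_Times_iff\<close>)
  have tangent: "tangent_space (fst ` \<beta> 0) (fst x) = {v. nA (fst x) \<bullet> v = 0}"
      "tangent_space (fst ` \<beta> 1) (snd x) = {v. nB (snd x) \<bullet> v = 0}"
      "nA (fst x) \<bullet> uA (fst x) = 1" "nB (snd x) \<bullet> uB (snd x) = 1" if "x \<in> O2" for x
  proof -
    have x: "x \<in> O1" "fst x \<in> WA" "snd x \<in> WB" using that by (auto simp: O2_def)
    obtain L where "(fst x, L) \<in> \<beta> 0" using O1_a(1)[OF x(1)] by force
    from dA[OF this x(2)] show "tangent_space (fst ` \<beta> 0) (fst x) = {v. nA (fst x) \<bullet> v = 0}"
      "nA (fst x) \<bullet> uA (fst x) = 1" by auto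
    obtain L' where "(snd x, L') \<in> \<beta> 1" using O1_a(2)[OF x(1)] by force
    from dB[OF this x(3)] show "tangent_space (fst ` \<beta> 1) (snd x) = {v. nB (snd x) \<bullet> v = 0}"
      "nB (snd x) \<bullet> uB (snd x) = 1" by auto
  qed
  have null_deriv: "?null {x\<in>Z. \<exists>a b. nA (fst x) \<bullet> a = 0 \<and> nB (snd x) \<bullet> b = 0 \<and> frechet_derivative F (at x) (a, b) \<noteq> 0}"
    if U: "open U" "smooth_open U F" and Z: "Z \<subseteq> U" "Z \<subseteq> O2" "\<And>x. x \<in> Z \<Longrightarrow> F x = (0::real)" for U F Z
  proof -
    have "?null {x\<in>Z. \<exists>v\<in>{v. nA (fst x) \<bullet> fst v = 0 \<and> nB (snd x) \<bullet> snd v = 0}. frechet_derivative F (at x) v \<noteq> 0}"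
    proof (rule param_null_deriv[OF V U Z(1,3)])
      fix z v assume z: "z \<in> V \<inter> span E" "X z \<in> Z" "v \<in> {v. nA (fst (X z)) \<bullet> fst v = 0 \<and> nB (snd (X z)) \<bullet> snd v = 0}"
      have "X z \<in> O2" using z Z by blast
      then show "\<exists>\<xi>\<in>span E. frechet_derivative X (at z) \<xi> = v"
        using lift[OF z(1), of "fst v" "snd v"] tangent z(3) by simp
    qed
    then show ?thesis by (rule param_null_subset) auto
  qed

  \<comment> \<open>By the laws at \<open>A\<close> and \<open>B\<close>, \<open>G\<close> and
    \<open>G'\<close> are the normalized directions from these vertices to \<open>C\<close>,
    computed without knowing \<open>C\<close>. Their Gram determinant \<open>D\<close> vanishes if
    they are parallel.\<close>
  define G where "G = (\<lambda>x. 2 *\<^sub>R uA (fst x) - cproj (nA (fst x)) (snd x - fst x))"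
  define G' where "G' = (\<lambda>x. 2 *\<^sub>R uB (snd x) - cproj (nB (snd x)) (fst x - snd x))"
  define D where "D = (\<lambda>x. (G' x \<bullet> G' x) * (G x \<bullet> G x) - (G x \<bullet> G' x) * (G x \<bullet> G' x))"
  define U0 where "U0 = {x\<in>WA \<times> WB. nA (fst x) \<bullet> (snd x - fst x) \<noteq> 0}"
  define U1 where "U1 = {x\<in>U0. nB (snd x) \<bullet> (fst x - snd x) \<noteq> 0}"
  define U2 where "U2 = {x\<in>U1. D x \<noteq> 0}"
  have sAB: "smooth_open S (\<lambda>x. nA (fst x))" "smooth_open S (\<lambda>x. uA (fst x))"
      "smooth_open S (\<lambda>x. nB (snd x))" "smooth_open S (\<lambda>x. uB (snd x))" if "S \<subseteq> WA \<times> WB" for S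
    by (rule smooth_open_compose[OF WA(3) smooth_open_fst[OF smooth_open_ident]]
      smooth_open_compose[OF WA(4) smooth_open_fst[OF smooth_open_ident]]
      smooth_open_compose[OF WB(3) smooth_open_snd[OF smooth_open_ident]]
      smooth_open_compose[OF WB(4) smooth_open_snd[OF smooth_open_ident]], use that in auto)+
  note si = smooth_open_diff smooth_open_inner smooth_open_fst smooth_open_snd smooth_open_ident
    smooth_open_scaleR smooth_open_const smooth_open_cproj smooth_open_mult smooth_open_add smooth_open_divide
  have oWW: "open (WA \<times> WB)" using WA WB by (intro open_Times)
  have oU0: "open U0" unfolding U0_def by (intro open_nonzero oWW si sAB order_refl)
  have U01: "U1 \<subseteq> U0" "U0 \<subseteq> WA \<times> WB" "U2 \<subseteq> U1" by (auto simp: U0_def U1_def U2_def)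
  have nz1: "nA (fst x) \<bullet> (snd x - fst x) \<noteq> 0" if "x \<in> U0" for x using that by (simp add: U0_def)
  have nz2: "nB (snd x) \<bullet> (fst x - snd x) \<noteq> 0" if "x \<in> U1" for x using that by (simp add: U1_def)
  note sAB0 = sAB[OF U01(2)] and sAB1 = sAB[OF subset_trans[OF U01(1,2)]]
  have oU1: "open U1" unfolding U1_def by (intro open_nonzero oU0 si sAB0)
  have sG: "smooth_open U1 G" "smooth_open U1 G'"
    unfolding G_def G'_def by (intro si sAB1 nz1 nz2 subsetD[OF U01(1)]; assumption)+
  have sD: "smooth_open U1 D" unfolding D_def by (intro si sG)
  have oU2: "open U2" unfolding U2_def by (intro open_nonzero oU1 sD)

  have vertex: "nA (fst x) \<bullet> (snd x - fst x) \<noteq> 0" "nA (fst x) \<bullet> (c - fst x) \<noteq> 0"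
      "cproj (nA (fst x)) (snd x - fst x) + cproj (nA (fst x)) (c - fst x) = 2 *\<^sub>R uA (fst x)"
      "nB (snd x) \<bullet> (fst x - snd x) \<noteq> 0" "nB (snd x) \<bullet> (c - snd x) \<noteq> 0"
      "cproj (nB (snd x)) (fst x - snd x) + cproj (nB (snd x)) (c - snd x) = 2 *\<^sub>R uB (snd x)"
    if x: "x \<in> O2" and q: "periodic_orbit 3 \<beta> q" "fst (q 0) = fst x" "fst (q 1) = snd x" "fst (q 2) = c" for x q c
  proof -
    note o3 = periodic_orbit_3[OF q(1), unfolded q(2-4)]
    have "fst x \<in> WA" "snd x \<in> WB" using x by (auto simp: O2_def)
    moreover have "(fst x, snd (q 0)) \<in> \<beta> 0" "(snd x, snd (q 1)) \<in> \<beta> 1"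
      using o3(1,2) q(2,3) by (metis prod.collapse)+
    ultimately have d: "nA (fst x) \<bullet> uA (fst x) = 1" "snd (q 0) = span {uA (fst x)}"
        "tangent_space (fst ` \<beta> 0) (fst x) = {v. nA (fst x) \<bullet> v = 0}"
        "nB (snd x) \<bullet> uB (snd x) = 1" "snd (q 1) = span {uB (snd x)}"
        "tangent_space (fst ` \<beta> 1) (snd x) = {v. nB (snd x) \<bullet> v = 0}"
      using dA dB by blast+
    show "nA (fst x) \<bullet> (snd x - fst x) \<noteq> 0" "nA (fst x) \<bullet> (c - fst x) \<noteq> 0"
      "cproj (nA (fst x)) (snd x - fst x) + cproj (nA (fst x)) (c - fst x) = 2 *\<^sub>R uA (fst x)"
      using orbit_vertex[OF d(1-3) o3(5,4,6)] by (simp_all add: add.commute)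
    show "nB (snd x) \<bullet> (fst x - snd x) \<noteq> 0" "nB (snd x) \<bullet> (c - snd x) \<noteq> 0"
      "cproj (nB (snd x)) (fst x - snd x) + cproj (nB (snd x)) (c - snd x) = 2 *\<^sub>R uB (snd x)"
      using orbit_vertex[OF d(4-6) o3(7-9)] by simp_all
  qed
  have orbitE: "\<exists>q. periodic_orbit 3 \<beta> q \<and> fst (q 0) = fst x \<and> fst (q 1) = snd x" if "x \<in> O2" for x
    using that by (auto simp: O2_def O1_def)

  \<comment> \<open>Collinear triangles: all vertices lie on L_A, and the laws at \<open>A\<close>
    and \<open>B\<close> leave the position of \<open>C\<close> on that line open.\<close>
  define col where "col = {x\<in>O2. cproj (nA (fst x)) (snd x - fst x) = uA (fst x)}"
  have col: "?null col"
  proof -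
    define F where "F = (\<lambda>x. cproj (nA (fst x)) (snd x - fst x) - uA (fst x))"
    have sF: "smooth_open U0 F" unfolding F_def by (intro si sAB0 nz1; assumption)
    have colU: "col \<subseteq> U0" using vertex(1) orbitE by (force simp: col_def U0_def O2_def)
    let ?bad = "\<lambda>i. {x\<in>col. \<exists>a b. nA (fst x) \<bullet> a = 0 \<and> nB (snd x) \<bullet> b = 0 \<and>
      frechet_derivative (\<lambda>x. F x \<bullet> i) (at x) (a, b) \<noteq> 0}"
    have "?null (\<Union>i\<in>Basis. ?bad i)"
    proof (rule param_null_UN)
      show "?null (?bad i)" for i
        by (rule null_deriv[OF oU0 smooth_open_inner[OF sF smooth_open_const] colU]) (auto simp: col_def F_def)
    qed (simp add: countable_finite)
    moreover have "col \<subseteq> (\<Union>i\<in>Basis. ?bad i)"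
    proof
      fix x assume x: "x \<in> col"
      then have xU: "x \<in> U0" and cx: "cproj (nA (fst x)) (snd x - fst x) = uA (fst x)"
        using colU by (auto simp: col_def)
      have nz: "nA (fst x) \<bullet> (snd x - fst x) \<noteq> 0" using xU by (simp add: U0_def)
      \<comment> \<open>Moving \<open>B\<close> along this tangent vector takes it off L_A to first
        order, so the equation defining \<open>col\<close> has a nonzero tangential derivative at
        every point of \<open>col\<close>.\<close>
      obtain b where b: "b \<noteq> 0" "b \<bullet> nB (snd x) = 0" "b \<bullet> uA (fst x) = 0"
        using exists_orthogonal_pair[OF dim] by metis
      have fx: "fst x \<in> WA" using xU by (auto simp: U0_def)
      have "(F has_derivative (\<lambda>h. dcproj (nA (fst x)) (frechet_derivative nA (at (fst x)) (fst h)) (snd x - fst x) (snd h - fst h)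
          - frechet_derivative uA (at (fst x)) (fst h))) (at x)"
        unfolding F_def
        using has_derivative_compose[OF has_derivative_fst[OF has_derivative_ident] smooth_open_has_derivative[OF WA(3) fx]]
          has_derivative_compose[OF has_derivative_fst[OF has_derivative_ident] smooth_open_has_derivative[OF WA(4) fx]] nz
        by (intro has_derivative_diff has_derivative_cproj has_derivative_fst has_derivative_snd has_derivative_ident) (simp_all add: o_def)
      from fun_cong[OF frechet_derivative_at[OF this], of "(0, b)"]
      have dF: "frechet_derivative F (at x) (0, b) = dcproj (nA (fst x)) 0 (snd x - fst x) b"
        using linear_0[OF has_derivative_linear[OF smooth_open_has_derivative[OF WA(3) fx]]]
          linear_0[OF has_derivative_linear[OF smooth_open_has_derivative[OF WA(4) fx]]] by simp
      have "frechet_derivative F (at x) (0, b) \<noteq> 0"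
      proof
        assume "frechet_derivative F (at x) (0, b) = 0"
        then have "b = (nA (fst x) \<bullet> b) *\<^sub>R uA (fst x)"
          using dcproj_0_eq[OF nz, of b] unfolding dF cx by simp
        then have "b \<bullet> b = 0" using b(3) by (metis inner_scaleR_right mult_zero_right)
        then show False using b(1) by simp
      qed
      then obtain i where "i \<in> Basis" "frechet_derivative F (at x) (0, b) \<bullet> i \<noteq> 0"
        by (metis euclidean_all_zero_iff)
      then have "i \<in> Basis" "frechet_derivative (\<lambda>x. F x \<bullet> i) (at x) (0, b) \<noteq> 0"
        using frechet_derivative_inner_const[OF sF xU] by auto
      then show "x \<in> (\<Union>i\<in>Basis. ?bad i)"
        using x b(2) by (intro UN_I[of i] CollectI conjI exI[of _ 0] exI[of _ b]) (auto simp: inner_commute)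
    qed
    ultimately show ?thesis by (rule param_null_subset)
  qed
  define O3 where "O3 = O2 - col"
  have "\<not> ?null O3"
  proof
    assume "?null O3"
    from param_null_Un[OF this col] have "?null O2" by (rule param_null_subset) (auto simp: O3_def)
    then show False using \<open>\<not> ?null O2\<close> by blast
  qed
  \<comment> \<open>A second localization is required: data for the third hypersurface can be chosen
    only near a definite point \<open>C x1\<close>.\<close>
  then obtain x1 where x1: "x1 \<in> O3" and loc1: "\<And>W. open W \<Longrightarrow> x1 \<in> W \<Longrightarrow> \<not> ?null (O3 \<inter> W)"
    using not_param_null_localize by blast

  \<comment> \<open>Cramer's rule for
    \<open>snd x - fst x = ga *\<^sub>R G x - gb *\<^sub>R G' x\<close>: the vector paired with
    \<open>snd x - fst x\<close> is orthogonal to \<open>G' x\<close>, which leaves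
    \<open>ga * D x\<close>.\<close>
  define C where "C = (\<lambda>x. fst x +
     (((G' x \<bullet> G' x) *\<^sub>R G x - (G x \<bullet> G' x) *\<^sub>R G' x) \<bullet> (snd x - fst x) / D x) *\<^sub>R G x)"
  have sC: "smooth_open U2 C" unfolding C_def
    by (intro si smooth_open_subset[OF sG(1) U01(3)] smooth_open_subset[OF sG(2) U01(3)]
        smooth_open_subset[OF sD U01(3)]) (simp add: U2_def)
  have third: "x \<in> U2 \<and> c = C x"
    if x: "x \<in> O3" and q: "periodic_orbit 3 \<beta> q" "fst (q 0) = fst x" "fst (q 1) = snd x" "fst (q 2) = c" for x q c
  proof -
    have x2: "x \<in> O2" "x \<notin> col" using x by (auto simp: O3_def)
    note v = vertex[OF x2(1) q]
    have xU1: "x \<in> U1" using v x2 by (auto simp: U1_def U0_def O2_def)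
    define ga gb where "ga = nA (fst x) \<bullet> (c - fst x)" and "gb = nB (snd x) \<bullet> (c - snd x)"
    have "G x = cproj (nA (fst x)) (c - fst x)" unfolding G_def using v(3) by (simp add: algebra_simps)
    then have G: "c - fst x = ga *\<^sub>R G x" using v(2) by (simp add: cproj_def ga_def)
    have "G' x = cproj (nB (snd x)) (c - snd x)" unfolding G'_def using v(6) by (simp add: algebra_simps)
    then have G': "c - snd x = gb *\<^sub>R G' x" using v(5) by (simp add: cproj_def gb_def)
    have nz: "ga \<noteq> 0" "gb \<noteq> 0" using v by (auto simp: ga_def gb_def)
    have nG: "nA (fst x) \<bullet> G x = 1" using G nz by (metis ga_def inner_scaleR_right mult_cancel_left1)
    have nG': "nB (snd x) \<bullet> G' x = 1" using G' nz by (metis gb_def inner_scaleR_right mult_cancel_left1)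
    have e: "snd x - fst x = ga *\<^sub>R G x - gb *\<^sub>R G' x" unfolding G[symmetric] G'[symmetric] by simp
    \<comment> \<open>If the edges at \<open>C\<close> were parallel, \<open>G x\<close> would also
      be the normalized direction from \<open>A\<close> to \<open>B\<close>, and the law at
      \<open>A\<close> would put \<open>x\<close> into \<open>col\<close>.\<close>
    have D: "D x \<noteq> 0"
    proof
      assume "D x = 0"
      moreover have "G x \<noteq> 0" "G' x \<noteq> 0" using nG nG' by auto
      ultimately obtain \<mu> where \<mu>: "G' x = \<mu> *\<^sub>R G x" using parallel_if_gram_0 unfolding D_def by metis
      have e2: "snd x - fst x = (ga - gb * \<mu>) *\<^sub>R G x" unfolding e \<mu> by (simp add: scaleR_diff_left)
      have "ga - gb * \<mu> \<noteq> 0" using v(1) unfolding e2 by auto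
      then have "cproj (nA (fst x)) (snd x - fst x) = G x" unfolding e2 by (simp add: cproj_def nG)
      then have "2 *\<^sub>R G x = 2 *\<^sub>R uA (fst x)" unfolding G_def by (simp add: scaleR_2)
      then have "cproj (nA (fst x)) (snd x - fst x) = uA (fst x)"
        using \<open>cproj (nA (fst x)) (snd x - fst x) = G x\<close> by simp
      then show False using x2 by (simp add: col_def)
    qed
    have "((G' x \<bullet> G' x) *\<^sub>R G x - (G x \<bullet> G' x) *\<^sub>R G' x) \<bullet> (snd x - fst x) = ga * D x"
      unfolding e D_def by (simp add: inner_diff_left inner_diff_right inner_commute[of "G' x" "G x"] algebra_simps)
    then have "C x = fst x + ga *\<^sub>R G x" using D by (simp add: C_def)
    then show ?thesis using G D xU1 by (simp add: U2_def algebra_simps)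
  qed
  have O3O2: "x \<in> O2" if "x \<in> O3" for x using that by (simp add: O3_def)
  obtain q1 where q1: "periodic_orbit 3 \<beta> q1" "fst (q1 0) = fst x1" "fst (q1 1) = snd x1"
    using orbitE[OF O3O2[OF x1]] by blast
  have C1: "x1 \<in> U2" "fst (q1 2) = C x1" using third[OF x1 q1 refl] by auto
  have C1\<beta>: "C x1 \<in> fst ` \<beta> 2" using periodic_orbit_3(3)[OF q1(1)] C1(2) by (metis imageI)
  obtain WC nC uC fC \<rho>C where WC: "open WC" "C x1 \<in> WC" "smooth_open WC nC" "smooth_open WC uC" "smooth_open WC fC"
    and fC: "\<And>P. P \<in> WC \<Longrightarrow> (fC has_derivative (\<lambda>v. \<rho>C P * (nC P \<bullet> v))) (at P)" "\<And>P. P \<in> WC \<Longrightarrow> \<rho>C P \<noteq> 0"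
    and dC: "\<And>A L. (A, L) \<in> \<beta> 2 \<Longrightarrow> A \<in> WC \<Longrightarrow> nC A \<bullet> uC A = 1 \<and> L = span {uC A} \<and>
        tangent_space (fst ` \<beta> 2) A = {v. nC A \<bullet> v = 0} \<and> fC A = (0::real)"
    by (rule line_framed_hypersurface_local[OF lf(3) C1\<beta>]) (rule that)
  define U3 where "U3 = U2 \<inter> C -` WC"
  have U3: "open U3" "U3 \<subseteq> U2" unfolding U3_def
    using continuous_open_preimage[OF smooth_open_continuous_on[OF sC] oU2 WC(1)] by auto
  have sub3: "U3 \<subseteq> WA \<times> WB" "U3 \<subseteq> U1" using U3 U01 by blast+
  have sC3: "smooth_open U3 C" by (rule smooth_open_subset[OF sC U3(2)])
  have sn3: "smooth_open U3 (\<lambda>x. nC (C x))"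
    by (rule smooth_open_compose[OF WC(3) sC3]) (simp add: U3_def)
  define U where "U = {x\<in>U3. nA (fst x) \<bullet> (C x - fst x) \<noteq> 0 \<and> nB (snd x) \<bullet> (C x - snd x) \<noteq> 0 \<and>
      nC (C x) \<bullet> (fst x - C x) \<noteq> 0 \<and> nC (C x) \<bullet> (snd x - C x) \<noteq> 0}"
  have UU: "U \<subseteq> U3" by (auto simp: U_def)
  have oU: "open U"
  proof -
    let ?F = "\<lambda>x. (nA (fst x) \<bullet> (C x - fst x)) * (nB (snd x) \<bullet> (C x - snd x)) *
      (nC (C x) \<bullet> (fst x - C x)) * (nC (C x) \<bullet> (snd x - C x))"
    have eq: "U = {x\<in>U3. ?F x \<noteq> 0}" by (auto simp: U_def)
    have "smooth_open U3 ?F" by (intro si sAB sub3 sC3 sn3)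
    then show ?thesis unfolding eq by (rule open_nonzero[OF U3(1)])
  qed
  have vertexC: "nC (C x) \<bullet> (fst x - C x) \<noteq> 0" "nC (C x) \<bullet> (snd x - C x) \<noteq> 0"
      "cproj (nC (C x)) (fst x - C x) + cproj (nC (C x)) (snd x - C x) = 2 *\<^sub>R uC (C x)" "fC (C x) = 0"
    if x: "x \<in> U3" and q: "periodic_orbit 3 \<beta> q" "fst (q 0) = fst x" "fst (q 1) = snd x" "fst (q 2) = C x" for x q
  proof -
    note o3 = periodic_orbit_3[OF q(1), unfolded q(2-4)]
    have "C x \<in> WC" using x by (simp add: U3_def)
    moreover have "(C x, snd (q 2)) \<in> \<beta> 2" using o3(3) q(4) by (metis prod.collapse)
    ultimately have d: "nC (C x) \<bullet> uC (C x) = 1" "snd (q 2) = span {uC (C x)}"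
        "tangent_space (fst ` \<beta> 2) (C x) = {v. nC (C x) \<bullet> v = 0}" "fC (C x) = 0"
      using dC by blast+
    show "nC (C x) \<bullet> (fst x - C x) \<noteq> 0" "nC (C x) \<bullet> (snd x - C x) \<noteq> 0"
      "cproj (nC (C x)) (fst x - C x) + cproj (nC (C x)) (snd x - C x) = 2 *\<^sub>R uC (C x)" "fC (C x) = 0"
      using orbit_vertex[OF d(1-3) o3(11,10,12)] d(4) by (simp_all add: add.commute)
  qed
  have "x1 \<in> U3" using C1(1) WC(2) by (simp add: U3_def)
  then have x1U: "x1 \<in> U"
    using vertex[OF O3O2[OF x1] q1 C1(2)] vertexC[OF _ q1 C1(2)] by (simp add: U_def)
  define Y where "Y = O3 \<inter> U"
  have "\<not> ?null Y" unfolding Y_def by (rule loc1[OF oU x1U])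
  have orbitY: "\<exists>q. periodic_orbit 3 \<beta> q \<and> fst (q 0) = fst x \<and> fst (q 1) = snd x \<and> fst (q 2) = C x" if x: "x \<in> Y" for x
  proof -
    have x3: "x \<in> O3" using x by (simp add: Y_def)
    obtain q where q: "periodic_orbit 3 \<beta> q" "fst (q 0) = fst x" "fst (q 1) = snd x"
      using orbitE[OF O3O2[OF x3]] by blast
    then show ?thesis using third[OF x3 q refl] by (intro exI[of _ q]) simp
  qed
  have YO2: "x \<in> O2" "x \<in> U" "x \<in> U3" if "x \<in> Y" for x using that O3O2 UU by (auto simp: Y_def)
  interpret triangle_family ?null U Y WA WB WC nA uA nB uB nC uC fC \<rho>C C
  proof
    show "DIM(real^'n) \<ge> 3" by (rule dim)
    show "open U" "open WA" "open WB" "open WC" by fact+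
    show "fst x \<in> WA" "snd x \<in> WB" "C x \<in> WC" if "x \<in> U" for x
      using that UU sub3 by (auto simp: U3_def)
    show "smooth_open WA nA" "smooth_open WA uA" "smooth_open WB nB" "smooth_open WB uB"
      "smooth_open WC nC" "smooth_open WC uC" "smooth_open WC fC" by fact+
    show "smooth_open U C" by (rule smooth_open_subset[OF sC3 UU])
    show "(fC has_derivative (\<lambda>v. \<rho>C P * (nC P \<bullet> v))) (at P)" "\<rho>C P \<noteq> 0" if "P \<in> WC" for P
      using fC that by blast+
    show "?null T" if "?null S" "T \<subseteq> S" for S T using param_null_subset that by blast
    show "?null (S \<union> T)" if "?null S" "?null T" for S T using param_null_Un that by blast
    show "?null {}" by (rule param_null_empty)
    show "?null {x\<in>Z. \<exists>a b. nA (fst x) \<bullet> a = 0 \<and> nB (snd x) \<bullet> b = 0 \<and> frechet_derivative F (at x) (a, b) \<noteq> 0}"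
      if "smooth_open U F" "Z \<subseteq> Y" "\<forall>x\<in>Z. F x = (0::real)" for F Z
      by (rule null_deriv[OF oU that(1)]) (use that YO2 in auto)
    show "Y \<subseteq> U" by (simp add: Y_def)
    show "\<not> ?null Y" by fact
    show "nA (fst x) \<bullet> (snd x - fst x) \<noteq> 0" "nA (fst x) \<bullet> (C x - fst x) \<noteq> 0"
      "nB (snd x) \<bullet> (fst x - snd x) \<noteq> 0" "nB (snd x) \<bullet> (C x - snd x) \<noteq> 0"
      "nC (C x) \<bullet> (fst x - C x) \<noteq> 0" "nC (C x) \<bullet> (snd x - C x) \<noteq> 0" if "x \<in> U" for x
      using that UU sub3 by (auto simp: U_def U0_def U1_def)
    show "nA (fst x) \<bullet> uA (fst x) = 1" "nB (snd x) \<bullet> uB (snd x) = 1" if "x \<in> Y" for x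
      using tangent YO2(1) that by blast+
    show "cproj (nA (fst x)) (snd x - fst x) + cproj (nA (fst x)) (C x - fst x) = 2 *\<^sub>R uA (fst x)"
      "cproj (nB (snd x)) (fst x - snd x) + cproj (nB (snd x)) (C x - snd x) = 2 *\<^sub>R uB (snd x)" if x: "x \<in> Y" for x
      using orbitY[OF x] vertex(3,6)[OF YO2(1)[OF x]] by blast+
    show "cproj (nC (C x)) (fst x - C x) + cproj (nC (C x)) (snd x - C x) = 2 *\<^sub>R uC (C x)" "fC (C x) = 0"
      if x: "x \<in> Y" for x
      using orbitY[OF x] vertexC(3,4)[OF YO2(3)[OF x]] by blast+
  qed
  show False by (rule no_triangle_family)
qed

theorem theorem1p14:
  fixes \<alpha> :: "nat \<Rightarrow> 'n::finite framed_point set" and p :: "nat \<Rightarrow> 'n framed_point"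
  assumes "CARD('n) \<ge> 3"
    and "local_projective_billiard 3 \<alpha> p"
  shows "\<not> pseudo_reflective 3 \<alpha> p"
proof
  assume "pseudo_reflective 3 \<alpha> p"
  then obtain W where W: "\<forall>j<3. open (W j) \<and> proj_embed (p j) \<in> W j"
    and refl: "\<forall>\<beta>. local_projective_billiard 3 \<beta> p \<and>
        (\<forall>j<3. same_germ (p j) (\<alpha> j) (\<beta> j) \<and> proj_embed ` \<beta> j \<subseteq> W j) \<longrightarrow>
        (\<exists>P \<subseteq> \<beta> 0 \<times> \<beta> 1. positive_lebesgue_measure_in (2 * (CARD('n) - 1))
            (proj_embed ` \<beta> 0 \<times> proj_embed ` \<beta> 1) (map_prod proj_embed proj_embed ` P) \<and>
          (\<forall>(x, y)\<in>P. \<exists>q. q 0 = x \<and> q 1 = y \<and> periodic_orbit 3 \<beta> q))"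
    unfolding pseudo_reflective_def by (elim conjE exE)
  \<comment> \<open>\<open>refl\<close> speaks only of representatives inside \<open>W\<close>, so
    such representatives have to be produced before it yields any orbit.\<close>
  have "\<exists>\<beta>. line_framed_hypersurface \<beta> \<and> p j \<in> \<beta> \<and> same_germ (p j) (\<alpha> j) \<beta> \<and> proj_embed ` \<beta> \<subseteq> W j"
    if j: "j < 3" for j
  proof -
    have "line_framed_hypersurface (\<alpha> j)" "p j \<in> \<alpha> j" "open (W j)" "proj_embed (p j) \<in> W j"
      using assms(2) W j unfolding local_projective_billiard_def by blast+
    then show ?thesis by (rule line_framed_hypersurface_shrink) blast
  qed
  then obtain \<beta> where \<beta>: "\<And>j. j < 3 \<Longrightarrow> line_framed_hypersurface (\<beta> j) \<and> p j \<in> \<beta> j \<and>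
      same_germ (p j) (\<alpha> j) (\<beta> j) \<and> proj_embed ` \<beta> j \<subseteq> W j"
    by metis
  have "local_projective_billiard 3 \<beta> p" using \<beta> unfolding local_projective_billiard_def by blast
  moreover have "\<forall>j<3. same_germ (p j) (\<alpha> j) (\<beta> j) \<and> proj_embed ` \<beta> j \<subseteq> W j" using \<beta> by blast
  ultimately have "\<exists>P \<subseteq> \<beta> 0 \<times> \<beta> 1. positive_lebesgue_measure_in (2 * (CARD('n) - 1))
            (proj_embed ` \<beta> 0 \<times> proj_embed ` \<beta> 1) (map_prod proj_embed proj_embed ` P) \<and>
          (\<forall>(x, y)\<in>P. \<exists>q. q 0 = x \<and> q 1 = y \<and> periodic_orbit 3 \<beta> q)"
    by (intro refl[rule_format] conjI)
  then obtain P where P: "P \<subseteq> \<beta> 0 \<times> \<beta> 1"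
    and pos: "positive_lebesgue_measure_in (2 * (CARD('n) - 1))
            (proj_embed ` \<beta> 0 \<times> proj_embed ` \<beta> 1) (map_prod proj_embed proj_embed ` P)"
    and orb: "\<forall>(x, y)\<in>P. \<exists>q. q 0 = x \<and> q 1 = y \<and> periodic_orbit 3 \<beta> q"
    by (elim exE conjE) (rule that)
  have lf: "line_framed_hypersurface (\<beta> 0)" "line_framed_hypersurface (\<beta> 1)" "line_framed_hypersurface (\<beta> 2)"
    using \<beta> by simp_all
  let ?P = "map_prod proj_embed proj_embed ` P"
  obtain U V \<phi> B where ch: "slice_chart (2 * (CARD('n) - 1)) (proj_embed ` \<beta> 0 \<times> proj_embed ` \<beta> 1) U V \<phi> B"
    and pos': "emeasure (span_lebesgue B) (\<phi> ` (U \<inter> ?P)) > 0"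
    using pos unfolding positive_lebesgue_measure_in_def by blast
  obtain X where V: "open V" "B \<subseteq> Basis" "smooth_open V X"
    and lift: "\<And>z v w. z \<in> V \<inter> span B \<Longrightarrow> v \<in> tangent_space (fst ` \<beta> 0) (fst (X z)) \<Longrightarrow>
        w \<in> tangent_space (fst ` \<beta> 1) (snd (X z)) \<Longrightarrow> \<exists>\<xi>\<in>span B. frechet_derivative X (at z) \<xi> = (v, w)"
    and X: "\<And>x y. x \<in> \<beta> 0 \<Longrightarrow> y \<in> \<beta> 1 \<Longrightarrow> (proj_embed x, proj_embed y) \<in> U \<Longrightarrow>
        \<phi> (proj_embed x, proj_embed y) \<in> V \<inter> span B \<and> X (\<phi> (proj_embed x, proj_embed y)) = (fst x, fst y)"
    by (rule product_parametrization[OF lf(1,2) ch]) (rule that)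
  let ?O = "{x. \<exists>q. periodic_orbit 3 \<beta> q \<and> fst (q 0) = fst x \<and> fst (q 1) = snd x}"
  have "param_null B V X ?O" by (rule triangular_orbits_null[OF assms(1) lf V lift])
  moreover have "\<phi> ` (U \<inter> ?P) \<subseteq> {z\<in>V \<inter> span B. X z \<in> ?O}"
  proof
    fix z assume "z \<in> \<phi> ` (U \<inter> ?P)"
    then obtain x y where xy: "(x, y) \<in> P" "(proj_embed x, proj_embed y) \<in> U" "z = \<phi> (proj_embed x, proj_embed y)"
      by auto
    obtain q where q: "q 0 = x" "q 1 = y" "periodic_orbit 3 \<beta> q"
      using bspec[OF orb xy(1)] unfolding prod.case by (elim exE conjE) (rule that)
    have "z \<in> V \<inter> span B" "X z = (fst x, fst y)" using X[of x y] P xy by auto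
    then show "z \<in> {z\<in>V \<inter> span B. X z \<in> ?O}" using q by auto
  qed
  ultimately have "\<phi> ` (U \<inter> ?P) \<in> null_sets (span_lebesgue B)"
    unfolding param_null_def by (rule null_sets_span_lebesgue_subset)
  then show False using pos' by (simp add: null_sets_def)
qed

end
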